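(* Suppose $(\mathbf{L},\mathbf{p})$ is a Brascamp--Lieb datum (with $H=\mathbb{R}^n$, $H_j=\mathbb{R}^{n_j}$) for which $\mathrm{BL}(\mathbf{L},\mathbf{p})<\infty$. Put $n_j':=n-n_j$ and $V_j:=\ker L_j$. Then there exists $\nu>0$ such that for every $\varepsilon>0$ there is a constant $C_\varepsilon<\infty$ such that $$\int_{[-1,1]^n}\prod_{j=1}^m\Big(\sum_{T_j\in\mathbb{T}_j}\chi_{T_j}\Big)^{p_j}\leq C_\varepsilon\,\delta^{n-\varepsilon}\prod_{j=1}^m(\#\mathbb{T}_j)^{p_j}$$ holds for all $0<\delta\le 1$ and all finite collections $\mathbb{T}_j$, $1\le j\le m$, of $\delta$-neighbourhoods of $n_j'$-dimensional affine subspaces of $\mathbb{R}^n$ which, modulo translations, are within a distance $\nu$ of the fixed subspace $V_j$.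
   Context: A Brascamp--Lieb datum $(\mathbf{L},\mathbf{p})$ consists of an $m$-tuple $\mathbf{L}=(L_j)_{j=1}^m$ of surjective linear maps $L_j:\mathbb{R}^n\to\mathbb{R}^{n_j}$, $n_j\le n$, with $\bigcap_{j=1}^m\ker L_j=\{0\}$, and an $m$-tuple $\mathbf{p}=(p_j)_{j=1}^m$ of real exponents $0\le p_j\le 1$. The Brascamp--Lieb constant $\mathrm{BL}(\mathbf{L},\mathbf{p})\in[0,\infty]$ is the smallest constant $C$ for which $$\int_{\mathbb{R}^n}\prod_{j=1}^m (f_j\circ L_j)^{p_j}\leq C\prod_{j=1}^m\Big(\int_{\mathbb{R}^{n_j}}f_j\Big)^{p_j}$$ holds for all nonnegative $f_j\in L^1(\mathbb{R}^{n_j})$, $1\le j\le m$. Here $\chi_T$ is the characteristic function of $T$ and $\#\mathbb{T}_j$ is the number of elements of $\mathbb{T}_j$. "Modulo translations, within distance $\nu$ of $V_j$" means that the linear subspace parallel to the affine subspace lies within distance $\nu$ of $V_j$ in the standard metric on the Grassmann manifold of $n_j'$-dimensional subspaces of $\mathbb{R}^n$ (for instance, the operator norm of the difference of the orthogonal projections). *)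

theory Defs
  imports "HOL-Analysis.Analysis"
begin

text \<open>
  The codomains \<open>\<real>\<^bsup>k\<^esup>\<close> occur with varying \<open>k\<close>, so they are rendered as the finite product
  spaces of functions on \<open>{1..k}\<close> (value \<open>undefined\<close> elsewhere), with Borel Lebesgue measure.
  Working with Borel instead of Lebesgue representatives does not change \<open>L\<^sup>1\<close>. For \<open>k = 0\<close> this
  is a one-point space of mass 1.
\<close>

definition Rdim :: "nat \<Rightarrow> (nat \<Rightarrow> real) measure" where
  "Rdim k = Pi\<^sub>M {1..k} (\<lambda>_. lborel)"

lemma space_Rdim: "space (Rdim k) = ({1..k} \<rightarrow>\<^sub>E UNIV)"
  by (simp add: Rdim_def space_PiM)

definition surj_linear_map :: "nat \<Rightarrow> (real ^ 'n \<Rightarrow> nat \<Rightarrow> real) \<Rightarrow> bool" where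
  "surj_linear_map k L \<longleftrightarrow>
     range L = space (Rdim k) \<and> (\<forall>i\<in>{1..k}. linear (\<lambda>x. L x i))"

definition ker :: "nat \<Rightarrow> (real ^ 'n \<Rightarrow> nat \<Rightarrow> real) \<Rightarrow> (real ^ 'n) set" where
  "ker k L = {x. \<forall>i\<in>{1..k}. L x i = 0}"

definition BL_datum ::
    "nat \<Rightarrow> (nat \<Rightarrow> nat) \<Rightarrow> (nat \<Rightarrow> real ^ 'n \<Rightarrow> nat \<Rightarrow> real) \<Rightarrow> (nat \<Rightarrow> real) \<Rightarrow> bool" where
  "BL_datum m d L p \<longleftrightarrow>
     (\<forall>j\<in>{1..m}. d j \<le> CARD('n) \<and> surj_linear_map (d j) (L j) \<and> 0 \<le> p j \<and> p j \<le> 1)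
     \<and> (\<Inter>j\<in>{1..m}. ker (d j) (L j)) = {0}"

text \<open>
  Powers of nonnegative reals with \<open>0\<^sup>0 = 1\<close>, so that a factor with exponent \<open>0\<close> is absent;
  \<open>powr\<close> would give \<open>0 powr 0 = 0\<close>.
\<close>

definition nnpow :: "real \<Rightarrow> real \<Rightarrow> real" where
  "nnpow x p = (if p = 0 then 1 else x powr p)"

text \<open>
  The infimum is attained whenever it is finite, because the right-hand side is then continuous
  in \<open>C\<close>; it is \<open>\<infinity>\<close> if no finite constant is admissible.
\<close>

definition BL_const ::
    "nat \<Rightarrow> (nat \<Rightarrow> nat) \<Rightarrow> (nat \<Rightarrow> real ^ 'n \<Rightarrow> nat \<Rightarrow> real) \<Rightarrow> (nat \<Rightarrow> real) \<Rightarrow> ennreal" where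
  "BL_const m d L p = Inf {C :: ennreal.
     \<forall>f :: nat \<Rightarrow> (nat \<Rightarrow> real) \<Rightarrow> real.
       (\<forall>j\<in>{1..m}. integrable (Rdim (d j)) (f j) \<and> (\<forall>y\<in>space (Rdim (d j)). 0 \<le> f j y)) \<longrightarrow>
       (\<integral>\<^sup>+ x. ennreal (\<Prod>j\<in>{1..m}. nnpow (f j (L j x)) (p j)) \<partial>lborel)
         \<le> C * ennreal (\<Prod>j\<in>{1..m}. nnpow (\<integral>y. f j y \<partial>Rdim (d j)) (p j))}"

definition orth_proj :: "(real ^ 'n) set \<Rightarrow> real ^ 'n \<Rightarrow> real ^ 'n" where
  "orth_proj V x = (THE y. y \<in> V \<and> (\<forall>v\<in>V. orthogonal (x - y) v))"

lemma orth_proj_eqI: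
  assumes V: "subspace V" and y: "y \<in> V" "\<And>v. v \<in> V \<Longrightarrow> orthogonal (x - y) v"
  shows "orth_proj V x = y"
  unfolding orth_proj_def
proof (rule the_equality)
  show "y \<in> V \<and> (\<forall>v\<in>V. orthogonal (x - y) v)"
    using y by blast
next
  fix z assume z: "z \<in> V \<and> (\<forall>v\<in>V. orthogonal (x - z) v)"
  have "z - y \<in> V"
    using z y V by (simp add: subspace_diff)
  then have "inner (x - y) (z - y) = 0" "inner (x - z) (z - y) = 0"
    using z y by (auto simp: orthogonal_def)
  then have "inner (z - y) (z - y) = 0"
    by (simp add: inner_diff_left)
  then show "z = y" by simp
qed

lemma orth_proj:
  assumes V: "subspace V"
  shows "orth_proj V x \<in> V" and "v \<in> V \<Longrightarrow> orthogonal (x - orth_proj V x) v"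
proof -
  have "span V = V"
    using V by (simp add: span_eq_iff)
  then obtain y z where yz: "y \<in> V" "\<And>w. w \<in> V \<Longrightarrow> orthogonal z w" "x = y + z"
    by (metis orthogonal_subspace_decomp_exists)
  then have "orth_proj V x = y"
    using V by (intro orth_proj_eqI) auto
  with yz show "orth_proj V x \<in> V" "v \<in> V \<Longrightarrow> orthogonal (x - orth_proj V x) v"
    by auto
qed

definition grassmann_dist :: "(real ^ 'n) set \<Rightarrow> (real ^ 'n) set \<Rightarrow> real" where
  "grassmann_dist V W = onorm (\<lambda>x. orth_proj V x - orth_proj W x)"

definition nbhd :: "real \<Rightarrow> (real ^ 'n) set \<Rightarrow> (real ^ 'n) set" where
  "nbhd \<delta> A = (\<Union>a\<in>A. ball a \<delta>)"

definition tubes :: "real \<Rightarrow> nat \<Rightarrow> (real ^ 'n) set \<Rightarrow> real \<Rightarrow> (real ^ 'n) set set" where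
  "tubes \<delta> k V \<nu> = {nbhd \<delta> A | A. affine A \<and> aff_dim A = int k \<and>
     (\<exists>W. subspace W \<and> affine_parallel W A \<and> grassmann_dist W V \<le> \<nu>)}"

end

theory Submission
  imports Defs
begin

text \<open>
  Let \<open>V j\<close> be the kernel of \<open>L j\<close>, let \<open>U j\<close> be its orthogonal complement, and write \<open>n\<close> for the
  dimension of the ambient space.

  \<^bold>\<open>The dimension condition.\<close> Testing the Brascamp--Lieb inequality on indicator functions adapted to a
  subspace shows that finiteness of the constant forces
  \<open>n - dim K \<le> (\<Sum>j. p j * (dim (U j) - dim (U j \<inter> K)))\<close> for all subspaces \<open>K\<close>
  (\<open>BL_condition_necessary\<close>). Everything else is derived from this condition.
  Dimensions of intersections are upper semicontinuous and the Grassmannian is compact, so the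
  condition persists when the \<open>U j\<close> are moved a little (\<open>BL_condition_stable\<close>).

  \<^bold>\<open>A Brascamp--Lieb inequality with loss.\<close> For parallel unit neighbourhoods in a ball of radius \<open>R\<close> the
  dimension condition gives the expected inequality up to a factor \<open>R\<^sup>\<eta>\<close>
  (\<open>discrete_BL_inequality\<close>). By duality it suffices to bound entropies: if \<open>h V\<close> is the entropy of the
  projection to \<open>V\<close>, rounded to unit cells, of a random point of the ball, then
  \<open>h UNIV \<le> (\<Sum>j. p j * h (U j)) + \<eta> * ln R + C\<close>. Up to additive constants \<open>h\<close> is submodular on the
  lattice of subspaces, and the inequality holds for all submodular functions: if \<open>K t\<close> minimises
  \<open>h V - t * dim V\<close>, then \<open>K t\<close> increases with \<open>t\<close>, \<open>h UNIV\<close> is the integral of \<open>n - dim (K t)\<close> over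
  \<open>t \<ge> 0\<close>, and \<open>h U\<close> is at least the integral of \<open>dim U - dim (U \<inter> K t)\<close> for every \<open>U\<close>. The dimension
  condition for \<open>K t\<close> compares the integrands (\<open>slopes_argument\<close>). The additive constants of
  submodularity are bounded only for finitely many subspaces, so the minimum is taken over a finite
  part of the lattice generated by the \<open>U j\<close>, chosen by a pigeonhole argument such that enlarging it
  hardly lowers the minimum; this is where the loss comes from (\<open>submodular_BL_inequality\<close>).

  \<^bold>\<open>Induction on scales.\<close> The loss is harmless for Guth's argument. If all directions are within
  \<open>1 / \<mu>\<close> of the \<open>V j\<close>, then inside a cube of side \<open>\<mu> * r\<close> the tubes of width \<open>r\<close> are parallel to
  the \<open>V j\<close> up to their width. The discrete inequality therefore bounds multiplicities at scale \<open>r\<close> by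
  multiplicities at scale \<open>\<mu> * r\<close> with a factor at most \<open>\<mu>\<^sup>\<epsilon>\<close>, provided \<open>\<mu>\<close> is large (\<open>scale_step\<close>),
  and iteration from scale \<open>\<delta>\<close> to scale \<open>1\<close> loses a constant times \<open>1 / \<delta>\<^sup>\<epsilon>\<close> (\<open>discrete_Kakeya\<close>).

  \<^bold>\<open>An angle independent of \<open>\<epsilon>\<close>.\<close> Every tuple of directions in a fixed neighbourhood of the \<open>V j\<close>
  satisfies the dimension condition and so has its own angle and constant for each \<open>\<epsilon>\<close>. By compactness
  these can be chosen uniformly, and splitting each family into finitely many classes of almost equal
  directions leaves only the size of the neighbourhood as a restriction (\<open>Kakeya_bound_fixed_angle\<close>).
\<close>

section \<open>Powers of nonnegative numbers\<close>

lemma nnpow_nonneg: "0 \<le> nnpow x p"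
  by (simp add: nnpow_def)

lemma nnpow_pos: "0 < x \<Longrightarrow> 0 < nnpow x p"
  by (simp add: nnpow_def)

lemma nnpow_mono: "0 \<le> x \<Longrightarrow> x \<le> y \<Longrightarrow> 0 \<le> p \<Longrightarrow> nnpow x p \<le> nnpow y p"
  by (simp add: nnpow_def powr_mono2)

lemma nnpow_mult: "0 \<le> x \<Longrightarrow> 0 \<le> y \<Longrightarrow> nnpow (x * y) p = nnpow x p * nnpow y p"
  by (simp add: nnpow_def powr_mult)

lemma ln_nnpow: "0 < x \<Longrightarrow> ln (nnpow x p) = p * ln x"
  by (simp add: nnpow_def ln_powr)

text \<open>By homogeneity the sum may be taken to be \<open>1\<close>, and \<open>t \<le> t\<^sup>p\<close> on \<open>[0, 1]\<close> because \<open>p \<le> 1\<close>.\<close>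

lemma nnpow_add_le:
  assumes "0 \<le> x" "0 \<le> y" "0 \<le> p" "p \<le> 1"
  shows "nnpow (x + y) p \<le> nnpow x p + nnpow y p"
proof (cases "p = 0 \<or> x + y = 0")
  case True
  with assms show ?thesis by (auto simp: nnpow_def)
next
  case False
  define s where "s = x + y"
  have s: "0 < s" using False assms by (simp add: s_def)
  have le: "t \<le> t powr p" if "0 \<le> t" "t \<le> 1" for t :: real
  proof (cases "t = 0")
    case False
    with that have "t powr 1 \<le> t powr p"
      by (intro powr_mono') (use assms in auto)
    with that show ?thesis by simp
  qed simp
  have "1 = x / s + y / s" using s by (simp add: s_def add_divide_distrib[symmetric])
  also have "\<dots> \<le> (x / s) powr p + (y / s) powr p"
    using s assms by (intro add_mono le) (auto simp: s_def)
  also have "\<dots> = (x powr p + y powr p) / s powr p"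
    using s assms by (simp add: powr_divide add_divide_distrib)
  finally show ?thesis using s False by (simp add: nnpow_def s_def field_simps)
qed

lemma nnpow_sum_le:
  assumes "finite A" "A \<noteq> {}" "\<And>a. a \<in> A \<Longrightarrow> 0 \<le> f a" "0 \<le> p" "p \<le> 1"
  shows "nnpow (\<Sum>a\<in>A. f a) p \<le> (\<Sum>a\<in>A. nnpow (f a) p)"
  using assms
proof (induction A rule: finite_ne_induct)
  case (insert a A)
  have "nnpow (f a + sum f A) p \<le> nnpow (f a) p + nnpow (sum f A) p"
    using insert by (intro nnpow_add_le) (auto intro: sum_nonneg)
  with insert show ?case by fastforce
qed simp

section \<open>Entropy of finite distributions\<close>

text \<open>Strictly positive weights make every logarithm below that of a positive number. Points of weight
  \<open>0\<close> are removed from \<open>\<Omega>\<close> before the locale is applied.\<close>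

locale finite_dist =
  fixes \<Omega> :: "'a set" and w :: "'a \<Rightarrow> real"
  assumes fin: "finite \<Omega>" and wpos: "\<omega> \<in> \<Omega> \<Longrightarrow> 0 < w \<omega>" and wsum: "(\<Sum>\<omega>\<in>\<Omega>. w \<omega>) = 1"
begin

definition law :: "('a \<Rightarrow> 'b) \<Rightarrow> 'b \<Rightarrow> real" where
  "law X v = (\<Sum>\<omega>\<in>{\<omega>\<in>\<Omega>. X \<omega> = v}. w \<omega>)"

definition ent :: "('a \<Rightarrow> 'b) \<Rightarrow> real" where
  "ent X = - (\<Sum>\<omega>\<in>\<Omega>. w \<omega> * ln (law X (X \<omega>)))"

lemma law_nonneg: "0 \<le> law X v"
  unfolding law_def by (intro sum_nonneg) (use wpos in \<open>auto intro: less_imp_le\<close>)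

lemma law_pos: "\<omega> \<in> \<Omega> \<Longrightarrow> 0 < law X (X \<omega>)"
  unfolding law_def using fin wpos by (intro sum_pos) auto

lemma law_le_1: "law X v \<le> 1"
proof -
  have "law X v \<le> (\<Sum>\<omega>\<in>\<Omega>. w \<omega>)"
    unfolding law_def by (rule sum_mono2) (use fin wpos in \<open>auto intro: less_imp_le\<close>)
  then show ?thesis by (simp add: wsum)
qed

lemma sum_law: "(\<Sum>\<omega>\<in>\<Omega>. w \<omega> * g (X \<omega>)) = (\<Sum>v\<in>X ` \<Omega>. law X v * g v)"
proof -
  have "(\<Sum>\<omega>\<in>\<Omega>. w \<omega> * g (X \<omega>)) = (\<Sum>v\<in>X ` \<Omega>. \<Sum>\<omega>\<in>{\<omega>\<in>\<Omega>. X \<omega> = v}. w \<omega> * g (X \<omega>))"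
    by (rule sum.image_gen[OF fin])
  also have "\<dots> = (\<Sum>v\<in>X ` \<Omega>. law X v * g v)"
    unfolding law_def sum_distrib_right by (intro sum.cong) auto
  finally show ?thesis .
qed

lemma sum_law_eq_1: "(\<Sum>v\<in>X ` \<Omega>. law X v) = 1"
  using sum_law[of "\<lambda>_. 1" X] by (simp add: wsum)

lemma ent_nonneg: "0 \<le> ent X"
proof -
  have "w \<omega> * ln (law X (X \<omega>)) \<le> 0" if "\<omega> \<in> \<Omega>" for \<omega>
    using that wpos[OF that] law_pos[OF that, of X] law_le_1[of X "X \<omega>"]
    by (intro mult_nonneg_nonpos) auto
  then show ?thesis unfolding ent_def by (simp add: sum_nonpos)
qed

lemma ent_const: "ent (\<lambda>_. c) = 0"
  unfolding ent_def law_def by (simp add: wsum)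

text \<open>Gibbs' inequality, from \<open>ln t \<le> t - 1\<close>. Every upper bound for an entropy below is an instance of
  it with a well-chosen \<open>q\<close>. Since \<open>q\<close> is not normalised, it is also the duality between entropies
  and integral inequalities: \<open>ln (\<Sum>q)\<close> dominates entropy plus the mean of \<open>ln q\<close>.\<close>

lemma gibbs:
  assumes q: "\<And>\<omega>. \<omega> \<in> \<Omega> \<Longrightarrow> 0 < q (X \<omega>)" and Q: "(\<Sum>v\<in>X ` \<Omega>. q v) \<le> Q"
  shows "ent X + (\<Sum>\<omega>\<in>\<Omega>. w \<omega> * ln (q (X \<omega>))) \<le> ln Q"
proof -
  have ne: "\<Omega> \<noteq> {}" using wsum by auto
  have "0 < (\<Sum>v\<in>X ` \<Omega>. q v)" using fin ne q by (intro sum_pos) auto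
  with Q have Qpos: "0 < Q" by linarith
  have "ent X + (\<Sum>\<omega>\<in>\<Omega>. w \<omega> * ln (q (X \<omega>))) - ln Q
      = (\<Sum>\<omega>\<in>\<Omega>. w \<omega> * ln (q (X \<omega>) / (law X (X \<omega>) * Q)))"
  proof -
    have "ln (q (X \<omega>) / (law X (X \<omega>) * Q)) = ln (q (X \<omega>)) - ln (law X (X \<omega>)) - ln Q"
      if "\<omega> \<in> \<Omega>" for \<omega>
      using q[OF that] law_pos[OF that, of X] Qpos by (simp add: ln_div ln_mult)
    then have "(\<Sum>\<omega>\<in>\<Omega>. w \<omega> * ln (q (X \<omega>) / (law X (X \<omega>) * Q)))
        = (\<Sum>\<omega>\<in>\<Omega>. w \<omega> * ln (q (X \<omega>)) - w \<omega> * ln (law X (X \<omega>)) - w \<omega> * ln Q)"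
      by (intro sum.cong) (auto simp: right_diff_distrib)
    then show ?thesis
      by (simp add: ent_def sum_subtractf sum_distrib_right[symmetric] wsum)
  qed
  also have "\<dots> \<le> (\<Sum>\<omega>\<in>\<Omega>. w \<omega> * (q (X \<omega>) / (law X (X \<omega>) * Q) - 1))"
  proof (intro sum_mono mult_left_mono)
    fix \<omega> assume "\<omega> \<in> \<Omega>"
    then show "ln (q (X \<omega>) / (law X (X \<omega>) * Q)) \<le> q (X \<omega>) / (law X (X \<omega>) * Q) - 1" "0 \<le> w \<omega>"
      using q law_pos[of \<omega> X] Qpos wpos[of \<omega>] by (auto intro!: ln_le_minus_one divide_pos_pos)
  qed
  also have "\<dots> = (\<Sum>v\<in>X ` \<Omega>. law X v * (q v / (law X v * Q))) - 1"
    using sum_law[of "\<lambda>v. q v / (law X v * Q)" X]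
    by (simp add: right_diff_distrib sum_subtractf wsum)
  also have "(\<Sum>v\<in>X ` \<Omega>. law X v * (q v / (law X v * Q))) = (\<Sum>v\<in>X ` \<Omega>. q v / Q)"
  proof (intro sum.cong refl)
    fix v assume "v \<in> X ` \<Omega>"
    then have "law X v > 0" using law_pos by auto
    then show "law X v * (q v / (law X v * Q)) = q v / Q" by simp
  qed
  also have "\<dots> - 1 \<le> 0" using Q Qpos by (simp add: sum_divide_distrib[symmetric])
  finally show ?thesis by simp
qed

lemma ent_le_ln_card:
  assumes "real (card (X ` \<Omega>)) \<le> M"
  shows "ent X \<le> ln M"
  using gibbs[of "\<lambda>_. 1" X M] assms by simp

lemma law_mono:
  assumes "\<And>\<omega>'. \<omega>' \<in> \<Omega> \<Longrightarrow> X \<omega>' = X \<omega> \<Longrightarrow> Y \<omega>' = Y \<omega>"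
  shows "law X (X \<omega>) \<le> law Y (Y \<omega>)"
  unfolding law_def
  by (rule sum_mono2) (use assms fin wpos in \<open>auto intro: less_imp_le\<close>)

lemma ent_mono:
  assumes "\<And>\<omega> \<omega>'. \<omega> \<in> \<Omega> \<Longrightarrow> \<omega>' \<in> \<Omega> \<Longrightarrow> X \<omega>' = X \<omega> \<Longrightarrow> Y \<omega>' = Y \<omega>"
  shows "ent Y \<le> ent X"
proof -
  have "w \<omega> * ln (law X (X \<omega>)) \<le> w \<omega> * ln (law Y (Y \<omega>))" if "\<omega> \<in> \<Omega>" for \<omega>
  proof -
    have "law X (X \<omega>) \<le> law Y (Y \<omega>)" using that by (intro law_mono assms)
    then have "ln (law X (X \<omega>)) \<le> ln (law Y (Y \<omega>))"
      using law_pos[OF that, of X] by (intro ln_mono)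
    then show ?thesis using wpos[OF that] by simp
  qed
  then show ?thesis unfolding ent_def by (simp add: sum_mono)
qed

lemma sum_law_pair:
  "(\<Sum>u\<in>X ` \<Omega>. law (\<lambda>\<omega>. (X \<omega>, Y \<omega>)) (u, v)) = law Y v"
proof -
  have "(\<Sum>u\<in>X ` \<Omega>. law (\<lambda>\<omega>. (X \<omega>, Y \<omega>)) (u, v))
      = (\<Sum>u\<in>X ` \<Omega>. \<Sum>\<omega>\<in>{\<omega>\<in>{\<omega>\<in>\<Omega>. Y \<omega> = v}. X \<omega> = u}. w \<omega>)"
    unfolding law_def by (intro sum.cong) auto
  also have "\<dots> = (\<Sum>\<omega>\<in>{\<omega>\<in>\<Omega>. Y \<omega> = v}. w \<omega>)"
    by (rule sum.group) (use fin in auto)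
  finally show ?thesis by (simp add: law_def)
qed

text \<open>If each value of \<open>Y\<close> leaves at most \<open>M\<close> possibilities for \<open>X\<close>, then \<open>X\<close> adds at
  most \<open>ln M\<close> to the entropy.\<close>

lemma ent_pair_le:
  fixes X :: "'a \<Rightarrow> 'b" and Y :: "'a \<Rightarrow> 'c"
  assumes M: "\<And>v. real (card (X ` {\<omega>\<in>\<Omega>. Y \<omega> = v})) \<le> M" and M0: "0 < M"
  shows "ent (\<lambda>\<omega>. (X \<omega>, Y \<omega>)) \<le> ent Y + ln M"
proof -
  define q where "q uv = law Y (snd uv)" for uv :: "'b \<times> 'c"
  have "(\<Sum>uv\<in>(\<lambda>\<omega>. (X \<omega>, Y \<omega>)) ` \<Omega>. q uv)
      = (\<Sum>v\<in>Y ` \<Omega>. \<Sum>uv\<in>{uv\<in>(\<lambda>\<omega>. (X \<omega>, Y \<omega>)) ` \<Omega>. snd uv = v}. q uv)"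
    by (rule sum.group[symmetric]) (use fin in auto)
  also have "\<dots> = (\<Sum>v\<in>Y ` \<Omega>. real (card (X ` {\<omega>\<in>\<Omega>. Y \<omega> = v})) * law Y v)"
  proof (intro sum.cong refl)
    fix v
    have "{uv\<in>(\<lambda>\<omega>. (X \<omega>, Y \<omega>)) ` \<Omega>. snd uv = v} = (\<lambda>u. (u, v)) ` (X ` {\<omega>\<in>\<Omega>. Y \<omega> = v})"
      by auto
    then show "(\<Sum>uv\<in>{uv\<in>(\<lambda>\<omega>. (X \<omega>, Y \<omega>)) ` \<Omega>. snd uv = v}. q uv)
        = real (card (X ` {\<omega>\<in>\<Omega>. Y \<omega> = v})) * law Y v"
      by (simp add: q_def sum.reindex inj_on_def)
  qed
  also have "\<dots> \<le> (\<Sum>v\<in>Y ` \<Omega>. M * law Y v)"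
    by (intro sum_mono mult_right_mono M law_nonneg)
  also have "\<dots> = M" by (simp add: sum_distrib_left[symmetric] sum_law_eq_1)
  finally have "(\<Sum>uv\<in>(\<lambda>\<omega>. (X \<omega>, Y \<omega>)) ` \<Omega>. q uv) \<le> M" .
  then have "ent (\<lambda>\<omega>. (X \<omega>, Y \<omega>)) + (\<Sum>\<omega>\<in>\<Omega>. w \<omega> * ln (q (X \<omega>, Y \<omega>))) \<le> ln M"
    by (intro gibbs) (auto simp: q_def law_pos)
  then show ?thesis by (simp add: q_def ent_def)
qed

text \<open>Strong subadditivity. The comparison distribution in Gibbs' inequality is the one that
  makes \<open>X\<close> and \<open>Y\<close> conditionally independent given \<open>Z\<close>.\<close>

lemma ent_submodular:
  "ent (\<lambda>\<omega>. (X \<omega>, Y \<omega>, Z \<omega>)) + ent Z \<le> ent (\<lambda>\<omega>. (X \<omega>, Z \<omega>)) + ent (\<lambda>\<omega>. (Y \<omega>, Z \<omega>))"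
proof -
  define q where "q t = (case t of (x, y, z) \<Rightarrow>
      law (\<lambda>\<omega>. (X \<omega>, Z \<omega>)) (x, z) * law (\<lambda>\<omega>. (Y \<omega>, Z \<omega>)) (y, z) / law Z z)" for t
  have q0: "0 \<le> q t" for t
    by (auto simp: q_def law_nonneg split: prod.split)
  have qpos: "0 < q (X \<omega>, Y \<omega>, Z \<omega>)" if "\<omega> \<in> \<Omega>" for \<omega>
    using law_pos[OF that, of "\<lambda>\<omega>. (X \<omega>, Z \<omega>)"] law_pos[OF that, of "\<lambda>\<omega>. (Y \<omega>, Z \<omega>)"]
      law_pos[OF that, of Z] by (simp add: q_def)
  have "(\<Sum>t\<in>(\<lambda>\<omega>. (X \<omega>, Y \<omega>, Z \<omega>)) ` \<Omega>. q t) \<le> (\<Sum>t\<in>X ` \<Omega> \<times> Y ` \<Omega> \<times> Z ` \<Omega>. q t)"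
    by (rule sum_mono2) (use fin q0 in auto)
  also have "\<dots> = (\<Sum>x\<in>X ` \<Omega>. \<Sum>y\<in>Y ` \<Omega>. \<Sum>z\<in>Z ` \<Omega>. q (x, y, z))"
    by (simp add: sum.cartesian_product)
  also have "\<dots> = (\<Sum>x\<in>X ` \<Omega>. \<Sum>z\<in>Z ` \<Omega>. \<Sum>y\<in>Y ` \<Omega>. q (x, y, z))"
    by (intro sum.cong refl sum.swap)
  also have "\<dots> = (\<Sum>z\<in>Z ` \<Omega>. \<Sum>x\<in>X ` \<Omega>. \<Sum>y\<in>Y ` \<Omega>. q (x, y, z))"
    by (rule sum.swap)
  also have "\<dots> = (\<Sum>z\<in>Z ` \<Omega>. law Z z * law Z z / law Z z)"
    by (intro sum.cong refl)
      (simp add: q_def sum_divide_distrib[symmetric] sum_product[symmetric] sum_law_pair)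
  also have "\<dots> = (\<Sum>z\<in>Z ` \<Omega>. law Z z)"
    using law_pos by (intro sum.cong) auto
  finally have "(\<Sum>t\<in>(\<lambda>\<omega>. (X \<omega>, Y \<omega>, Z \<omega>)) ` \<Omega>. q t) \<le> 1"
    by (simp add: sum_law_eq_1)
  then have "ent (\<lambda>\<omega>. (X \<omega>, Y \<omega>, Z \<omega>)) + (\<Sum>\<omega>\<in>\<Omega>. w \<omega> * ln (q (X \<omega>, Y \<omega>, Z \<omega>))) \<le> ln 1"
    by (intro gibbs qpos)
  moreover have "(\<Sum>\<omega>\<in>\<Omega>. w \<omega> * ln (q (X \<omega>, Y \<omega>, Z \<omega>)))
      = (\<Sum>\<omega>\<in>\<Omega>. w \<omega> * ln (law (\<lambda>\<omega>. (X \<omega>, Z \<omega>)) (X \<omega>, Z \<omega>))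
          + w \<omega> * ln (law (\<lambda>\<omega>. (Y \<omega>, Z \<omega>)) (Y \<omega>, Z \<omega>)) - w \<omega> * ln (law Z (Z \<omega>)))"
  proof (intro sum.cong refl)
    fix \<omega> assume "\<omega> \<in> \<Omega>"
    then have "0 < law (\<lambda>\<omega>. (X \<omega>, Z \<omega>)) (X \<omega>, Z \<omega>)" "0 < law (\<lambda>\<omega>. (Y \<omega>, Z \<omega>)) (Y \<omega>, Z \<omega>)"
        "0 < law Z (Z \<omega>)"
      using law_pos[of \<omega> "\<lambda>\<omega>. (X \<omega>, Z \<omega>)"] law_pos[of \<omega> "\<lambda>\<omega>. (Y \<omega>, Z \<omega>)"] law_pos[of \<omega> Z] by auto
    then show "w \<omega> * ln (q (X \<omega>, Y \<omega>, Z \<omega>)) = w \<omega> * ln (law (\<lambda>\<omega>. (X \<omega>, Z \<omega>)) (X \<omega>, Z \<omega>))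
          + w \<omega> * ln (law (\<lambda>\<omega>. (Y \<omega>, Z \<omega>)) (Y \<omega>, Z \<omega>)) - w \<omega> * ln (law Z (Z \<omega>))"
      by (simp add: q_def ln_div ln_mult algebra_simps)
  qed
  ultimately show ?thesis
    by (simp add: ent_def sum.distrib sum_subtractf)
qed

end

section \<open>Orthogonal projections\<close>

lemma orth_proj_mem_eq:
  assumes V: "subspace V" and x: "x \<in> V"
  shows "orth_proj V x = x"
  by (rule orth_proj_eqI[OF V x]) (simp add: orthogonal_clauses)

lemma orth_proj_UNIV [simp]: "orth_proj UNIV x = x"
  by (simp add: orth_proj_mem_eq)

lemma inner_orth_proj:
  assumes V: "subspace V" and "v \<in> V"
  shows "orth_proj V x \<bullet> v = x \<bullet> v"
  using orth_proj(2)[OF assms, of x] by (simp add: orthogonal_def inner_diff_left)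

lemma linear_orth_proj:
  assumes V: "subspace V"
  shows "linear (orth_proj V)"
proof (rule linearI)
  show "orth_proj V (x + y) = orth_proj V x + orth_proj V y" for x y
    by (rule orth_proj_eqI[OF V])
      (use V in \<open>auto simp: orthogonal_def inner_diff_left inner_add_left inner_orth_proj
         intro!: subspace_add orth_proj(1)\<close>)
  show "orth_proj V (c *\<^sub>R x) = c *\<^sub>R orth_proj V x" for c x
    by (rule orth_proj_eqI[OF V])
      (use V in \<open>auto simp: orthogonal_def inner_diff_left inner_orth_proj
         intro!: subspace_scale orth_proj(1)\<close>)
qed

lemma orth_proj_diff:
  "subspace V \<Longrightarrow> orth_proj V (x - y) = orth_proj V x - orth_proj V y"
  by (simp add: linear_orth_proj linear_diff)

lemma orth_proj_symmetric:
  assumes "subspace V"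
  shows "orth_proj V x \<bullet> y = x \<bullet> orth_proj V y"
  using inner_orth_proj[OF assms orth_proj(1)[OF assms, of y], of x]
    inner_orth_proj[OF assms orth_proj(1)[OF assms, of x], of y]
  by (simp add: inner_commute)

lemma norm_orth_proj_le:
  assumes "subspace V"
  shows "norm (orth_proj V x) \<le> norm x"
proof (cases "orth_proj V x = 0")
  case False
  have "norm (orth_proj V x) ^ 2 = orth_proj V x \<bullet> orth_proj V x"
    by (simp add: power2_norm_eq_inner)
  also have "\<dots> = x \<bullet> orth_proj V x"
    by (intro inner_orth_proj assms orth_proj(1))
  also have "\<dots> \<le> norm x * norm (orth_proj V x)" by (rule norm_cauchy_schwarz)
  finally show ?thesis using False by (simp add: power2_eq_square)
qed simp

lemma orth_proj_orth_proj:
  assumes V: "subspace V" and W: "subspace W" and "V \<subseteq> W"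
  shows "orth_proj V (orth_proj W x) = orth_proj V x"
proof (rule orth_proj_eqI[OF V orth_proj(1)[OF V]])
  fix v assume "v \<in> V"
  with \<open>V \<subseteq> W\<close> show "orthogonal (orth_proj W x - orth_proj V x) v"
    by (auto simp: orthogonal_def inner_diff_left inner_orth_proj V W subsetD)
qed

lemma orth_proj_comp:
  assumes V: "subspace V"
  shows "orth_proj (V\<^sup>\<bottom>) x = x - orth_proj V x"
  by (rule orth_proj_eqI[OF subspace_orthogonal_comp])
    (use orth_proj[OF V] in \<open>auto simp: orthogonal_comp_def orthogonal_commute\<close>)

lemma orth_proj_eq_0_iff:
  assumes V: "subspace V"
  shows "orth_proj V x = 0 \<longleftrightarrow> x \<in> V\<^sup>\<bottom>"
proof
  assume "orth_proj V x = 0"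
  then show "x \<in> V\<^sup>\<bottom>" using orth_proj(2)[OF V, of _ x]
    by (auto simp: orthogonal_comp_def orthogonal_commute)
next
  assume "x \<in> V\<^sup>\<bottom>"
  then show "orth_proj V x = 0"
    by (intro orth_proj_eqI V) (auto simp: V subspace_0 orthogonal_comp_def orthogonal_commute)
qed

lemma subspace_set_plus:
  assumes "subspace A" "subspace B"
  shows "subspace (A + B)"
proof -
  have "A + B = {x + y |x y. x \<in> A \<and> y \<in> B}" by (auto simp: set_plus_def)
  then show ?thesis using subspace_sums[OF assms] by simp
qed

lemma subset_set_plus:
  assumes "subspace A" "subspace B"
  shows "A \<subseteq> A + B" "B \<subseteq> A + B"
  using set_plus_intro[of _ A 0 B] set_plus_intro[of 0 A _ B] assms subspace_0 by fastforce+

text \<open>A vector of \<open>A + B\<close> orthogonal to both summands vanishes, so the pair of projections is injective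
  on \<open>A + B\<close> and hence bounded below. The constant degenerates as the angle between \<open>A\<close> and \<open>B\<close>
  tends to \<open>0\<close>.\<close>

lemma orth_proj_sum_bounded_below:
  fixes A B :: "(real^'n) set"
  assumes A: "subspace A" and B: "subspace B"
  obtains K where "0 \<le> K"
    "\<And>x. norm (orth_proj (A + B) x) \<le> K * (norm (orth_proj A x) + norm (orth_proj B x))"
proof -
  have S: "subspace (A + B)" using A B by (rule subspace_set_plus)
  note sub = subset_set_plus[OF A B]
  define f where "f = (\<lambda>y. (orth_proj A y, orth_proj B y))"
  have "linear f"
    using linear_orth_proj[OF A] linear_orth_proj[OF B]
    by (auto simp: f_def linear_iff)
  then have f: "bounded_linear f" by (rule linear_conv_bounded_linear[THEN iffD1])
  have "y = 0" if y: "y \<in> A + B" "f y = 0" for y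
  proof -
    have "y \<in> A\<^sup>\<bottom>" "y \<in> B\<^sup>\<bottom>"
      using y by (auto simp: f_def zero_prod_def orth_proj_eq_0_iff A B)
    moreover obtain a b where "y = a + b" "a \<in> A" "b \<in> B" using y by (auto simp: set_plus_def)
    ultimately have "a \<bullet> y = 0" "b \<bullet> y = 0" "y \<bullet> y = a \<bullet> y + b \<bullet> y"
      by (auto simp: orthogonal_comp_def orthogonal_def inner_add_left)
    then show "y = 0" by simp
  qed
  then obtain e where e: "0 < e" "\<And>y. y \<in> A + B \<Longrightarrow> e * norm y \<le> norm (f y)"
    using injective_imp_isometric[OF closed_subspace[OF S] S f] by (auto simp: mult.commute)
  show thesis
  proof (rule that[of "1 / e"])
    show "0 \<le> 1 / e" using e by simp
    fix x
    let ?y = "orth_proj (A + B) x"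
    have "e * norm ?y \<le> norm (f ?y)" by (intro e orth_proj S)
    also have "\<dots> \<le> norm (orth_proj A ?y) + norm (orth_proj B ?y)"
      unfolding f_def by (rule norm_Pair_le)
    also have "\<dots> = norm (orth_proj A x) + norm (orth_proj B x)"
      by (simp add: orth_proj_orth_proj A B S sub)
    finally show "norm ?y \<le> 1 / e * (norm (orth_proj A x) + norm (orth_proj B x))"
      using e by (simp add: field_simps)
  qed
qed

section \<open>Rounding\<close>

text \<open>Rounding for vectors with an arbitrary index set, so that both \<open>real ^ 'n\<close> and the function
  spaces \<open>Rdim k\<close> are covered. Outside \<open>I\<close> the value is \<open>undefined\<close>, as in \<open>Rdim k\<close>.\<close>

definition floors :: "'i set \<Rightarrow> ('i \<Rightarrow> real) \<Rightarrow> 'i \<Rightarrow> int" where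
  "floors I y = (\<lambda>i\<in>I. \<lfloor>y i\<rfloor>)"

lemma card_floors_le:
  assumes I: "finite I" and D: "0 \<le> D"
    and close: "\<And>y y' i. y \<in> S \<Longrightarrow> y' \<in> S \<Longrightarrow> i \<in> I \<Longrightarrow> \<bar>y i - y' i\<bar> \<le> D"
  shows "finite (floors I ` S) \<and> real (card (floors I ` S)) \<le> (2 * D + 2) ^ card I"
proof (cases "S = {}")
  case False
  then obtain y0 where y0: "y0 \<in> S" by blast
  define F where "F = PiE I (\<lambda>i. {\<lfloor>y0 i - D\<rfloor>..\<lfloor>y0 i + D\<rfloor>})"
  have sub: "floors I ` S \<subseteq> F"
  proof
    fix z assume "z \<in> floors I ` S"
    then obtain y where y: "y \<in> S" "z = floors I y" by blast
    have "\<lfloor>y0 i - D\<rfloor> \<le> \<lfloor>y i\<rfloor> \<and> \<lfloor>y i\<rfloor> \<le> \<lfloor>y0 i + D\<rfloor>" if "i \<in> I" for i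
      using close[OF y0 y(1) that] by (intro conjI floor_mono) linarith+
    then show "z \<in> F" by (auto simp: F_def floors_def y)
  qed
  have finF: "finite F" unfolding F_def using I by (intro finite_PiE) auto
  have "real (card F) = (\<Prod>i\<in>I. real (card {\<lfloor>y0 i - D\<rfloor>..\<lfloor>y0 i + D\<rfloor>}))"
    unfolding F_def using I by (simp add: card_PiE)
  also have "\<dots> \<le> (\<Prod>i\<in>I. 2 * D + 2)"
  proof (intro prod_mono conjI)
    fix i
    have "\<lfloor>y0 i - D\<rfloor> \<le> \<lfloor>y0 i + D\<rfloor>" using D by (intro floor_mono) linarith
    then have "real (card {\<lfloor>y0 i - D\<rfloor>..\<lfloor>y0 i + D\<rfloor>}) = of_int \<lfloor>y0 i + D\<rfloor> - of_int \<lfloor>y0 i - D\<rfloor> + 1"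
      by simp
    also have "\<dots> \<le> 2 * D + 2" by linarith
    finally show "real (card {\<lfloor>y0 i - D\<rfloor>..\<lfloor>y0 i + D\<rfloor>}) \<le> 2 * D + 2" .
  qed simp
  also have "\<dots> = (2 * D + 2) ^ card I" by simp
  finally have "real (card F) \<le> (2 * D + 2) ^ card I" .
  moreover have "real (card (floors I ` S)) \<le> real (card F)"
    using card_mono[OF finF sub] by simp
  ultimately show ?thesis using finite_subset[OF sub finF] by linarith
qed (use D in simp)

text \<open>The form in which "rounding costs a bounded factor" is used: a quantity that is determined by
  \<open>g\<close> up to a bounded error is, after rounding, determined by \<open>g\<close> up to boundedly many
  possibilities.\<close>

lemma card_floors_fibres_le:
  assumes I: "finite I" and D: "0 \<le> D" and g: "finite (g ` S)"
    and close: "\<And>x x' i. x \<in> S \<Longrightarrow> x' \<in> S \<Longrightarrow> i \<in> I \<Longrightarrow> g x = g x' \<Longrightarrow> \<bar>f x i - f x' i\<bar> \<le> D"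
  shows "finite ((\<lambda>x. floors I (f x)) ` S) \<and>
    real (card ((\<lambda>x. floors I (f x)) ` S)) \<le> real (card (g ` S)) * (2 * D + 2) ^ card I"
proof -
  define F where "F b = floors I ` (f ` {x\<in>S. g x = b})" for b
  have F: "finite (F b) \<and> real (card (F b)) \<le> (2 * D + 2) ^ card I" for b
    unfolding F_def by (rule card_floors_le[OF I D]) (use close in auto)
  have eq: "(\<lambda>x. floors I (f x)) ` S = (\<Union>b\<in>g ` S. F b)"
    by (auto simp: F_def)
  have "card (\<Union>b\<in>g ` S. F b) \<le> (\<Sum>b\<in>g ` S. card (F b))"
    by (rule card_UN_le[OF g])
  then have "real (card (\<Union>b\<in>g ` S. F b)) \<le> (\<Sum>b\<in>g ` S. real (card (F b)))"
    by (metis of_nat_le_iff of_nat_sum)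
  also have "\<dots> \<le> (\<Sum>b\<in>g ` S. (2 * D + 2) ^ card I)"
    by (intro sum_mono) (use F in auto)
  finally have "real (card (\<Union>b\<in>g ` S. F b)) \<le> real (card (g ` S)) * (2 * D + 2) ^ card I"
    by simp
  moreover have "finite (\<Union>b\<in>g ` S. F b)" using g F by (intro finite_UN_I) auto
  ultimately show ?thesis unfolding eq by blast
qed

definition rnd :: "real ^ 'n \<Rightarrow> 'n \<Rightarrow> int" where
  "rnd x = floors UNIV (($) x)"

definition ivec :: "('n \<Rightarrow> int) \<Rightarrow> real ^ 'n" where
  "ivec z = (\<chi> i. of_int (z i))"

lemma rnd_apply: "rnd x i = \<lfloor>x $ i\<rfloor>"
  by (simp add: rnd_def floors_def)

lemma norm_le_card:
  fixes x :: "real ^ 'n"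
  assumes "\<And>i. \<bar>x $ i\<bar> \<le> c"
  shows "norm x \<le> c * real CARD('n)"
proof -
  have "norm x \<le> (\<Sum>i\<in>UNIV. \<bar>x $ i\<bar>)" by (rule norm_le_l1_cart)
  also have "\<dots> \<le> (\<Sum>i\<in>(UNIV::'n set). c)" by (intro sum_mono assms)
  finally show ?thesis by (simp add: mult.commute)
qed

lemma norm_diff_le_if_rnd_eq:
  fixes x y :: "real ^ 'n"
  assumes "rnd x = rnd y"
  shows "norm (x - y) \<le> real CARD('n)"
proof -
  have "\<bar>(x - y) $ i\<bar> \<le> 1" for i
  proof -
    have "\<lfloor>x $ i\<rfloor> = \<lfloor>y $ i\<rfloor>" using assms by (metis rnd_apply)
    then show ?thesis by simp linarith
  qed
  then show ?thesis using norm_le_card[of "x - y" 1] by simp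
qed

lemma card_rnd_fibres_le:
  fixes f :: "'a \<Rightarrow> real ^ 'n"
  assumes D: "0 \<le> D" and g: "finite (g ` S)"
    and close: "\<And>x x'. x \<in> S \<Longrightarrow> x' \<in> S \<Longrightarrow> g x = g x' \<Longrightarrow> norm (f x - f x') \<le> D"
  shows "finite ((\<lambda>x. rnd (f x)) ` S)" (is ?fin)
    and "real (card ((\<lambda>x. rnd (f x)) ` S)) \<le> real (card (g ` S)) * (2 * D + 2) ^ CARD('n)" (is ?card)
proof -
  have "\<bar>f x $ i - f x' $ i\<bar> \<le> D" if "x \<in> S" "x' \<in> S" "g x = g x'" for x x' i
    using component_le_norm_cart[of "f x - f x'" i] close[OF that] by simp
  then show ?fin ?card
    using card_floors_fibres_le[of UNIV D g S "\<lambda>x. ($) (f x)"] D g by (auto simp: rnd_def)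
qed

lemma card_rnd_le:
  fixes f :: "'a \<Rightarrow> real ^ 'n"
  assumes D: "0 \<le> D" and close: "\<And>x x'. x \<in> S \<Longrightarrow> x' \<in> S \<Longrightarrow> norm (f x - f x') \<le> D"
  shows "finite ((\<lambda>x. rnd (f x)) ` S)" "real (card ((\<lambda>x. rnd (f x)) ` S)) \<le> (2 * D + 2) ^ CARD('n)"
proof -
  have fin: "finite ((\<lambda>_. ()) ` S)" by (rule finite_subset[of _ UNIV]) auto
  show "finite ((\<lambda>x. rnd (f x)) ` S)"
    by (rule card_rnd_fibres_le(1)[OF D fin]) (use close in auto)
  have "real (card ((\<lambda>x. rnd (f x)) ` S)) \<le> real (card ((\<lambda>_. ()) ` S)) * (2 * D + 2) ^ CARD('n)"
    by (rule card_rnd_fibres_le(2)[OF D fin]) (use close in auto)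
  also have "\<dots> \<le> 1 * (2 * D + 2) ^ CARD('n)"
    by (intro mult_right_mono) (use D card_mono[of UNIV "(\<lambda>_. ()) ` S"] in auto)
  finally show "real (card ((\<lambda>x. rnd (f x)) ` S)) \<le> (2 * D + 2) ^ CARD('n)" by simp
qed

text \<open>Projections are rounded in the ambient coordinates, not in coordinates of \<open>V\<close>. This avoids a
  choice of bases, at the price of comparing different subspaces through fibres of bounded size.\<close>

definition rproj :: "(real ^ 'n) set \<Rightarrow> real ^ 'n \<Rightarrow> 'n \<Rightarrow> int" where
  "rproj V x = rnd (orth_proj V x)"

lemma norm_orth_proj_diff_if_rproj_eq:
  fixes x y :: "real ^ 'n"
  assumes "subspace V" "rproj V x = rproj V y"
  shows "norm (orth_proj V (x - y)) \<le> real CARD('n)"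
  using norm_diff_le_if_rnd_eq assms by (simp add: rproj_def orth_proj_diff)

text \<open>Coordinates with respect to an orthonormal basis show that the projection of a ball onto
  a \<open>k\<close>-dimensional subspace meets \<open>O(R\<^sup>k)\<close> unit cells.\<close>

lemma card_rproj_ball_le:
  fixes V :: "(real ^ 'n) set"
  assumes V: "subspace V" and R: "1 \<le> R" and S: "S \<subseteq> {x. norm x \<le> R}"
  shows "finite (rproj V ` S)"
    "real (card (rproj V ` S)) \<le> (6 * R) ^ dim V * (2 * real CARD('n) + 2) ^ CARD('n)"
proof -
  obtain B where B: "B \<subseteq> V" "pairwise orthogonal B" "\<And>x. x \<in> B \<Longrightarrow> norm x = 1"
      "independent B" "card B = dim V" "span B = V"
    using orthonormal_basis_subspace[OF V] by metis
  have finB: "finite B" using B(4) by (rule independent_imp_finite)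
  define g where "g x = floors B (\<lambda>b. x \<bullet> b)" for x :: "real ^ 'n"
  have g: "finite (g ` S) \<and> real (card (g ` S)) \<le> (2 * (2 * R) + 2) ^ card B"
  proof -
    have "\<bar>x \<bullet> b - x' \<bullet> b\<bar> \<le> 2 * R" if "x \<in> S" "x' \<in> S" "b \<in> B" for x x' b
    proof -
      have "\<bar>(x - x') \<bullet> b\<bar> \<le> norm (x - x') * norm b" by (rule Cauchy_Schwarz_ineq2)
      also have "\<dots> \<le> norm x + norm x'" using B(3)[OF that(3)] norm_triangle_ineq4[of x x'] by simp
      also have "\<dots> \<le> R + R" using that S by (intro add_mono) auto
      finally show ?thesis by (simp add: inner_diff_left)
    qed
    then show ?thesis
      using card_floors_le[OF finB, of "2 * R" "(\<lambda>x. \<lambda>b. x \<bullet> b) ` S"] R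
      by (auto simp: g_def image_image)
  qed
  have close: "norm (orth_proj V x - orth_proj V x') \<le> real CARD('n)"
    if eq: "g x = g x'" for x x'
  proof -
    have one: "\<bar>(x - x') \<bullet> b\<bar> \<le> 1" if "b \<in> B" for b
    proof -
      have "\<lfloor>x \<bullet> b\<rfloor> = \<lfloor>x' \<bullet> b\<rfloor>" using fun_cong[OF eq, of b] that by (simp add: g_def floors_def)
      then show ?thesis by (simp add: inner_diff_left) linarith
    qed
    \<comment> \<open>Equal rounded coordinates in the basis \<open>B\<close> mean that the projections differ by at most \<open>card B\<close>.\<close>
    have "orth_proj V (x - x') = (\<Sum>b\<in>B. ((x - x') \<bullet> b) *\<^sub>R b)"
    proof (rule orth_proj_eqI[OF V])
      show "(\<Sum>b\<in>B. ((x - x') \<bullet> b) *\<^sub>R b) \<in> V"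
        using B(1) V by (intro subspace_sum subspace_scale) auto
      fix v assume "v \<in> V"
      then have "v \<in> span B" using B by simp
      moreover have "orthogonal (x - x' - (\<Sum>b\<in>B. ((x - x') \<bullet> b) *\<^sub>R b)) b'" if "b' \<in> B" for b'
      proof -
        have "(\<Sum>b\<in>B. ((x - x') \<bullet> b) * (b \<bullet> b')) = (\<Sum>b\<in>B. if b = b' then (x - x') \<bullet> b' else 0)"
          using B(2) B(3)[OF that] that
          by (intro sum.cong) (auto simp: pairwise_def orthogonal_def norm_eq_1)
        also have "\<dots> = (x - x') \<bullet> b'" using finB that by simp
        finally show ?thesis by (simp add: orthogonal_def inner_diff_left inner_sum_left)
      qed
      ultimately show "orthogonal (x - x' - (\<Sum>b\<in>B. ((x - x') \<bullet> b) *\<^sub>R b)) v"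
        using orthogonal_to_span by (metis (no_types, lifting) )
    qed
    then have "norm (orth_proj V (x - x')) \<le> (\<Sum>b\<in>B. norm (((x - x') \<bullet> b) *\<^sub>R b))"
      by (simp only: norm_sum)
    also have "\<dots> \<le> (\<Sum>b\<in>B. 1)"
      using one B(3) by (intro sum_mono) simp
    also have "\<dots> \<le> real CARD('n)"
      using B(5) dim_subset_UNIV[of V] by simp
    finally show ?thesis by (simp add: orth_proj_diff[OF V])
  qed
  show "finite (rproj V ` S)"
    using card_rnd_fibres_le(1)[of "real CARD('n)" g S "orth_proj V"] g close
    by (simp add: rproj_def[abs_def])
  have "real (card (rproj V ` S)) \<le> real (card (g ` S)) * (2 * real CARD('n) + 2) ^ CARD('n)"
    using card_rnd_fibres_le(2)[of "real CARD('n)" g S "orth_proj V"] g close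
    by (simp add: rproj_def[abs_def])
  also have "\<dots> \<le> (6 * R) ^ card B * (2 * real CARD('n) + 2) ^ CARD('n)"
  proof (intro mult_right_mono)
    have "(2 * (2 * R) + 2) ^ card B \<le> (6 * R) ^ card B" using R by (intro power_mono) auto
    with g show "real (card (g ` S)) \<le> (6 * R) ^ card B" by linarith
  qed simp
  finally show "real (card (rproj V ` S)) \<le> (6 * R) ^ dim V * (2 * real CARD('n) + 2) ^ CARD('n)"
    using B by simp
qed

section \<open>Entropies of rounded projections\<close>

lemma (in finite_dist) ent_rnd_pair_le:
  fixes f :: "'a \<Rightarrow> real ^ 'n"
  assumes D: "0 \<le> D"
    and close: "\<And>x x'. x \<in> \<Omega> \<Longrightarrow> x' \<in> \<Omega> \<Longrightarrow> g x = g x' \<Longrightarrow> norm (f x - f x') \<le> D"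
  shows "ent (\<lambda>\<omega>. (rnd (f \<omega>), g \<omega>)) \<le> ent g + ln ((2 * D + 2) ^ CARD('n))"
  by (intro ent_pair_le card_rnd_le(2)) (use D close in auto)

text \<open>Strong subadditivity for the rounded projections to \<open>A\<close>, \<open>B\<close> and \<open>A \<inter> B\<close>: the first two
  determine the projection to \<open>A + B\<close>, and each of them determines the one to \<open>A \<inter> B\<close>, up to
  boundedly many possibilities. What matters later is that \<open>C\<close> does not depend on the
  distribution. It is not uniform in \<open>A\<close> and \<open>B\<close>, and this is why only finitely many subspaces can
  be used at a time.\<close>

lemma ent_rproj_submodular:
  fixes A B :: "(real ^ 'n) set"
  assumes A: "subspace A" and B: "subspace B"
  obtains C where "\<And>\<Omega> w. finite_dist \<Omega> w \<Longrightarrow>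
    finite_dist.ent \<Omega> w (rproj (A + B)) + finite_dist.ent \<Omega> w (rproj (A \<inter> B))
      \<le> finite_dist.ent \<Omega> w (rproj A) + finite_dist.ent \<Omega> w (rproj B) + C"
proof -
  let ?n = "real CARD('n)"
  obtain K where K: "0 \<le> K"
    "\<And>x. norm (orth_proj (A + B) x) \<le> K * (norm (orth_proj A x) + norm (orth_proj B x))"
    using orth_proj_sum_bounded_below[OF A B] by blast
  have S: "subspace (A + B)" using A B by (rule subspace_set_plus)
  have I: "subspace (A \<inter> B)" using A B by (rule subspace_inter)
  define C where "C = ln ((2 * (K * (?n + ?n)) + 2) ^ CARD('n)) + 2 * ln ((2 * ?n + 2) ^ CARD('n))"
  show thesis
  proof (rule that[of C])
    fix \<Omega> :: "(real ^ 'n) set" and w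
    assume "finite_dist \<Omega> w"
    then interpret finite_dist \<Omega> w .
    let ?a = "rproj A" and ?b = "rproj B" and ?c = "rproj (A \<inter> B)" and ?e = "rproj (A + B)"
    have "ent ?e \<le> ent (\<lambda>x. (?e x, (?a x, ?b x)))" by (rule ent_mono) auto
    also have "\<dots> \<le> ent (\<lambda>x. (?a x, ?b x)) + ln ((2 * (K * (?n + ?n)) + 2) ^ CARD('n))"
      unfolding rproj_def[of "A + B"]
    proof (rule ent_rnd_pair_le)
      show "0 \<le> K * (?n + ?n)" using K by simp
      fix x x' assume "(?a x, ?b x) = (?a x', ?b x')"
      then have "norm (orth_proj A (x - x')) \<le> ?n" "norm (orth_proj B (x - x')) \<le> ?n"
        using A B by (auto intro: norm_orth_proj_diff_if_rproj_eq)
      then have "K * (norm (orth_proj A (x - x')) + norm (orth_proj B (x - x'))) \<le> K * (?n + ?n)"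
        using K(1) by (intro mult_left_mono) auto
      with K(2)[of "x - x'"] show "norm (orth_proj (A + B) x - orth_proj (A + B) x') \<le> K * (?n + ?n)"
        by (simp add: orth_proj_diff[OF S])
    qed
    also have "ent (\<lambda>x. (?a x, ?b x)) \<le> ent (\<lambda>x. (?a x, ?b x, ?c x))" by (rule ent_mono) auto
    finally have 1: "ent ?e \<le> ent (\<lambda>x. (?a x, ?b x, ?c x)) + ln ((2 * (K * (?n + ?n)) + 2) ^ CARD('n))"
      by simp
    have 2: "ent (\<lambda>x. (rproj V x, ?c x)) \<le> ent (rproj V) + ln ((2 * ?n + 2) ^ CARD('n))"
      if V: "subspace V" "A \<inter> B \<subseteq> V" for V
    proof -
      have "ent (\<lambda>x. (rproj V x, ?c x)) \<le> ent (\<lambda>x. (?c x, rproj V x))" by (rule ent_mono) auto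
      also have "\<dots> \<le> ent (rproj V) + ln ((2 * ?n + 2) ^ CARD('n))"
        unfolding rproj_def[of "A \<inter> B"]
      proof (rule ent_rnd_pair_le)
        fix x x' assume "rproj V x = rproj V x'"
        then have "norm (orth_proj V (x - x')) \<le> ?n"
          by (rule norm_orth_proj_diff_if_rproj_eq[OF V(1)])
        moreover have "norm (orth_proj (A \<inter> B) (x - x')) \<le> norm (orth_proj V (x - x'))"
          using norm_orth_proj_le[OF I, of "orth_proj V (x - x')"]
          by (simp add: orth_proj_orth_proj[OF I V])
        ultimately show "norm (orth_proj (A \<inter> B) x - orth_proj (A \<inter> B) x') \<le> ?n"
          by (simp add: orth_proj_diff[OF I])
      qed simp
      finally show ?thesis .
    qed
    show "ent ?e + ent ?c \<le> ent ?a + ent ?b + C"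
      using 1 2[OF A] 2[OF B] ent_submodular[of ?a ?b ?c] by (simp add: C_def)
  qed
qed

lemma (in finite_dist) ent_rproj_UNIV_le:
  fixes f :: "'a \<Rightarrow> real ^ 'n"
  assumes R: "1 \<le> R" and f: "\<And>x. x \<in> \<Omega> \<Longrightarrow> norm (f x) \<le> R"
  shows "ent (\<lambda>x. rproj UNIV (f x))
    \<le> real CARD('n) * ln R + ln (6 ^ CARD('n) * (2 * real CARD('n) + 2) ^ CARD('n))"
proof -
  have "real (card (rproj UNIV ` (f ` \<Omega>))) \<le> (6 * R) ^ CARD('n) * (2 * real CARD('n) + 2) ^ CARD('n)"
    using card_rproj_ball_le(2)[OF subspace_UNIV R, of "f ` \<Omega>"] f by auto
  then have "ent (\<lambda>x. rproj UNIV (f x)) \<le> ln ((6 * R) ^ CARD('n) * (2 * real CARD('n) + 2) ^ CARD('n))"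
    by (intro ent_le_ln_card) (simp add: image_image)
  also have "\<dots> = real CARD('n) * ln R + ln (6 ^ CARD('n) * (2 * real CARD('n) + 2) ^ CARD('n))"
  proof -
    have "0 < 2 * real CARD('n) + 2" by (simp add: add_nonneg_pos)
    with R show ?thesis
      by (simp add: power_mult_distrib ln_mult ln_realpow)
  qed
  finally show ?thesis .
qed

section \<open>Submodular functions on the lattice of subspaces\<close>

text \<open>With \<open>U j\<close> the orthogonal complement of the kernel of \<open>L j\<close> and \<open>V = K\<^sup>\<bottom>\<close>, the dimension of
  \<open>L j ` V\<close> is \<open>dim (U j) - dim (U j \<inter> K)\<close>. So this is the condition
  \<open>dim V \<le> (\<Sum>j. p j * dim (L j ` V))\<close> of Bennett, Carbery, Christ and Tao, stated for orthogonal
  complements because entropies of projections are attached to the spaces \<open>U j\<close>.\<close>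

definition BL_condition :: "nat \<Rightarrow> (nat \<Rightarrow> (real ^ 'n) set) \<Rightarrow> (nat \<Rightarrow> real) \<Rightarrow> bool" where
  "BL_condition m U p \<longleftrightarrow> (\<forall>K. subspace K \<longrightarrow>
     real CARD('n) - real (dim K) \<le> (\<Sum>j\<in>{1..m}. p j * (real (dim (U j)) - real (dim (U j \<inter> K)))))"

lemma dim_set_plus:
  fixes A B :: "'a::euclidean_space set"
  assumes "subspace A" "subspace B"
  shows "real (dim (A + B)) + real (dim (A \<inter> B)) = real (dim A) + real (dim B)"
proof -
  have "A + B = {x + y |x y. x \<in> A \<and> y \<in> B}" by (auto simp: set_plus_def)
  then show ?thesis using dim_sums_Int[OF assms] by simp
qed

lemma sum_Abel:
  fixes a :: "nat \<Rightarrow> real"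
  shows "(\<Sum>i<N. (real i + 1) * (a (Suc i) - a i)) = (\<Sum>i<N. a N - a i)"
proof (induction N)
  case (Suc N)
  have "(\<Sum>i<Suc N. a (Suc N) - a i) = (\<Sum>i<N. (a N - a i) + (a (Suc N) - a N)) + (a (Suc N) - a N)"
    by simp
  also have "\<dots> = (\<Sum>i<N. a N - a i) + (real N + 1) * (a (Suc N) - a N)"
    unfolding sum.distrib by (simp add: algebra_simps)
  finally show ?case using Suc by simp
qed simp

text \<open>The subspaces \<open>K i\<close> minimise \<open>h V - t * dim V\<close> at the slopes \<open>t = i * \<tau>\<close>; they are the steps of a
  Harder--Narasimhan filtration of \<open>h\<close>. Minimality against the previous step bounds the increments
  of \<open>h (K i)\<close> from above, so that \<open>h UNIV\<close> is at most a Riemann sum of \<open>n - dim (K i)\<close>.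
  Submodularity turns minimality against \<open>(U \<inter> K (i + 1)) + K i\<close> into a lower bound for the increments
  of \<open>h (U \<inter> K i)\<close>, so that \<open>h U\<close> is, up to the error terms, at least a Riemann sum of
  \<open>dim U - dim (U \<inter> K i)\<close>. The dimension condition for \<open>K i\<close> compares the two sums term by term.

  The minimum is taken over \<open>\<A>\<close>, and up to \<open>\<sigma>\<close> also over the larger family \<open>\<B>\<close>, which contains the
  few sums and intersections of members of \<open>\<A>\<close> that are compared with minimisers.\<close>

lemma slopes_argument:
  fixes h :: "(real ^ 'n) set \<Rightarrow> real" and U :: "nat \<Rightarrow> (real ^ 'n) set"
    and K :: "nat \<Rightarrow> (real ^ 'n) set" and C \<tau> \<sigma> :: real and N :: nat
  assumes cond: "BL_condition m U p" and p: "\<And>j. j \<in> {1..m} \<Longrightarrow> 0 \<le> p j"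
    and U: "\<And>j. j \<in> {1..m} \<Longrightarrow> subspace (U j)"
    and sub: "\<And>V. V \<in> \<B> \<Longrightarrow> subspace V" and nonneg: "\<And>V. V \<in> \<B> \<Longrightarrow> 0 \<le> h V" and h0: "h {0} = 0"
    and AB: "\<A> \<subseteq> \<B>" "\<And>A B. A \<in> \<A> \<Longrightarrow> B \<in> \<A> \<Longrightarrow> A + B \<in> \<B>" "\<And>A B. A \<in> \<A> \<Longrightarrow> B \<in> \<A> \<Longrightarrow> A \<inter> B \<in> \<B>"
      "\<And>j A B. j \<in> {1..m} \<Longrightarrow> A \<in> \<A> \<Longrightarrow> B \<in> \<A> \<Longrightarrow> (U j \<inter> A) + B \<in> \<B>"
    and A0: "{0} \<in> \<A>" "UNIV \<in> \<A>" "\<And>j. j \<in> {1..m} \<Longrightarrow> U j \<in> \<A>"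
    and submod: "\<And>A B. A \<in> \<B> \<Longrightarrow> B \<in> \<B> \<Longrightarrow> h (A + B) + h (A \<inter> B) \<le> h A + h B + C"
    and K: "\<And>i. i \<le> N \<Longrightarrow> K i \<in> \<A>"
    and minA: "\<And>i V. i \<le> N \<Longrightarrow> V \<in> \<A> \<Longrightarrow> h (K i) - i * \<tau> * dim (K i) \<le> h V - i * \<tau> * dim V"
    and minB: "\<And>i V. i \<le> N \<Longrightarrow> V \<in> \<B> \<Longrightarrow> h (K i) - i * \<tau> * dim (K i) \<le> h V - i * \<tau> * dim V + \<sigma>"
    and small: "C + 2 * \<sigma> < \<tau>" and \<tau>: "0 < \<tau>" and big: "h UNIV < N * \<tau>"
  shows "h UNIV \<le> (\<Sum>j\<in>{1..m}. p j * h (U j)) + (\<Sum>j\<in>{1..m}. p j * (\<tau> * CARD('n) + N * (C + \<sigma>)))"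
proof -
  have Ksub: "subspace (K i)" if "i \<le> N" for i using K[OF that] AB(1) sub by blast
  \<comment> \<open>Comparing \<open>K i\<close> with \<open>K i \<inter> K (Suc i)\<close> and \<open>K (Suc i)\<close> with \<open>K i + K (Suc i)\<close>, every dimension by
    which \<open>K i\<close> fails to lie in \<open>K (Suc i)\<close> gains \<open>\<tau>\<close>, which exceeds the errors.\<close>
  have nested: "K i \<subseteq> K (Suc i)" if i: "i < N" for i
  proof -
    let ?A = "K i" and ?B = "K (Suc i)"
    have s: "subspace ?A" "subspace ?B" "?A \<in> \<A>" "?B \<in> \<A>" using K Ksub i by auto
    have "h (?A + ?B) + h (?A \<inter> ?B) \<le> h ?A + h ?B + C"
      using s AB(1) by (intro submod) auto
    moreover have "h ?B - Suc i * \<tau> * dim ?B \<le> h (?A + ?B) - Suc i * \<tau> * dim (?A + ?B) + \<sigma>"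
      using i s by (intro minB AB) auto
    moreover have "h ?A - i * \<tau> * dim ?A \<le> h (?A \<inter> ?B) - i * \<tau> * dim (?A \<inter> ?B) + \<sigma>"
      using i s by (intro minB AB) auto
    moreover have d: "real (dim (?A + ?B)) = real (dim ?A) + real (dim ?B) - real (dim (?A \<inter> ?B))"
      using dim_set_plus[OF s(1,2)] by simp
    ultimately have le: "\<tau> * (real (dim ?A) - real (dim (?A \<inter> ?B))) \<le> C + 2 * \<sigma>"
      unfolding d by (simp add: algebra_simps)
    have "dim ?A \<le> dim (?A \<inter> ?B)"
    proof (rule ccontr)
      assume "\<not> ?thesis"
      then have "1 \<le> real (dim ?A) - real (dim (?A \<inter> ?B))" by linarith
      then have "\<tau> * 1 \<le> \<tau> * (real (dim ?A) - real (dim (?A \<inter> ?B)))" using \<tau> by (intro mult_left_mono) auto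
      with le small show False by simp
    qed
    then have "?A \<inter> ?B = ?A"
      using s by (intro subspace_dim_equal subspace_inter) auto
    then show ?thesis by blast
  qed
  \<comment> \<open>At the last slope, giving up a single dimension costs more than \<open>h UNIV\<close>.\<close>
  have KN: "K N = UNIV"
  proof (rule ccontr)
    assume neq: "K N \<noteq> UNIV"
    have "dim (K N) < CARD('n)"
    proof (rule ccontr)
      assume "\<not> ?thesis"
      then have "K N = UNIV" by (intro subspace_dim_equal Ksub) auto
      with neq show False by simp
    qed
    then have "real (dim (K N)) + 1 \<le> real CARD('n)" by linarith
    then have "N * \<tau> * (real (dim (K N)) + 1) \<le> N * \<tau> * real CARD('n)"
      using \<tau> by (intro mult_left_mono) auto
    moreover have "h (K N) - N * \<tau> * dim (K N) \<le> h UNIV - N * \<tau> * CARD('n)"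
      using minA[of N UNIV] A0 by simp
    moreover have "0 \<le> h (K N)" using K[of N] AB(1) nonneg by blast
    ultimately show False using big by (simp add: algebra_simps)
  qed
  let ?k = "\<lambda>i. real (dim (K i))"
  have upper: "h UNIV \<le> \<tau> * (\<Sum>i<N. real CARD('n) - ?k i)"
  proof -
    have "h (K (Suc i)) - h (K i) \<le> \<tau> * ((real i + 1) * (?k (Suc i) - ?k i))" if "i < N" for i
      using minA[of "Suc i" "K i"] K[of i] that by (simp add: algebra_simps)
    then have "(\<Sum>i<N. h (K (Suc i)) - h (K i)) \<le> (\<Sum>i<N. \<tau> * ((real i + 1) * (?k (Suc i) - ?k i)))"
      by (intro sum_mono) auto
    also have "\<dots> = \<tau> * (\<Sum>i<N. ?k N - ?k i)"
      by (simp only: sum_distrib_left[symmetric] sum_Abel[of ?k N])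
    finally have "h (K N) - h (K 0) \<le> \<tau> * (\<Sum>i<N. ?k N - ?k i)"
      by (simp only: sum_lessThan_telescope[of "\<lambda>i. h (K i)"])
    moreover have "h (K 0) \<le> 0" using minA[of 0 "{0}"] A0 h0 by simp
    ultimately show ?thesis by (simp add: KN)
  qed
  \<comment> \<open>The slope at step \<open>i\<close> is \<open>i * \<tau>\<close> here but \<open>(i + 1) * \<tau>\<close> in \<open>upper\<close>; the shift contributes
    the term \<open>\<tau> * CARD('n)\<close>.\<close>
  have lower: "\<tau> * (\<Sum>i<N. real (dim (U j)) - real (dim (U j \<inter> K i))) \<le> h (U j) + (\<tau> * CARD('n) + N * (C + \<sigma>))"
    if j: "j \<in> {1..m}" for j
  proof -
    let ?a = "\<lambda>i. real (dim (U j \<inter> K i))"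
    have step: "\<tau> * (real i * (?a (Suc i) - ?a i)) - (C + \<sigma>) \<le> h (U j \<inter> K (Suc i)) - h (U j \<inter> K i)"
      if i: "i < N" for i
    proof -
      let ?V = "U j \<inter> K (Suc i)" and ?K = "K i"
      have s: "subspace ?V" "subspace ?K" "?V \<in> \<B>" "?K \<in> \<B>" "?V + ?K \<in> \<B>"
        using K Ksub i j U A0 AB by (auto intro!: subspace_inter)
      have I: "?V \<inter> ?K = U j \<inter> ?K" using nested[OF i] by blast
      have "h (?V + ?K) + h (?V \<inter> ?K) \<le> h ?V + h ?K + C"
        by (intro submod s)
      moreover have "h ?K - i * \<tau> * dim ?K \<le> h (?V + ?K) - i * \<tau> * dim (?V + ?K) + \<sigma>"
        using i s by (intro minB) auto
      moreover have d: "real (dim (?V + ?K)) = real (dim ?V) + real (dim ?K) - real (dim (?V \<inter> ?K))"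
        using dim_set_plus[OF s(1,2)] by simp
      ultimately show ?thesis unfolding d I by (simp add: algebra_simps)
    qed
    have "(\<Sum>i<N. \<tau> * ((real i + 1) * (?a (Suc i) - ?a i)) - \<tau> * (?a (Suc i) - ?a i) - (C + \<sigma>))
        \<le> (\<Sum>i<N. h (U j \<inter> K (Suc i)) - h (U j \<inter> K i))"
      using step by (intro sum_mono) (simp add: algebra_simps)
    also have "\<dots> = h (U j) - h (U j \<inter> K 0)"
      by (subst sum_lessThan_telescope[of "\<lambda>i. h (U j \<inter> K i)"]) (simp add: KN)
    also have "\<dots> \<le> h (U j)"
      using nonneg[of "U j \<inter> K 0"] AB(3)[OF A0(3)[OF j] K[of 0]] by simp
    finally have "(\<Sum>i<N. \<tau> * ((real i + 1) * (?a (Suc i) - ?a i)) - \<tau> * (?a (Suc i) - ?a i) - (C + \<sigma>)) \<le> h (U j)" .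
    moreover have "(\<Sum>i<N. \<tau> * ((real i + 1) * (?a (Suc i) - ?a i)) - \<tau> * (?a (Suc i) - ?a i) - (C + \<sigma>))
      = \<tau> * (\<Sum>i<N. ?a N - ?a i) - \<tau> * (?a N - ?a 0) - N * (C + \<sigma>)"
      by (simp only: sum_subtractf sum_distrib_left[symmetric] sum_Abel[of ?a N]
          sum_lessThan_telescope[of ?a N, unfolded sum_subtractf]) simp
    moreover have "\<tau> * (?a N - ?a 0) \<le> \<tau> * CARD('n)"
      using \<tau> dim_subset_UNIV[of "U j \<inter> K N"] by (intro mult_left_mono) auto
    ultimately show ?thesis by (simp add: KN)
  qed
  have "h UNIV \<le> \<tau> * (\<Sum>i<N. \<Sum>j\<in>{1..m}. p j * (real (dim (U j)) - real (dim (U j \<inter> K i))))"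
  proof -
    have "\<tau> * (\<Sum>i<N. real CARD('n) - ?k i)
        \<le> \<tau> * (\<Sum>i<N. \<Sum>j\<in>{1..m}. p j * (real (dim (U j)) - real (dim (U j \<inter> K i))))"
      using \<tau> cond Ksub by (intro mult_left_mono sum_mono) (auto simp: BL_condition_def)
    with upper show ?thesis by linarith
  qed
  also have "\<dots> = (\<Sum>j\<in>{1..m}. p j * (\<tau> * (\<Sum>i<N. real (dim (U j)) - real (dim (U j \<inter> K i)))))"
    by (subst sum.swap) (simp add: sum_distrib_left algebra_simps)
  also have "\<dots> \<le> (\<Sum>j\<in>{1..m}. p j * (h (U j) + (\<tau> * CARD('n) + N * (C + \<sigma>))))"
    by (intro sum_mono mult_left_mono lower p) auto
  also have "\<dots> = (\<Sum>j\<in>{1..m}. p j * h (U j)) + (\<Sum>j\<in>{1..m}. p j * (\<tau> * CARD('n) + N * (C + \<sigma>)))"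
    by (simp add: sum.distrib distrib_left)
  finally show ?thesis .
qed

text \<open>Otherwise each of the first \<open>S\<close> steps would lower the sum of the \<open>N + 1\<close> sequences by more than
  \<open>\<sigma>\<close>, and they would leave \<open>[- B, 0]\<close>.\<close>

lemma pigeonhole_decreasing:
  fixes \<phi> :: "nat \<Rightarrow> nat \<Rightarrow> real"
  assumes bounds: "\<And>s i. i \<le> N \<Longrightarrow> - B \<le> \<phi> s i" "\<And>s i. i \<le> N \<Longrightarrow> \<phi> s i \<le> 0"
    and dec: "\<And>s i. i \<le> N \<Longrightarrow> \<phi> (Suc s) i \<le> \<phi> s i"
    and S: "real (Suc N) * B < real S * \<sigma>"
  obtains s where "s < S" "\<And>i. i \<le> N \<Longrightarrow> \<phi> s i \<le> \<phi> (Suc s) i + \<sigma>"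
proof -
  have "\<exists>s<S. \<forall>i\<le>N. \<phi> s i \<le> \<phi> (Suc s) i + \<sigma>"
  proof (rule ccontr)
    assume neg: "\<not> ?thesis"
    have "\<sigma> \<le> (\<Sum>i\<le>N. \<phi> s i - \<phi> (Suc s) i)" if s: "s < S" for s
    proof -
      obtain i where i: "i \<le> N" "\<phi> (Suc s) i + \<sigma> < \<phi> s i" using neg s by (auto simp: not_le)
      have "\<phi> s i - \<phi> (Suc s) i \<le> (\<Sum>i\<le>N. \<phi> s i - \<phi> (Suc s) i)"
        by (rule member_le_sum) (use dec i in auto)
      with i show ?thesis by linarith
    qed
    then have "(\<Sum>s<S. \<sigma>) \<le> (\<Sum>s<S. \<Sum>i\<le>N. \<phi> s i - \<phi> (Suc s) i)" by (intro sum_mono) auto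
    also have "\<dots> = (\<Sum>i\<le>N. \<phi> 0 i - \<phi> S i)"
    proof -
      have "(\<Sum>s<S. \<phi> s i - \<phi> (Suc s) i) = \<phi> 0 i - \<phi> S i" for i
        using sum_lessThan_telescope'[of "\<lambda>s. \<phi> s i" S] by simp
      then show ?thesis by (subst sum.swap) simp
    qed
    also have "\<dots> \<le> (\<Sum>i\<le>N. B)"
    proof (rule sum_mono)
      fix i assume "i \<in> {..N}"
      then show "\<phi> 0 i - \<phi> S i \<le> B" using bounds(1)[of i S] bounds(2)[of i 0] by auto
    qed
    finally show False using S by simp
  qed
  with that show thesis by blast
qed

text \<open>The lattice generated by finitely many subspaces may be infinite, so it is built up in finite
  generations.\<close>

fun lattice_level :: "(real ^ 'n) set set \<Rightarrow> nat \<Rightarrow> (real ^ 'n) set set" where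
  "lattice_level \<G> 0 = \<G>"
| "lattice_level \<G> (Suc s) = lattice_level \<G> s
     \<union> (\<lambda>(A, B). A + B) ` (lattice_level \<G> s \<times> lattice_level \<G> s)
     \<union> (\<lambda>(A, B). A \<inter> B) ` (lattice_level \<G> s \<times> lattice_level \<G> s)"

lemma finite_lattice_level: "finite \<G> \<Longrightarrow> finite (lattice_level \<G> s)"
  by (induction s) auto

lemma subspace_lattice_level:
  assumes "\<And>V. V \<in> \<G> \<Longrightarrow> subspace V"
  shows "V \<in> lattice_level \<G> s \<Longrightarrow> subspace V"
proof (induction s arbitrary: V)
  case (Suc s)
  then show ?case by (auto intro!: subspace_set_plus subspace_inter)
qed (use assms in simp)

lemma lattice_level_mono: "s \<le> t \<Longrightarrow> lattice_level \<G> s \<subseteq> lattice_level \<G> t"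
  by (rule lift_Suc_mono_le) auto

lemma lattice_level_plus:
  "A \<in> lattice_level \<G> s \<Longrightarrow> B \<in> lattice_level \<G> s \<Longrightarrow> A + B \<in> lattice_level \<G> (Suc s)"
  by force

lemma lattice_level_Int:
  "A \<in> lattice_level \<G> s \<Longrightarrow> B \<in> lattice_level \<G> s \<Longrightarrow> A \<inter> B \<in> lattice_level \<G> (Suc s)"
  by force

text \<open>The number of slopes \<open>N\<close>, and then the number \<open>S\<close> of generations of the lattice, depend only on
  \<open>\<eta>\<close>, the exponents and the dimension. Hence the finite family \<open>\<L>\<close>, and with it the constant of
  submodularity, can be fixed before \<open>h\<close> is known. For a given \<open>h\<close> the pigeonhole principle finds a
  generation whose minima are almost minima over the next one.\<close>

theorem submodular_BL_inequality:
  fixes U :: "nat \<Rightarrow> (real ^ 'n) set"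
  assumes cond: "BL_condition m U p" and p': "\<forall>j\<in>{1..m}. 0 \<le> p j"
    and U': "\<forall>j\<in>{1..m}. subspace (U j)" and \<eta>: "0 < \<eta>"
  shows "\<exists>\<L> \<kappa>. finite \<L> \<and> (\<forall>V\<in>\<L>. subspace V) \<and> 0 < \<kappa> \<and>
    (\<forall>h \<Lambda> C. (\<forall>V\<in>\<L>. 0 \<le> h V) \<and> h {0} = 0 \<and> h UNIV \<le> \<Lambda> \<and> 0 < \<Lambda> \<and> C \<le> \<kappa> * \<Lambda> \<and>
       (\<forall>A\<in>\<L>. \<forall>B\<in>\<L>. h (A + B) + h (A \<inter> B) \<le> h A + h B + C) \<longrightarrow>
       h UNIV \<le> (\<Sum>j\<in>{1..m}. p j * h (U j)) + \<eta> * \<Lambda>)"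
proof -
  note p = p'[rule_format] and U = U'[rule_format]
  let ?n = "real CARD('n)"
  define P where "P = (\<Sum>j\<in>{1..m}. p j)"
  have P: "0 \<le> P" unfolding P_def by (intro sum_nonneg p)
  obtain N0 :: nat where N0: "2 * P * (?n + 1) / \<eta> \<le> real N0" using real_arch_simple by blast
  define N where "N = N0 + 4"
  have N: "4 \<le> N" "2 * P * (?n + 1) \<le> \<eta> * real N"
  proof -
    have "2 * P * (?n + 1) \<le> \<eta> * real N0" using N0 \<eta> by (simp add: field_simps)
    also have "\<dots> \<le> \<eta> * real N" unfolding N_def using \<eta> by (intro mult_left_mono) auto
    finally show "2 * P * (?n + 1) \<le> \<eta> * real N" .
  qed (simp add: N_def)
  define S where "S = 2 * N * N * (N + 1) * CARD('n) + 1"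
  define \<G> where "\<G> = insert {0} (insert UNIV (U ` {1..m}))"
  \<comment> \<open>Two generations at a time, since \<open>(U j \<inter> A) + B\<close> takes two lattice operations.\<close>
  define lev where "lev s = lattice_level \<G> (2 * s)" for s
  define \<L> where "\<L> = lev S"
  have \<G>sub: "subspace V" if "V \<in> \<G>" for V using that U by (auto simp: \<G>_def)
  have lev_fin: "finite (lev s)" for s
    unfolding lev_def \<G>_def by (intro finite_lattice_level) auto
  have lev_sub: "subspace V" if "V \<in> lev s" for V s
    using subspace_lattice_level[OF \<G>sub] that unfolding lev_def by blast
  have lev_mono: "lev s \<subseteq> lev t" if "s \<le> t" for s t
    unfolding lev_def using that by (intro lattice_level_mono) auto
  have lev0: "V \<in> lev s" if "V \<in> \<G>" for V s
    using lev_mono[of 0 s] that by (auto simp: lev_def)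
  have lev1: "lattice_level \<G> (Suc (2 * s)) \<subseteq> lev (Suc s)" "lev s \<subseteq> lattice_level \<G> (Suc (2 * s))" for s
    unfolding lev_def by (intro lattice_level_mono, simp)+
  have lev_plus: "A + B \<in> lev (Suc s)" "A \<inter> B \<in> lev (Suc s)" if "A \<in> lev s" "B \<in> lev s" for A B s
    using lattice_level_plus[of A \<G> "2 * s" B] lattice_level_Int[of A \<G> "2 * s" B] lev1(1)[of s] that
    by (auto simp: lev_def)
  have lev_3: "(A \<inter> B) + D \<in> lev (Suc s)" if "A \<in> lev s" "B \<in> lev s" "D \<in> lev s" for A B D s
  proof -
    have "A \<inter> B \<in> lattice_level \<G> (Suc (2 * s))" using that by (intro lattice_level_Int) (auto simp: lev_def)
    moreover have "D \<in> lattice_level \<G> (Suc (2 * s))" using that lev1(2) by blast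
    ultimately have "(A \<inter> B) + D \<in> lattice_level \<G> (Suc (Suc (2 * s)))" by (rule lattice_level_plus)
    then show ?thesis by (simp add: lev_def)
  qed
  define \<kappa> where "\<kappa> = 1 / (real N * real N)"
  show ?thesis
  proof (intro exI[of _ \<L>] exI[of _ \<kappa>] conjI allI impI ballI)
    show "finite \<L>" "\<And>V. V \<in> \<L> \<Longrightarrow> subspace V" unfolding \<L>_def using lev_fin lev_sub by auto
    show "0 < \<kappa>" using N by (simp add: \<kappa>_def)
    fix h :: "(real ^ 'n) set \<Rightarrow> real" and \<Lambda> C
    assume "(\<forall>V\<in>\<L>. 0 \<le> h V) \<and> h {0} = 0 \<and> h UNIV \<le> \<Lambda> \<and> 0 < \<Lambda> \<and> C \<le> \<kappa> * \<Lambda> \<and>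
       (\<forall>A\<in>\<L>. \<forall>B\<in>\<L>. h (A + B) + h (A \<inter> B) \<le> h A + h B + C)"
    then have h: "\<And>V. V \<in> \<L> \<Longrightarrow> 0 \<le> h V" "h {0} = 0" "h UNIV \<le> \<Lambda>" and \<Lambda>: "0 < \<Lambda>" and C: "C \<le> \<kappa> * \<Lambda>"
      and submod: "\<And>A B. A \<in> \<L> \<Longrightarrow> B \<in> \<L> \<Longrightarrow> h (A + B) + h (A \<inter> B) \<le> h A + h B + C"
      by auto
    \<comment> \<open>The largest slope \<open>N * \<tau> = 2 * \<Lambda>\<close> exceeds \<open>h UNIV\<close>, and \<open>N * (C + \<sigma>) \<le> \<tau>\<close> keeps the accumulated
      errors below one step.\<close>
    define \<tau> where "\<tau> = 2 * \<Lambda> / real N"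
    define \<sigma> where "\<sigma> = \<tau> / (2 * real N)"
    have \<tau>: "0 < \<tau>" "N * \<tau> = 2 * \<Lambda>" using \<Lambda> N by (auto simp: \<tau>_def)
    have C\<sigma>: "C \<le> \<sigma>" using C N by (simp add: \<kappa>_def \<sigma>_def \<tau>_def field_simps)
    have \<sigma>: "0 < \<sigma>" using \<tau> N by (simp add: \<sigma>_def)
    have \<sigma>\<tau>: "4 * (2 * \<sigma>) \<le> \<tau>"
    proof -
      have "4 * (2 * \<sigma>) \<le> real N * (2 * \<sigma>)" using \<sigma> N by (intro mult_right_mono) auto
      also have "\<dots> = \<tau>" using N by (simp add: \<sigma>_def)
      finally show ?thesis .
    qed
    define f where "f i V = h V - real i * \<tau> * real (dim V)" for i V
    define \<phi> where "\<phi> s i = Min (f i ` lev (min s S))" for s i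
    have ne: "lev s \<noteq> {}" for s using lev0[of UNIV s] by (auto simp: \<G>_def)
    have \<phi>_le: "\<phi> s i \<le> f i V" if "V \<in> lev (min s S)" for s i V
      unfolding \<phi>_def using that lev_fin by (intro Min_le) auto
    have \<phi>_in: "\<exists>V\<in>lev (min s S). \<phi> s i = f i V" for s i
      proof -
      have "\<phi> s i \<in> f i ` lev (min s S)" unfolding \<phi>_def using lev_fin ne by (intro Min_in) auto
      then show ?thesis by blast
    qed
    obtain s where s: "s < S" "\<And>i. i \<le> N \<Longrightarrow> \<phi> s i \<le> \<phi> (Suc s) i + \<sigma>"
    proof (rule pigeonhole_decreasing[of N "2 * \<Lambda> * ?n" \<phi> S \<sigma>])
      fix s i assume i: "i \<le> N"
      obtain V where V: "V \<in> lev (min s S)" "\<phi> s i = f i V" using \<phi>_in by blast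
      have "V \<in> \<L>" using V lev_mono[of "min s S" S] by (auto simp: \<L>_def)
      then have "0 \<le> h V" by (rule h)
      moreover have "real i * \<tau> * real (dim V) \<le> real N * \<tau> * ?n"
        using i \<tau> \<Lambda> dim_subset_UNIV[of V] by (intro mult_mono) auto
      ultimately show "- (2 * \<Lambda> * ?n) \<le> \<phi> s i" unfolding V f_def using \<tau> by simp
      show "\<phi> s i \<le> 0"
        using \<phi>_le[of "{0}" s i] lev0[of "{0}"] h by (simp add: f_def \<G>_def)
      show "\<phi> (Suc s) i \<le> \<phi> s i"
        unfolding \<phi>_def using lev_fin ne lev_mono[of "min s S" "min (Suc s) S"]
        by (intro Min_antimono image_mono) auto
    next
      have "real (Suc N) * (2 * \<Lambda> * ?n) = real (2 * N * N * (N + 1) * CARD('n)) * \<sigma>"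
        using N by (simp add: \<sigma>_def \<tau>_def field_simps)
      also have "\<dots> < real S * \<sigma>"
        unfolding S_def using \<sigma> by (intro mult_strict_right_mono) auto
      finally show "real (Suc N) * (2 * \<Lambda> * ?n) < real S * \<sigma>" .
    next
      fix s assume "s < S" "\<And>i. i \<le> N \<Longrightarrow> \<phi> s i \<le> \<phi> (Suc s) i + \<sigma>"
      then show thesis by (rule that)
    qed
    have ss: "min s S = s" "min (Suc s) S = Suc s" using s by auto
    have subL: "lev (Suc s) \<subseteq> \<L>" unfolding \<L>_def using s by (intro lev_mono) auto
    obtain K where K: "\<And>i. K i \<in> lev s" "\<And>i. \<phi> s i = f i (K i)"
      using \<phi>_in[of s] unfolding ss by metis
    have "h UNIV \<le> (\<Sum>j\<in>{1..m}. p j * h (U j)) + (\<Sum>j\<in>{1..m}. p j * (\<tau> * CARD('n) + N * (C + \<sigma>)))"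
    proof (rule slopes_argument[where \<A> = "lev s" and \<B> = "lev (Suc s)" and K = K])
      show "BL_condition m U p" "\<And>j. j \<in> {1..m} \<Longrightarrow> 0 \<le> p j" "\<And>j. j \<in> {1..m} \<Longrightarrow> subspace (U j)"
        by fact+
      show "\<And>V. V \<in> lev (Suc s) \<Longrightarrow> subspace V" by (rule lev_sub)
      show "\<And>V. V \<in> lev (Suc s) \<Longrightarrow> 0 \<le> h V" using subL h by blast
      show "h {0} = 0" by fact
      show "lev s \<subseteq> lev (Suc s)" by (rule lev_mono) simp
      show "\<And>A B. A \<in> lev s \<Longrightarrow> B \<in> lev s \<Longrightarrow> A + B \<in> lev (Suc s)"
        "\<And>A B. A \<in> lev s \<Longrightarrow> B \<in> lev s \<Longrightarrow> A \<inter> B \<in> lev (Suc s)" by (rule lev_plus; assumption)+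
      show "\<And>j A B. j \<in> {1..m} \<Longrightarrow> A \<in> lev s \<Longrightarrow> B \<in> lev s \<Longrightarrow> (U j \<inter> A) + B \<in> lev (Suc s)"
        by (rule lev_3) (auto intro: lev0 simp: \<G>_def)
      show "{0} \<in> lev s" "UNIV \<in> lev s" "\<And>j. j \<in> {1..m} \<Longrightarrow> U j \<in> lev s"
        by (auto intro: lev0 simp: \<G>_def)
      show "\<And>A B. A \<in> lev (Suc s) \<Longrightarrow> B \<in> lev (Suc s) \<Longrightarrow> h (A + B) + h (A \<inter> B) \<le> h A + h B + C"
        using subL by (intro submod) auto
      show "\<And>i. i \<le> N \<Longrightarrow> K i \<in> lev s" by (rule K)
      show "h (K i) - real i * \<tau> * real (dim (K i)) \<le> h V - real i * \<tau> * real (dim V)"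
        if "i \<le> N" "V \<in> lev s" for i V
        using \<phi>_le[of V s i] that K(2)[of i] by (simp add: ss f_def)
      show "h (K i) - real i * \<tau> * real (dim (K i)) \<le> h V - real i * \<tau> * real (dim V) + \<sigma>"
        if "i \<le> N" "V \<in> lev (Suc s)" for i V
        using \<phi>_le[of V "Suc s" i] s(2)[of i] that K(2)[of i] by (simp add: ss f_def)
      show "C + 2 * \<sigma> < \<tau>" using C\<sigma> \<sigma>\<tau> \<sigma> by linarith
      show "0 < \<tau>" by fact
      show "h UNIV < real N * \<tau>" using h \<tau> \<Lambda> by linarith
    qed
    also have "(\<Sum>j\<in>{1..m}. p j * (\<tau> * CARD('n) + N * (C + \<sigma>))) \<le> (\<Sum>j\<in>{1..m}. p j * (\<tau> * (?n + 1)))"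
    proof (intro sum_mono mult_left_mono p)
      have "N * (C + \<sigma>) \<le> N * (2 * \<sigma>)" using C\<sigma> by (intro mult_left_mono) auto
      also have "\<dots> = \<tau>" using N by (simp add: \<sigma>_def)
      finally show "\<tau> * CARD('n) + N * (C + \<sigma>) \<le> \<tau> * (?n + 1)" by (simp add: algebra_simps)
    qed
    also have "\<dots> = P * \<tau> * (?n + 1)" by (simp add: P_def sum_distrib_right mult.assoc)
    also have "\<dots> = (2 * P * (?n + 1)) * \<Lambda> / N" by (simp add: \<tau>_def)
    also have "\<dots> \<le> (\<eta> * real N) * \<Lambda> / N" using N \<Lambda> by (intro divide_right_mono mult_right_mono) auto
    also have "\<dots> = \<eta> * \<Lambda>" using N by simp
    finally show "h UNIV \<le> (\<Sum>j\<in>{1..m}. p j * h (U j)) + \<eta> * \<Lambda>" by simp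
  qed
qed

section \<open>The discrete inequality for parallel families\<close>

text \<open>Entropies on a ball of radius \<open>R\<close> are at most \<open>n * ln R + O(1)\<close>. With this bound as \<open>\<Lambda>\<close> the
  submodularity errors are negligible once an additive constant is included in \<open>\<Lambda>\<close>, and the loss
  \<open>\<eta>' * \<Lambda>\<close> becomes \<open>\<eta> * ln R + O(1)\<close>.\<close>

lemma entropy_BL_inequality:
  fixes U :: "nat \<Rightarrow> (real ^ 'n) set"
  assumes cond: "BL_condition m U p" and p': "\<forall>j\<in>{1..m}. 0 \<le> p j"
    and U': "\<forall>j\<in>{1..m}. subspace (U j)" and \<eta>: "0 < \<eta>"
  shows "\<exists>C. \<forall>R \<Omega> w. 1 \<le> R \<and> finite_dist \<Omega> w \<and> \<Omega> \<subseteq> {x. norm x \<le> R} \<longrightarrow>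
    finite_dist.ent \<Omega> w (rproj UNIV)
      \<le> (\<Sum>j\<in>{1..m}. p j * finite_dist.ent \<Omega> w (rproj (U j))) + \<eta> * ln R + C"
proof -
  let ?n = "real CARD('n)"
  define \<eta>' where "\<eta>' = \<eta> / ?n"
  have \<eta>': "0 < \<eta>'" using \<eta> by (simp add: \<eta>'_def)
  obtain \<L> :: "(real ^ 'n) set set" and \<kappa> where \<L>': "finite \<L>" "\<forall>V\<in>\<L>. subspace V" "0 < \<kappa>"
    and main: "\<forall>h \<Lambda> C. (\<forall>V\<in>\<L>. 0 \<le> h V) \<and> h {0} = 0 \<and> h UNIV \<le> \<Lambda> \<and> 0 < \<Lambda> \<and> C \<le> \<kappa> * \<Lambda> \<and>
       (\<forall>A\<in>\<L>. \<forall>B\<in>\<L>. h (A + B) + h (A \<inter> B) \<le> h A + h B + C) \<longrightarrow>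
       h UNIV \<le> (\<Sum>j\<in>{1..m}. p j * h (U j)) + \<eta>' * \<Lambda>"
    using submodular_BL_inequality[OF cond p' U' \<eta>'] by (elim exE conjE) (rule that; assumption)
  note \<L> = \<L>'(1) \<L>'(2)[rule_format] \<L>'(3)
  have "\<exists>C. \<forall>\<Omega> w. finite_dist \<Omega> w \<longrightarrow>
    finite_dist.ent \<Omega> w (rproj (A + B)) + finite_dist.ent \<Omega> w (rproj (A \<inter> B))
      \<le> finite_dist.ent \<Omega> w (rproj A) + finite_dist.ent \<Omega> w (rproj B) + C"
    if "A \<in> \<L>" "B \<in> \<L>" for A B
    using ent_rproj_submodular[OF \<L>(2)[OF that(1)] \<L>(2)[OF that(2)]] by metis
  then obtain c where c: "\<And>A B \<Omega> w. A \<in> \<L> \<Longrightarrow> B \<in> \<L> \<Longrightarrow> finite_dist \<Omega> w \<Longrightarrow>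
    finite_dist.ent \<Omega> w (rproj (A + B)) + finite_dist.ent \<Omega> w (rproj (A \<inter> B))
      \<le> finite_dist.ent \<Omega> w (rproj A) + finite_dist.ent \<Omega> w (rproj B) + c A B"
    by metis
  define C1 where "C1 = Max (insert 0 ((\<lambda>(A, B). c A B) ` (\<L> \<times> \<L>)))"
  have C1: "0 \<le> C1" "\<And>A B. A \<in> \<L> \<Longrightarrow> B \<in> \<L> \<Longrightarrow> c A B \<le> C1"
    unfolding C1_def using \<L>(1) by (auto intro!: Max_ge)
  define C2 where "C2 = \<bar>ln (6 ^ CARD('n) * (2 * ?n + 2) ^ CARD('n))\<bar>"
  define C3 where "C3 = C2 + C1 / \<kappa> + 1"
  have C2: "0 \<le> C2" by (simp add: C2_def)
  have C1\<kappa>: "0 \<le> C1 / \<kappa>" using C1(1) \<L>(3) by simp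
  have C3: "0 < C3" "C2 \<le> C3" using C2 C1\<kappa> by (auto simp: C3_def)
  have "\<kappa> * (C1 / \<kappa>) \<le> \<kappa> * C3" using C2 \<L>(3) by (intro mult_left_mono) (auto simp: C3_def)
  then have C1C3: "C1 \<le> \<kappa> * C3" using \<L>(3) by simp
  show ?thesis
  proof (intro exI[of _ "\<eta>' * C3"] allI impI, elim conjE)
    fix R :: real and \<Omega> :: "(real ^ 'n) set" and w
    assume R: "1 \<le> R" and fd: "finite_dist \<Omega> w" and \<Omega>: "\<Omega> \<subseteq> {x. norm x \<le> R}"
    interpret finite_dist \<Omega> w by fact
    define \<Lambda> where "\<Lambda> = ?n * ln R + C3"
    have \<Lambda>: "C3 \<le> \<Lambda>" using R by (simp add: \<Lambda>_def)
    have "ent (rproj UNIV) \<le> (\<Sum>j\<in>{1..m}. p j * ent (rproj (U j))) + \<eta>' * \<Lambda>"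
    proof (rule main[rule_format, where h = "\<lambda>V. ent (rproj V)" and C = C1], intro conjI ballI)
      show "0 \<le> ent (rproj V)" for V :: "(real ^ 'n) set" by (rule ent_nonneg)
      have "orth_proj {0} x = 0" for x :: "real ^ 'n"
        using orth_proj(1)[OF subspace_single_0, of x] by simp
      then have "rproj {0 :: real ^ 'n} = (\<lambda>_. rnd 0)" by (simp add: rproj_def[abs_def])
      then show "ent (rproj {0 :: real ^ 'n}) = 0" by (simp add: ent_const)
      show "ent (rproj UNIV) \<le> \<Lambda>"
      proof -
        have "ent (rproj UNIV) \<le> ?n * ln R + ln (6 ^ CARD('n) * (2 * ?n + 2) ^ CARD('n))"
          by (rule ent_rproj_UNIV_le[OF R, of "\<lambda>x. x"]) (use \<Omega> in auto)
        also have "\<dots> \<le> \<Lambda>" using C3(2) unfolding \<Lambda>_def C2_def by linarith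
        finally show ?thesis .
      qed
      show "0 < \<Lambda>" using \<Lambda> C3 by linarith
      have "\<kappa> * C3 \<le> \<kappa> * \<Lambda>" using \<Lambda> \<L>(3) by (intro mult_left_mono) auto
      then show "C1 \<le> \<kappa> * \<Lambda>" using C1C3 by linarith
      show "ent (rproj (A + B)) + ent (rproj (A \<inter> B)) \<le> ent (rproj A) + ent (rproj B) + C1"
        if "A \<in> \<L>" "B \<in> \<L>" for A B
        using c[OF that fd] C1(2)[OF that] by linarith
    qed
    also have "\<eta>' * \<Lambda> = \<eta> * ln R + \<eta>' * C3" by (simp add: \<Lambda>_def \<eta>'_def distrib_left)
    finally show "ent (rproj UNIV) \<le> (\<Sum>j\<in>{1..m}. p j * ent (rproj (U j))) + \<eta> * ln R + \<eta>' * C3"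
      by simp
  qed
qed

text \<open>A Brascamp--Lieb inequality at unit scale with a loss of \<open>R\<^sup>\<eta>\<close>. The index \<open>i\<close> stands for a unit
  neighbourhood of a translate of the orthogonal complement of \<open>U j\<close>: the points related to \<open>i\<close>
  agree up to \<open>D\<close> after projection to \<open>U j\<close>.

  The inequality is dual to the entropy inequality. For the distribution on \<open>B\<close> proportional to the
  summand, the logarithm of the left-hand side is the entropy plus the mean of the logarithm of the
  summand. The latter splits over \<open>j\<close>, and Gibbs' inequality bounds the entropy of the projection to
  \<open>U j\<close> plus the mean of the logarithm of the \<open>j\<close>-th multiplicity by the logarithm of the number of
  pairs of an index and a cell that it meets, which is at most a constant times \<open>card (I j)\<close>.\<close>

theorem discrete_BL_inequality:
  fixes U :: "nat \<Rightarrow> (real ^ 'n) set"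
  assumes cond: "BL_condition m U p" and p': "\<forall>j\<in>{1..m}. 0 \<le> p j"
    and U': "\<forall>j\<in>{1..m}. subspace (U j)" and \<eta>: "0 < \<eta>" and D: "0 \<le> D"
  shows "\<exists>C>0. \<forall>R B I rel. 1 \<le> R \<and> finite B \<and> inj_on rnd B \<and> B \<subseteq> {x. norm x \<le> R} \<and>
      (\<forall>j\<in>{1..m}. finite (I j) \<and> (\<forall>i::'b\<in>I j. \<forall>x\<in>B. \<forall>x'\<in>B. rel i x \<and> rel i x' \<longrightarrow>
         norm (orth_proj (U j) (x - x')) \<le> D)) \<longrightarrow>
      (\<Sum>x\<in>B. \<Prod>j\<in>{1..m}. nnpow (real (card {i\<in>I j. rel i x})) (p j))
        \<le> C * R powr \<eta> * (\<Prod>j\<in>{1..m}. nnpow (real (card (I j))) (p j))"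
proof -
  note p = p'[rule_format] and U = U'[rule_format]
  obtain C0 where C0: "\<And>R \<Omega> w. 1 \<le> R \<Longrightarrow> finite_dist \<Omega> w \<Longrightarrow> \<Omega> \<subseteq> {x. norm x \<le> R} \<Longrightarrow>
    finite_dist.ent \<Omega> w (rproj UNIV)
      \<le> (\<Sum>j\<in>{1..m}. p j * finite_dist.ent \<Omega> w (rproj (U j))) + \<eta> * ln R + C0"
    using entropy_BL_inequality[OF cond p' U' \<eta>] by blast
  define M where "M = (2 * D + 2) ^ CARD('n)"
  have M: "0 < M" using D by (simp add: M_def)
  define C where "C = exp C0 * (\<Prod>j\<in>{1..m}. nnpow M (p j))"
  show ?thesis
  proof (intro exI[of _ C] conjI allI impI)
    show "0 < C" unfolding C_def using M by (intro mult_pos_pos prod_pos) (auto intro: nnpow_pos)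
    fix R :: real and B :: "(real ^ 'n) set" and I :: "nat \<Rightarrow> 'b set" and rel :: "'b \<Rightarrow> real ^ 'n \<Rightarrow> bool"
    assume "1 \<le> R \<and> finite B \<and> inj_on rnd B \<and> B \<subseteq> {x. norm x \<le> R} \<and>
      (\<forall>j\<in>{1..m}. finite (I j) \<and> (\<forall>i\<in>I j. \<forall>x\<in>B. \<forall>x'\<in>B. rel i x \<and> rel i x' \<longrightarrow>
         norm (orth_proj (U j) (x - x')) \<le> D))"
    then have R: "1 \<le> R" and B: "finite B" "inj_on rnd B" "B \<subseteq> {x. norm x \<le> R}"
      and I: "\<And>j. j \<in> {1..m} \<Longrightarrow> finite (I j)"
      and rel: "\<And>j i x x'. j \<in> {1..m} \<Longrightarrow> i \<in> I j \<Longrightarrow> x \<in> B \<Longrightarrow> x' \<in> B \<Longrightarrow> rel i x \<Longrightarrow> rel i x' \<Longrightarrow>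
         norm (orth_proj (U j) (x - x')) \<le> D"
      by blast+
    define N where "N j x = real (card {i\<in>I j. rel i x})" for j x
    define F where "F x = (\<Prod>j\<in>{1..m}. nnpow (N j x) (p j))" for x
    define Z where "Z = (\<Sum>x\<in>B. F x)"
    have F0: "0 \<le> F x" for x unfolding F_def by (intro prod_nonneg) (simp add: nnpow_nonneg)
    have rhs0: "0 \<le> C * R powr \<eta> * (\<Prod>j\<in>{1..m}. nnpow (real (card (I j))) (p j))"
      using \<open>0 < C\<close> by (intro mult_nonneg_nonneg prod_nonneg) (auto simp: nnpow_nonneg)
    have "Z \<le> C * R powr \<eta> * (\<Prod>j\<in>{1..m}. nnpow (real (card (I j))) (p j))"
    proof (cases "Z = 0")
      case True
      with rhs0 show ?thesis by simp
    next
      case False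
      then have Z: "0 < Z" unfolding Z_def using F0 sum_nonneg[of B F] by auto
      define \<Omega> where "\<Omega> = {x\<in>B. 0 < F x}"
      have \<Omega>B: "\<Omega> \<subseteq> B" by (auto simp: \<Omega>_def)
      have Z\<Omega>: "(\<Sum>x\<in>\<Omega>. F x) = Z"
        unfolding Z_def by (rule sum.mono_neutral_left) (use B F0 in \<open>auto simp: \<Omega>_def less_le\<close>)
      define w where "w x = F x / Z" for x
      have fd: "finite_dist \<Omega> w"
        by unfold_locales
          (use B Z Z\<Omega> in \<open>auto simp: \<Omega>_def w_def sum_divide_distrib[symmetric]\<close>)
      interpret finite_dist \<Omega> w by fact
      have Npos: "0 < N j x" if "j \<in> {1..m}" "p j \<noteq> 0" "x \<in> \<Omega>" for j x
      proof (rule ccontr)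
        assume "\<not> ?thesis"
        then have "N j x = 0" by (simp add: N_def)
        then have "nnpow (N j x) (p j) = 0" using that by (simp add: nnpow_def)
        then have "F x = 0" unfolding F_def using that(1) by (intro prod_zero) auto
        with that show False by (simp add: \<Omega>_def)
      qed
      have lnF: "ln (F x) = (\<Sum>j\<in>{1..m}. p j * ln (N j x))" if x: "x \<in> \<Omega>" for x
      proof -
        have "ln (F x) = (\<Sum>j\<in>{1..m}. ln (nnpow (N j x) (p j)))"
          unfolding F_def
        proof (rule ln_prod)
          fix j assume "j \<in> {1..m}"
          then show "nnpow (N j x) (p j) \<noteq> 0"
            using Npos[OF _ _ x, of j] by (cases "p j = 0") (auto simp: nnpow_def)
        qed simp
        also have "\<dots> = (\<Sum>j\<in>{1..m}. p j * ln (N j x))"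
        proof (intro sum.cong refl)
          fix j assume "j \<in> {1..m}"
          then show "ln (nnpow (N j x) (p j)) = p j * ln (N j x)"
            using Npos[OF _ _ x, of j] by (cases "p j = 0") (auto simp: ln_nnpow, simp add: nnpow_def)
        qed
        finally show ?thesis .
      qed
      \<comment> \<open>Rounding is injective on \<open>B\<close>, so the entropy of the rounded point is that of \<open>w\<close> itself.\<close>
      have "ent (rproj UNIV) = ln Z - (\<Sum>x\<in>\<Omega>. w x * ln (F x))"
      proof -
        have "law (rproj UNIV) (rproj UNIV x) = w x" if "x \<in> \<Omega>" for x
        proof -
          have "{y\<in>\<Omega>. rnd y = rnd x} = {x}"
            using that \<Omega>B B(2) by (auto simp: inj_on_def)
          then show ?thesis by (simp add: law_def rproj_def)
        qed
        then have "ent (rproj UNIV) = - (\<Sum>x\<in>\<Omega>. w x * ln (w x))"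
          by (simp add: ent_def)
        also have "(\<Sum>x\<in>\<Omega>. w x * ln (w x)) = (\<Sum>x\<in>\<Omega>. w x * ln (F x) - w x * ln Z)"
          using Z by (intro sum.cong refl) (auto simp: \<Omega>_def w_def ln_div right_diff_distrib)
        also have "\<dots> = (\<Sum>x\<in>\<Omega>. w x * ln (F x)) - ln Z"
          by (simp add: sum_subtractf sum_distrib_right[symmetric] wsum)
        finally show ?thesis by simp
      qed
      then have "ln Z = ent (rproj UNIV) + (\<Sum>x\<in>\<Omega>. w x * ln (F x))" by simp
      also have "(\<Sum>x\<in>\<Omega>. w x * ln (F x)) = (\<Sum>x\<in>\<Omega>. \<Sum>j\<in>{1..m}. p j * (w x * ln (N j x)))"
        by (intro sum.cong refl) (simp add: lnF sum_distrib_left mult.left_commute)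
      also have "\<dots> = (\<Sum>j\<in>{1..m}. p j * (\<Sum>x\<in>\<Omega>. w x * ln (N j x)))"
        by (subst sum.swap) (simp add: sum_distrib_left)
      also have "ent (rproj UNIV) \<le> (\<Sum>j\<in>{1..m}. p j * ent (rproj (U j))) + \<eta> * ln R + C0"
        by (rule C0[OF R fd]) (use \<Omega>B B(3) in blast)
      finally have "ln Z \<le> (\<Sum>j\<in>{1..m}. p j * (ent (rproj (U j)) + (\<Sum>x\<in>\<Omega>. w x * ln (N j x)))) + \<eta> * ln R + C0"
        by (simp add: distrib_left sum.distrib)
      also have "(\<Sum>j\<in>{1..m}. p j * (ent (rproj (U j)) + (\<Sum>x\<in>\<Omega>. w x * ln (N j x))))
          \<le> (\<Sum>j\<in>{1..m}. ln (nnpow (M * card (I j)) (p j)))"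
      proof (rule sum_mono)
        fix j assume j: "j \<in> {1..m}"
        show "p j * (ent (rproj (U j)) + (\<Sum>x\<in>\<Omega>. w x * ln (N j x))) \<le> ln (nnpow (M * card (I j)) (p j))"
        proof (cases "p j = 0")
          case pj: False
          \<comment> \<open>The multiplicity of a whole fibre of the rounded projection. Each index contributes to at most
            \<open>M\<close> fibres.\<close>
          define q where "q y = real (card {i\<in>I j. \<exists>x\<in>\<Omega>. rproj (U j) x = y \<and> rel i x})" for y
          have Nq: "N j x \<le> q (rproj (U j) x)" if "x \<in> \<Omega>" for x
            unfolding N_def q_def using I[OF j] that by (auto intro!: card_mono)
          have "(\<Sum>y\<in>rproj (U j) ` \<Omega>. q y)
              = real (\<Sum>y\<in>rproj (U j) ` \<Omega>. card {i\<in>I j. \<exists>x\<in>\<Omega>. rproj (U j) x = y \<and> rel i x})"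
            by (simp add: q_def)
          also have "(\<Sum>y\<in>rproj (U j) ` \<Omega>. card {i\<in>I j. \<exists>x\<in>\<Omega>. rproj (U j) x = y \<and> rel i x})
              = (\<Sum>i\<in>I j. card {y\<in>rproj (U j) ` \<Omega>. \<exists>x\<in>\<Omega>. rproj (U j) x = y \<and> rel i x})"
            using sum.swap_restrict[of "rproj (U j) ` \<Omega>" "I j" "\<lambda>_ _. 1 :: nat"
                "\<lambda>y i. \<exists>x\<in>\<Omega>. rproj (U j) x = y \<and> rel i x"] fin I[OF j] by simp
          also have "real \<dots> \<le> (\<Sum>i\<in>I j. M)"
            unfolding of_nat_sum
          proof (rule sum_mono)
            fix i assume i: "i \<in> I j"
            have "{y\<in>rproj (U j) ` \<Omega>. \<exists>x\<in>\<Omega>. rproj (U j) x = y \<and> rel i x}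
                = rproj (U j) ` {x\<in>\<Omega>. rel i x}" (is "?A = ?B")
            proof (intro equalityI subsetI)
              fix y assume "y \<in> ?A"
              then have "\<exists>x\<in>\<Omega>. rproj (U j) x = y \<and> rel i x" by simp
              then obtain x where "x \<in> \<Omega>" "rel i x" "rproj (U j) x = y" by blast
              then show "y \<in> ?B" by (intro image_eqI[of _ _ x]) simp_all
            next
              fix y assume "y \<in> ?B"
              then obtain x where "x \<in> \<Omega>" "rel i x" "rproj (U j) x = y" by auto
              then show "y \<in> ?A" by auto
            qed
            also have "\<dots> = (\<lambda>x. rnd (orth_proj (U j) x)) ` {x\<in>\<Omega>. rel i x}"
              by (simp add: rproj_def[abs_def])
            finally have "?A = (\<lambda>x. rnd (orth_proj (U j) x)) ` {x\<in>\<Omega>. rel i x}" .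
            moreover have "real (card ((\<lambda>x. rnd (orth_proj (U j) x)) ` {x\<in>\<Omega>. rel i x})) \<le> M"
              unfolding M_def
              by (rule card_rnd_le(2)[OF D])
                (use rel[OF j i] \<Omega>B in \<open>auto simp: orth_proj_diff[OF U[OF j], symmetric]\<close>)
            ultimately show "real (card {y\<in>rproj (U j) ` \<Omega>. \<exists>x\<in>\<Omega>. rproj (U j) x = y \<and> rel i x}) \<le> M"
              by simp
          qed
          finally have sumq: "(\<Sum>y\<in>rproj (U j) ` \<Omega>. q y) \<le> M * card (I j)" by (simp add: mult.commute)
          have qpos: "0 < q (rproj (U j) x)" if "x \<in> \<Omega>" for x
            using Npos[OF j pj that] Nq[OF that] by linarith
          obtain x0 where x0: "x0 \<in> \<Omega>" using wsum by fastforce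
          have "0 < (\<Sum>y\<in>rproj (U j) ` \<Omega>. q y)"
            using fin x0 qpos by (intro sum_pos) auto
          with sumq have pos: "0 < M * card (I j)" by linarith
          have "(\<Sum>x\<in>\<Omega>. w x * ln (N j x)) \<le> (\<Sum>x\<in>\<Omega>. w x * ln (q (rproj (U j) x)))"
          proof (intro sum_mono mult_left_mono)
            fix x assume x: "x \<in> \<Omega>"
            show "ln (N j x) \<le> ln (q (rproj (U j) x))"
              using Npos[OF j pj x] Nq[OF x] by (intro ln_mono)
            show "0 \<le> w x" using wpos[OF x] by simp
          qed
          moreover have "ent (rproj (U j)) + (\<Sum>x\<in>\<Omega>. w x * ln (q (rproj (U j) x))) \<le> ln (M * card (I j))"
            using qpos sumq by (rule gibbs)
          ultimately have "ent (rproj (U j)) + (\<Sum>x\<in>\<Omega>. w x * ln (N j x)) \<le> ln (M * card (I j))"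
            by linarith
          then show ?thesis
            unfolding ln_nnpow[OF pos] using p[OF j] by (intro mult_left_mono)
        qed (simp add: nnpow_def)
      qed
      finally have lnZ: "ln Z \<le> (\<Sum>j\<in>{1..m}. ln (nnpow (M * card (I j)) (p j))) + \<eta> * ln R + C0"
        by simp
      have Ipos: "0 < nnpow (M * card (I j)) (p j)" if j: "j \<in> {1..m}" for j
      proof (cases "p j = 0")
        case False
        obtain x0 where "x0 \<in> \<Omega>" using wsum by fastforce
        then have "0 < N j x0" by (rule Npos[OF j False])
        also have "N j x0 \<le> card (I j)" unfolding N_def using I[OF j] by (auto intro: card_mono)
        finally show ?thesis using M by (intro nnpow_pos) simp
      qed (simp add: nnpow_def)
      have "Z \<le> exp ((\<Sum>j\<in>{1..m}. ln (nnpow (M * card (I j)) (p j))) + \<eta> * ln R + C0)"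
        using lnZ Z by (metis exp_le_cancel_iff exp_ln)
      also have "\<dots> = (\<Prod>j\<in>{1..m}. nnpow (M * card (I j)) (p j)) * R powr \<eta> * exp C0"
        using R Ipos by (simp add: exp_add exp_sum powr_def)
      also have "\<dots> = C * R powr \<eta> * (\<Prod>j\<in>{1..m}. nnpow (real (card (I j))) (p j))"
        using M by (simp add: C_def nnpow_mult prod.distrib)
      finally show ?thesis .
    qed
    then show "(\<Sum>x\<in>B. \<Prod>j\<in>{1..m}. nnpow (real (card {i\<in>I j. rel i x})) (p j))
        \<le> C * R powr \<eta> * (\<Prod>j\<in>{1..m}. nnpow (real (card (I j))) (p j))"
      by (simp add: Z_def F_def N_def)
  qed
qed

section \<open>Induction on scales\<close>

text \<open>Cells are half-open cubes of side \<open>r\<close> with corners in \<open>r\<close> times the integer lattice, labelled by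
  integer vectors. Coarsening passes to the cell of side \<open>\<mu> * r\<close> that contains the given one.\<close>

definition coarsen :: "nat \<Rightarrow> ('n \<Rightarrow> int) \<Rightarrow> 'n \<Rightarrow> int" where
  "coarsen \<mu> z = (\<lambda>i. z i div int \<mu>)"

text \<open>The constant \<open>n + 1\<close> survives coarsening by any factor \<open>\<mu> \<ge> n + 1\<close>: the corner of a cell moves
  by at most \<open>n * \<mu> * r\<close>, which leaves room \<open>\<mu> * r \<ge> (n + 1) * r\<close>.\<close>

definition near :: "real \<Rightarrow> ('n \<Rightarrow> int) \<Rightarrow> (real ^ 'n) set \<Rightarrow> bool" where
  "near r z A \<longleftrightarrow> (\<exists>a\<in>A. norm (a - r *\<^sub>R ivec z) \<le> (real CARD('n) + 1) * r)"

definition mult_product ::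
    "nat \<Rightarrow> (nat \<Rightarrow> real) \<Rightarrow> (nat \<Rightarrow> (real ^ 'n) set set) \<Rightarrow> real \<Rightarrow> ('n \<Rightarrow> int) \<Rightarrow> real" where
  "mult_product m p \<A> r z = (\<Prod>j\<in>{1..m}. nnpow (real (card {A\<in>\<A> j. near r z A})) (p j))"

lemma norm_ivec_coarsen:
  fixes z :: "'n::finite \<Rightarrow> int"
  assumes "0 < \<mu>"
  shows "norm (ivec z - real \<mu> *\<^sub>R ivec (coarsen \<mu> z)) \<le> real \<mu> * real CARD('n)"
proof (rule norm_le_card)
  fix i
  have "real_of_int (z i) - real \<mu> * real_of_int (z i div int \<mu>) = real_of_int (z i mod int \<mu>)"
    by (simp add: minus_div_mult_eq_mod[symmetric])
  moreover have "0 \<le> z i mod int \<mu>" "z i mod int \<mu> < int \<mu>" using assms by auto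
  ultimately have "0 \<le> real_of_int (z i) - real \<mu> * real_of_int (z i div int \<mu>)"
      "real_of_int (z i) - real \<mu> * real_of_int (z i div int \<mu>) \<le> real \<mu>" by linarith+
  then show "\<bar>(ivec z - real \<mu> *\<^sub>R ivec (coarsen \<mu> z)) $ i\<bar> \<le> real \<mu>"
    by (simp add: ivec_def coarsen_def)
qed

lemma near_coarsen:
  fixes z :: "'n::finite \<Rightarrow> int"
  assumes \<mu>: "real CARD('n) + 1 \<le> real \<mu>" and r: "0 < r" and near: "near r z A"
  shows "near (real \<mu> * r) (coarsen \<mu> z) A"
proof -
  let ?n = "real CARD('n)"
  obtain a where a: "a \<in> A" "norm (a - r *\<^sub>R ivec z) \<le> (?n + 1) * r"
    using near by (auto simp: near_def)
  have \<mu>0: "0 < \<mu>" using \<mu> by (cases "\<mu> = 0") auto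
  have "norm (r *\<^sub>R ivec z - (real \<mu> * r) *\<^sub>R ivec (coarsen \<mu> z))
      = r * norm (ivec z - real \<mu> *\<^sub>R ivec (coarsen \<mu> z))"
  proof -
    have "r *\<^sub>R ivec z - (real \<mu> * r) *\<^sub>R ivec (coarsen \<mu> z)
        = r *\<^sub>R (ivec z - real \<mu> *\<^sub>R ivec (coarsen \<mu> z))"
      by (simp add: scaleR_diff_right mult.commute)
    then show ?thesis using r by simp
  qed
  also have "\<dots> \<le> r * (real \<mu> * ?n)"
    using norm_ivec_coarsen[OF \<mu>0, of z] r by (intro mult_left_mono) auto
  finally have 1: "norm (r *\<^sub>R ivec z - (real \<mu> * r) *\<^sub>R ivec (coarsen \<mu> z)) \<le> r * (real \<mu> * ?n)" .
  have "norm (a - (real \<mu> * r) *\<^sub>R ivec (coarsen \<mu> z)) \<le>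
      norm (a - r *\<^sub>R ivec z) + norm (r *\<^sub>R ivec z - (real \<mu> * r) *\<^sub>R ivec (coarsen \<mu> z))"
    by (rule norm_diff_triangle_ineq[of a "r *\<^sub>R ivec z" "r *\<^sub>R ivec z", simplified])
  also have "\<dots> \<le> real \<mu> * r + r * (real \<mu> * ?n)"
    using a(2) 1 mult_right_mono[OF \<mu>, of r] r by linarith
  also have "\<dots> = (?n + 1) * (real \<mu> * r)" by (simp add: algebra_simps)
  finally show ?thesis using a(1) by (auto simp: near_def)
qed

text \<open>One step of Guth's induction on scales. Cells of side \<open>r\<close> that are near the same \<open>A\<close> and lie in one
  cell of side \<open>\<mu> * r\<close> project to \<open>U j\<close> at distance \<open>O(r)\<close> of each other, because the direction of
  \<open>A\<close> deviates by at most \<open>1 / \<mu>\<close>. So, after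
  rescaling by \<open>r\<close>, inside each such cell the discrete Brascamp--Lieb inequality applies. Its constant
  and its loss \<open>\<mu>\<^sup>\<eta>\<close> with \<open>\<eta> = \<epsilon> / 2\<close> are together below \<open>\<mu>\<^sup>\<epsilon>\<close> if \<open>\<mu>\<close> is large.\<close>

lemma scale_step:
  fixes U :: "nat \<Rightarrow> (real ^ 'n) set"
  assumes cond: "BL_condition m U p" and p: "\<forall>j\<in>{1..m}. 0 \<le> p j"
    and U: "\<forall>j\<in>{1..m}. subspace (U j)" and \<epsilon>: "0 < \<epsilon>"
  shows "\<exists>\<mu>\<ge>2. \<forall>r Z \<A>. 0 < r \<and> finite Z \<and>
      (\<forall>j\<in>{1..m}. finite (\<A> j) \<and>
        (\<forall>A\<in>\<A> j. \<forall>a\<in>A. \<forall>a'\<in>A. norm (orth_proj (U j) (a - a')) \<le> norm (a - a') / real \<mu>)) \<longrightarrow>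
      (\<Sum>z\<in>Z. mult_product m p \<A> r z)
        \<le> real \<mu> powr \<epsilon> * (\<Sum>z\<in>coarsen \<mu> ` Z. mult_product m p \<A> (real \<mu> * r) z)"
proof -
  let ?n = "real CARD('n)"
  have n1: "1 \<le> ?n" by (simp add: Suc_leI)
  define \<eta> where "\<eta> = \<epsilon> / 2"
  have \<eta>: "0 < \<eta>" using \<epsilon> by (simp add: \<eta>_def)
  have D: "0 \<le> 4 * ?n + 4" by simp
  obtain C where C: "0 < C" and disc': "\<forall>R B I rel. 1 \<le> R \<and> finite B \<and> inj_on rnd B \<and> B \<subseteq> {x. norm x \<le> R} \<and>
      (\<forall>j\<in>{1..m}. finite (I j) \<and> (\<forall>i::(real^'n) set\<in>I j. \<forall>x\<in>B. \<forall>x'\<in>B. rel i x \<and> rel i x' \<longrightarrow>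
         norm (orth_proj (U j) (x - x')) \<le> 4 * ?n + 4)) \<longrightarrow>
      (\<Sum>x\<in>B. \<Prod>j\<in>{1..m}. nnpow (real (card {i\<in>I j. rel i x})) (p j))
        \<le> C * R powr \<eta> * (\<Prod>j\<in>{1..m}. nnpow (real (card (I j))) (p j))"
    using discrete_BL_inequality[OF cond p U \<eta> D, where 'b = "(real ^ 'n) set"]
    by (elim exE conjE) (rule that; assumption)
  note disc = disc'[rule_format]
  obtain \<mu> :: nat where \<mu>': "max (?n + 1) ((C * ?n powr \<eta>) powr (1 / \<eta>)) \<le> real \<mu>"
    using real_arch_simple by blast
  then have \<mu>: "?n + 1 \<le> real \<mu>" "(C * ?n powr \<eta>) powr (1 / \<eta>) \<le> real \<mu>" by auto
  have \<mu>2: "2 \<le> \<mu>" using \<mu>(1) n1 by linarith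
  have const: "C * (real \<mu> * ?n) powr \<eta> \<le> real \<mu> powr \<epsilon>"
  proof -
    have "C * ?n powr \<eta> = ((C * ?n powr \<eta>) powr (1 / \<eta>)) powr \<eta>"
      using C n1 \<eta> by (simp add: powr_powr)
    also have "\<dots> \<le> real \<mu> powr \<eta>" using \<mu>(2) \<eta> by (intro powr_mono2) auto
    finally have "real \<mu> powr \<eta> * (C * ?n powr \<eta>) \<le> real \<mu> powr \<eta> * real \<mu> powr \<eta>"
      by (intro mult_left_mono) auto
    also have "\<dots> = real \<mu> powr \<epsilon>" by (simp add: powr_add[symmetric] \<eta>_def)
    finally show ?thesis by (simp add: powr_mult algebra_simps)
  qed
  show ?thesis
  proof (intro exI[of _ \<mu>] conjI allI impI)
    fix r :: real and Z :: "('n \<Rightarrow> int) set" and \<A> :: "nat \<Rightarrow> (real ^ 'n) set set"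
    assume H: "0 < r \<and> finite Z \<and> (\<forall>j\<in>{1..m}. finite (\<A> j) \<and>
        (\<forall>A\<in>\<A> j. \<forall>a\<in>A. \<forall>a'\<in>A. norm (orth_proj (U j) (a - a')) \<le> norm (a - a') / real \<mu>))"
    then have r: "0 < r" and Z: "finite Z" by auto
    have cell: "(\<Sum>z\<in>{z\<in>Z. coarsen \<mu> z = z'}. mult_product m p \<A> r z)
        \<le> real \<mu> powr \<epsilon> * mult_product m p \<A> (real \<mu> * r) z'" for z'
    proof -
      let ?Z = "{z\<in>Z. coarsen \<mu> z = z'}"
      define v where "v = real \<mu> *\<^sub>R (ivec z' :: real ^ 'n)"
      define f where "f z = ivec z - v" for z :: "'n \<Rightarrow> int"
      define I where "I j = {A\<in>\<A> j. near (real \<mu> * r) z' A}" for j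
      define rel where "rel A x \<longleftrightarrow> (\<exists>a\<in>A. norm (a - r *\<^sub>R (x + v)) \<le> (?n + 1) * r)"
        for A :: "(real ^ 'n) set" and x
      have rnd_f: "rnd (f z) i = z i - int \<mu> * z' i" for z i
      proof -
        have "f z $ i = real_of_int (z i - int \<mu> * z' i)" by (simp add: f_def v_def ivec_def)
        then show ?thesis by (simp only: rnd_apply floor_of_int)
      qed
      have inj_rf: "inj (\<lambda>z. rnd (f z))"
      proof (rule injI)
        fix x y :: "'n \<Rightarrow> int" assume "rnd (f x) = rnd (f y)"
        then have "rnd (f x) i = rnd (f y) i" for i by simp
        then show "x = y" by (auto simp: rnd_f)
      qed
      have inj_f: "inj_on f A" for A
        using inj_rf by (auto simp: inj_on_def)
      have norm_f: "norm (f z) \<le> real \<mu> * ?n" if "z \<in> ?Z" for z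
        using norm_ivec_coarsen[of \<mu> z] that \<mu>2 by (auto simp: f_def v_def)
      have rel_near: "rel A (f z) \<longleftrightarrow> near r z A" for A z
        by (simp add: rel_def near_def f_def)
      have "(\<Sum>x\<in>f ` ?Z. \<Prod>j\<in>{1..m}. nnpow (real (card {A\<in>I j. rel A x})) (p j))
          \<le> C * (real \<mu> * ?n) powr \<eta> * (\<Prod>j\<in>{1..m}. nnpow (real (card (I j))) (p j))"
      proof (rule disc, intro conjI ballI impI)
        show "1 \<le> real \<mu> * ?n" using \<mu>2 n1 mult_mono[of 1 "real \<mu>" 1 ?n] by simp
        show "finite (f ` ?Z)" using Z by simp
        show "inj_on rnd (f ` ?Z)" using inj_rf by (auto simp: inj_on_def)
        show "f ` ?Z \<subseteq> {x. norm x \<le> real \<mu> * ?n}" using norm_f by blast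
        fix j assume j: "j \<in> {1..m}"
        show "finite (I j)" using H j by (auto simp: I_def)
        fix A x x' assume A: "A \<in> I j" and x: "x \<in> f ` ?Z" "x' \<in> f ` ?Z" and "rel A x \<and> rel A x'"
        then obtain a a' where a: "a \<in> A" "norm (a - r *\<^sub>R (x + v)) \<le> (?n + 1) * r"
            "a' \<in> A" "norm (a' - r *\<^sub>R (x' + v)) \<le> (?n + 1) * r"
          unfolding rel_def by blast
        define e where "e = (a - r *\<^sub>R (x + v)) - (a' - r *\<^sub>R (x' + v))"
        have "norm e \<le> (?n + 1) * r + (?n + 1) * r"
          using norm_triangle_ineq4[of "a - r *\<^sub>R (x + v)" "a' - r *\<^sub>R (x' + v)"] a(2,4)
          unfolding e_def by linarith
        then have e: "norm e \<le> 2 * (?n + 1) * r" by (simp add: algebra_simps)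
        have aa: "a - a' = r *\<^sub>R (x - x') + e" by (simp add: e_def algebra_simps)
        have xx: "norm (x - x') \<le> 2 * (real \<mu> * ?n)"
        proof -
          have "norm x \<le> real \<mu> * ?n" "norm x' \<le> real \<mu> * ?n" using x norm_f by blast+
          then show ?thesis using norm_triangle_ineq4[of x x'] by linarith
        qed
        have sU: "subspace (U j)" using U j by blast
        have "norm (a - a') \<le> r * (2 * (real \<mu> * ?n)) + 2 * (?n + 1) * r"
        proof -
          have "norm (a - a') \<le> r * norm (x - x') + norm e"
            unfolding aa using norm_triangle_ineq[of "r *\<^sub>R (x - x')" e] r by simp
          also have "\<dots> \<le> r * (2 * (real \<mu> * ?n)) + 2 * (?n + 1) * r"
            using xx e r by (intro add_mono mult_left_mono) auto
          finally show ?thesis .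
        qed
        also have "\<dots> \<le> r * (2 * (real \<mu> * ?n)) + 2 * real \<mu> * r"
          using \<mu>(1) r by (intro add_left_mono mult_right_mono) auto
        also have "\<dots> = real \<mu> * (r * (2 * ?n + 2))" by (simp add: algebra_simps)
        finally have "norm (a - a') / real \<mu> \<le> r * (2 * ?n + 2)"
          using \<mu>2 by (simp add: field_simps)
        moreover have "norm (orth_proj (U j) (a - a')) \<le> norm (a - a') / real \<mu>"
          using H j A a by (auto simp: I_def)
        moreover have "r *\<^sub>R orth_proj (U j) (x - x') = orth_proj (U j) (a - a') - orth_proj (U j) e"
          by (simp add: aa linear_orth_proj[OF sU] linear_add linear_cmul)
        then have "r * norm (orth_proj (U j) (x - x')) \<le> norm (orth_proj (U j) (a - a')) + norm (orth_proj (U j) e)"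
          using norm_triangle_ineq4[of "orth_proj (U j) (a - a')" "orth_proj (U j) e"] r
          by (metis abs_of_pos norm_scaleR)
        moreover have "norm (orth_proj (U j) e) \<le> 2 * (?n + 1) * r"
          using norm_orth_proj_le[OF sU, of e] e by linarith
        ultimately have "r * norm (orth_proj (U j) (x - x')) \<le> r * (4 * ?n + 4)"
          by (simp add: algebra_simps)
        then show "norm (orth_proj (U j) (x - x')) \<le> 4 * ?n + 4" using r by simp
      qed
      also have "(\<Prod>j\<in>{1..m}. nnpow (real (card (I j))) (p j)) = mult_product m p \<A> (real \<mu> * r) z'"
        by (simp add: mult_product_def I_def)
      also have "(\<Sum>x\<in>f ` ?Z. \<Prod>j\<in>{1..m}. nnpow (real (card {A\<in>I j. rel A x})) (p j))
          = (\<Sum>z\<in>?Z. \<Prod>j\<in>{1..m}. nnpow (real (card {A\<in>I j. rel A (f z)})) (p j))"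
        by (rule sum.reindex_cong[OF inj_f]) auto
      also have "\<dots> = (\<Sum>z\<in>?Z. mult_product m p \<A> r z)"
      proof (intro sum.cong refl)
        fix z assume z: "z \<in> ?Z"
        have "{A\<in>I j. rel A (f z)} = {A\<in>\<A> j. near r z A}" for j
          using near_coarsen[OF \<mu>(1) r, of z] z by (auto simp: I_def rel_near)
        then show "(\<Prod>j\<in>{1..m}. nnpow (real (card {A\<in>I j. rel A (f z)})) (p j)) = mult_product m p \<A> r z"
          by (simp add: mult_product_def)
      qed
      finally have "(\<Sum>z\<in>?Z. mult_product m p \<A> r z)
          \<le> C * (real \<mu> * ?n) powr \<eta> * mult_product m p \<A> (real \<mu> * r) z'" .
      also have "\<dots> \<le> real \<mu> powr \<epsilon> * mult_product m p \<A> (real \<mu> * r) z'"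
        using const by (intro mult_right_mono) (auto simp: mult_product_def intro!: prod_nonneg nnpow_nonneg)
      finally show ?thesis .
    qed
    have "(\<Sum>z\<in>Z. mult_product m p \<A> r z)
        = (\<Sum>z'\<in>coarsen \<mu> ` Z. \<Sum>z\<in>{z\<in>Z. coarsen \<mu> z = z'}. mult_product m p \<A> r z)"
      by (rule sum.image_gen[OF Z])
    also have "\<dots> \<le> (\<Sum>z'\<in>coarsen \<mu> ` Z. real \<mu> powr \<epsilon> * mult_product m p \<A> (real \<mu> * r) z')"
      by (intro sum_mono cell)
    finally show "(\<Sum>z\<in>Z. mult_product m p \<A> r z)
        \<le> real \<mu> powr \<epsilon> * (\<Sum>z\<in>coarsen \<mu> ` Z. mult_product m p \<A> (real \<mu> * r) z)"
      by (simp add: sum_distrib_left)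
  qed (fact \<mu>2)
qed

definition cells :: "real \<Rightarrow> ('n::finite \<Rightarrow> int) set" where
  "cells r = (\<lambda>x :: real ^ 'n. rnd ((1 / r) *\<^sub>R x)) ` {x. \<forall>i. -1 \<le> x $ i \<and> x $ i \<le> 1}"

lemma coarsen_rnd:
  assumes "0 < \<mu>"
  shows "coarsen \<mu> (rnd x) = rnd ((1 / real \<mu>) *\<^sub>R x)"
  using floor_divide_real_eq_div[of "int \<mu>"] assms
  by (simp add: fun_eq_iff coarsen_def rnd_apply)

lemma coarsen_cells:
  assumes "0 < \<mu>"
  shows "coarsen \<mu> ` cells r = (cells (real \<mu> * r) :: ('n::finite \<Rightarrow> int) set)"
  unfolding cells_def image_image coarsen_rnd[OF assms] by (simp add: mult.commute)

lemma card_cells_le: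
  assumes "0 < r"
  shows "finite (cells r :: ('n::finite \<Rightarrow> int) set)"
    "real (card (cells r :: ('n::finite \<Rightarrow> int) set)) \<le> (4 / r + 2) ^ CARD('n)"
proof -
  let ?S = "(\<lambda>x :: real ^ 'n. ($) ((1 / r) *\<^sub>R x)) ` {x. \<forall>i. -1 \<le> x $ i \<and> x $ i \<le> 1}"
  have "\<bar>y i - y' i\<bar> \<le> 2 / r" if yS: "y \<in> ?S" "y' \<in> ?S" for y y' :: "'n \<Rightarrow> real" and i
  proof -
    obtain x x' :: "real ^ 'n" where x: "y = ($) ((1 / r) *\<^sub>R x)" "y' = ($) ((1 / r) *\<^sub>R x')"
        "\<forall>i. -1 \<le> x $ i \<and> x $ i \<le> 1" "\<forall>i. -1 \<le> x' $ i \<and> x' $ i \<le> 1" using yS by blast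
    then have "-1 \<le> x $ i" "x $ i \<le> 1" "-1 \<le> x' $ i" "x' $ i \<le> 1" by auto
    then have xx: "\<bar>x $ i - x' $ i\<bar> \<le> 2" by linarith
    have "\<bar>y i - y' i\<bar> = \<bar>x $ i - x' $ i\<bar> / r" using assms x by (simp add: diff_divide_distrib[symmetric])
    also have "\<dots> \<le> 2 / r" using assms xx by (intro divide_right_mono) auto
    finally show ?thesis .
  qed
  then have "finite (floors UNIV ` ?S) \<and> real (card (floors UNIV ` ?S)) \<le> (2 * (2 / r) + 2) ^ CARD('n)"
    using assms by (intro card_floors_le) auto
  moreover have "floors UNIV ` ?S = cells r" by (simp add: cells_def rnd_def image_image)
  ultimately show "finite (cells r :: ('n::finite \<Rightarrow> int) set)"
    "real (card (cells r :: ('n::finite \<Rightarrow> int) set)) \<le> (4 / r + 2) ^ CARD('n)" by simp_all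
qed

lemma mult_product_le:
  assumes "\<forall>j\<in>{1..m}. 0 \<le> p j" "\<forall>j\<in>{1..m}. finite (\<A> j)"
  shows "mult_product m p \<A> r z \<le> (\<Prod>j\<in>{1..m}. nnpow (real (card (\<A> j))) (p j))"
  unfolding mult_product_def
  using assms by (intro prod_mono conjI nnpow_nonneg nnpow_mono) (auto intro: card_mono)

text \<open>Iteration of the scale step from \<open>\<delta>\<close> up to scale \<open>1\<close>, where boundedly many cells remain and
  every multiplicity is at most the total number. The factor is \<open>\<mu>\<^sup>\<epsilon>\<close> for each of about
  \<open>log (1 / \<delta>) / log \<mu>\<close> steps. The admissible angle \<open>\<nu> = 1 / \<mu>\<close> still depends on \<open>\<epsilon>\<close>.\<close>

theorem discrete_Kakeya:
  fixes U :: "nat \<Rightarrow> (real ^ 'n) set"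
  assumes cond: "BL_condition m U p" and p: "\<forall>j\<in>{1..m}. 0 \<le> p j"
    and U: "\<forall>j\<in>{1..m}. subspace (U j)" and \<epsilon>: "0 < \<epsilon>"
  shows "\<exists>\<nu>>0. \<exists>C\<ge>0. \<forall>\<delta> \<A>. 0 < \<delta> \<and> \<delta> \<le> 1 \<and>
      (\<forall>j\<in>{1..m}. finite (\<A> j) \<and>
        (\<forall>A\<in>\<A> j. \<forall>a\<in>A. \<forall>a'\<in>A. norm (orth_proj (U j) (a - a')) \<le> \<nu> * norm (a - a'))) \<longrightarrow>
      (\<Sum>z\<in>cells \<delta>. mult_product m p \<A> \<delta> z)
        \<le> C * \<delta> powr - \<epsilon> * (\<Prod>j\<in>{1..m}. nnpow (real (card (\<A> j))) (p j))"
proof -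
  obtain \<mu> :: nat where \<mu>: "2 \<le> \<mu>" and step: "\<And>r Z \<A>. 0 < r \<and> finite Z \<and>
      (\<forall>j\<in>{1..m}. finite (\<A> j) \<and>
        (\<forall>A\<in>\<A> j. \<forall>a\<in>A. \<forall>a'\<in>A. norm (orth_proj (U j) (a - a')) \<le> norm (a - a') / real \<mu>)) \<Longrightarrow>
      (\<Sum>z\<in>Z. mult_product m p \<A> r z)
        \<le> real \<mu> powr \<epsilon> * (\<Sum>z\<in>coarsen \<mu> ` Z. mult_product m p \<A> (real \<mu> * r) z)"
    using scale_step[OF cond p U \<epsilon>] by blast
  define C where "C = real \<mu> powr \<epsilon> * 6 ^ CARD('n)"
  show ?thesis
  proof (rule exI[of _ "1 / real \<mu>"], rule conjI, use \<mu> in simp, rule exI[of _ C], intro conjI allI impI)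
    show "0 \<le> C" by (simp add: C_def)
    fix \<delta> :: real and \<A> :: "nat \<Rightarrow> (real ^ 'n) set set"
    let ?P = "\<Prod>j\<in>{1..m}. nnpow (real (card (\<A> j))) (p j)"
    assume "0 < \<delta> \<and> \<delta> \<le> 1 \<and> (\<forall>j\<in>{1..m}. finite (\<A> j) \<and>
        (\<forall>A\<in>\<A> j. \<forall>a\<in>A. \<forall>a'\<in>A. norm (orth_proj (U j) (a - a')) \<le> 1 / real \<mu> * norm (a - a')))"
    then have \<delta>: "0 < \<delta>" "\<delta> \<le> 1" and H: "\<forall>j\<in>{1..m}. finite (\<A> j) \<and>
        (\<forall>A\<in>\<A> j. \<forall>a\<in>A. \<forall>a'\<in>A. norm (orth_proj (U j) (a - a')) \<le> norm (a - a') / real \<mu>)"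
      by auto
    have P0: "0 \<le> ?P" by (intro prod_nonneg) (simp add: nnpow_nonneg)
    have iter: "(\<Sum>z\<in>cells r. mult_product m p \<A> r z)
        \<le> (real \<mu> powr \<epsilon>) ^ k * real (card (cells (real \<mu> ^ k * r) :: ('n \<Rightarrow> int) set)) * ?P"
      if "0 < r" for r k
      using that
    proof (induction k arbitrary: r)
      case 0
      have "(\<Sum>z\<in>cells r. mult_product m p \<A> r z) \<le> (\<Sum>z\<in>(cells r :: ('n \<Rightarrow> int) set). ?P)"
        using p H by (intro sum_mono mult_product_le) auto
      then show ?case by simp
    next
      case (Suc k)
      have "(\<Sum>z\<in>cells r. mult_product m p \<A> r z)
          \<le> real \<mu> powr \<epsilon> * (\<Sum>z\<in>cells (real \<mu> * r). mult_product m p \<A> (real \<mu> * r) z)"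
      proof -
        have "finite (cells r :: ('n \<Rightarrow> int) set)" by (rule card_cells_le(1)[OF Suc.prems])
        moreover have "coarsen \<mu> ` cells r = (cells (real \<mu> * r) :: ('n \<Rightarrow> int) set)"
          using \<mu> by (intro coarsen_cells) simp
        ultimately show ?thesis using step[of r "cells r" \<A>] Suc.prems H by simp
      qed
      also have "\<dots> \<le> real \<mu> powr \<epsilon> * ((real \<mu> powr \<epsilon>) ^ k
          * real (card (cells (real \<mu> ^ k * (real \<mu> * r)) :: ('n \<Rightarrow> int) set)) * ?P)"
        using Suc.prems \<mu> by (intro mult_left_mono Suc.IH) auto
      finally show ?case by (simp add: mult_ac)
    qed
    have "\<exists>k. 1 \<le> real \<mu> ^ k * \<delta> \<and> real \<mu> ^ k \<le> real \<mu> / \<delta>"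
    proof -
      obtain k0 where "1 / \<delta> < real \<mu> ^ k0" using real_arch_pow[of "real \<mu>" "1 / \<delta>"] \<mu> by auto
      then have ex: "\<exists>k. 1 \<le> real \<mu> ^ k * \<delta>" using \<delta> by (intro exI[of _ k0]) (simp add: field_simps)
      define k where "k = (LEAST k. 1 \<le> real \<mu> ^ k * \<delta>)"
      have k: "1 \<le> real \<mu> ^ k * \<delta>" unfolding k_def by (rule LeastI_ex[OF ex])
      have "real \<mu> ^ k \<le> real \<mu> / \<delta>"
      proof (cases k)
        case 0
        have "1 * \<delta> \<le> real \<mu>" using \<delta> \<mu> by simp
        with 0 \<delta> show ?thesis by (simp add: field_simps)
      next
        case (Suc k')
        then have "\<not> 1 \<le> real \<mu> ^ k' * \<delta>" using not_less_Least[of k' "\<lambda>k. 1 \<le> real \<mu> ^ k * \<delta>"] by (simp add: k_def)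
        then have "real \<mu> * (real \<mu> ^ k' * \<delta>) \<le> real \<mu> * 1" by (intro mult_left_mono) auto
        with Suc \<delta> show ?thesis by (simp add: field_simps)
      qed
      with k show ?thesis by blast
    qed
    then obtain k where k: "1 \<le> real \<mu> ^ k * \<delta>" "real \<mu> ^ k \<le> real \<mu> / \<delta>" by blast
    have "(real \<mu> powr \<epsilon>) ^ k = (real \<mu> ^ k) powr \<epsilon>"
      using \<mu> by (simp add: powr_realpow[symmetric] powr_powr mult.commute)
    also have "\<dots> \<le> (real \<mu> / \<delta>) powr \<epsilon>" using k \<epsilon> by (intro powr_mono2) auto
    also have "\<dots> = real \<mu> powr \<epsilon> * \<delta> powr - \<epsilon>" using \<delta> by (simp add: powr_divide powr_minus_divide)
    finally have 1: "(real \<mu> powr \<epsilon>) ^ k \<le> real \<mu> powr \<epsilon> * \<delta> powr - \<epsilon>" .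
    have 2: "real (card (cells (real \<mu> ^ k * \<delta>) :: ('n \<Rightarrow> int) set)) \<le> 6 ^ CARD('n)"
    proof -
      have pos: "0 < real \<mu> ^ k * \<delta>" using \<mu> \<delta> by simp
      have "4 / (real \<mu> ^ k * \<delta>) + 2 \<le> 6" using k(1) pos by (simp add: field_simps)
      then have "(4 / (real \<mu> ^ k * \<delta>) + 2) ^ CARD('n) \<le> 6 ^ CARD('n)" using pos by (intro power_mono) auto
      with card_cells_le(2)[OF pos, where 'n = 'n] show ?thesis by linarith
    qed
    have "(\<Sum>z\<in>cells \<delta>. mult_product m p \<A> \<delta> z)
        \<le> (real \<mu> powr \<epsilon>) ^ k * real (card (cells (real \<mu> ^ k * \<delta>) :: ('n \<Rightarrow> int) set)) * ?P"
      by (rule iter) (fact \<delta>)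
    also have "\<dots> \<le> (real \<mu> powr \<epsilon> * \<delta> powr - \<epsilon>) * 6 ^ CARD('n) * ?P"
      using 1 2 P0 by (intro mult_mono mult_nonneg_nonneg) auto
    also have "\<dots> = C * \<delta> powr - \<epsilon> * ?P" by (simp add: C_def mult_ac)
    finally show "(\<Sum>z\<in>cells \<delta>. mult_product m p \<A> \<delta> z) \<le> C * \<delta> powr - \<epsilon> * ?P" .
  qed
qed

section \<open>Necessity of the dimension condition\<close>

lemma subspace_ker:
  assumes "surj_linear_map k L"
  shows "subspace (ker k L)"
proof -
  have lin: "linear (\<lambda>x. L x i)" if "i \<in> {1..k}" for i using assms that by (auto simp: surj_linear_map_def)
  show ?thesis
  proof (rule subspaceI)
    show "0 \<in> ker k L" using linear_0[OF lin] by (auto simp: ker_def)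
    show "x + y \<in> ker k L" if "x \<in> ker k L" "y \<in> ker k L" for x y
      using that linear_add[OF lin] by (auto simp: ker_def)
    show "c *\<^sub>R x \<in> ker k L" if "x \<in> ker k L" for c x
      using that linear_cmul[OF lin] by (auto simp: ker_def)
  qed
qed

text \<open>Within \<open>U\<close>, the orthogonal complement of the image is \<open>U \<inter> K\<^sup>\<bottom>\<^sup>\<bottom>\<close>.\<close>

lemma dim_orth_proj_image:
  fixes U K :: "(real ^ 'n) set"
  assumes U: "subspace U" and K: "subspace K"
  shows "real (dim (orth_proj U ` (K\<^sup>\<bottom>))) = real (dim U) - real (dim (U \<inter> K))"
proof -
  let ?W = "orth_proj U ` (K\<^sup>\<bottom>)"
  have W: "subspace ?W"
    by (intro linear_subspace_image linear_orth_proj U subspace_orthogonal_comp)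
  have sub: "?W \<subseteq> U" using orth_proj(1)[OF U] by auto
  have "{y\<in>U. \<forall>x\<in>?W. orthogonal x y} = U \<inter> K"
  proof -
    have "(\<forall>x\<in>?W. orthogonal x y) \<longleftrightarrow> y \<in> K" if y: "y \<in> U" for y
    proof -
      have "(\<forall>x\<in>?W. orthogonal x y) \<longleftrightarrow> y \<in> K\<^sup>\<bottom>\<^sup>\<bottom>"
        by (auto simp: orthogonal_comp_def[of "K\<^sup>\<bottom>"] orthogonal_def inner_orth_proj[OF U y])
      then show ?thesis by (simp add: orthogonal_comp_self[OF K])
    qed
    then show ?thesis by blast
  qed
  then show ?thesis using dim_subspace_orthogonal_to_vectors[OF W U sub] by simp
qed

text \<open>Sorting the points of a cube of side of order \<open>R\<close> by their rounded projection to \<open>K\<close> covers the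
  cube by \<open>O(R ^ dim K)\<close> translates of \<open>E\<close>. So the volume of \<open>E\<close> is at least of
  order \<open>R ^ (n - dim K)\<close>.\<close>

lemma slab_volume_ge:
  fixes K :: "(real ^ 'n) set"
  assumes K: "subspace K" and R: "1 \<le> R"
  defines "E \<equiv> {x. norm x \<le> R \<and> norm (orth_proj K x) \<le> real CARD('n)}"
  shows "compact E"
    "(R / real CARD('n)) ^ CARD('n)
       \<le> (6 * R) ^ dim K * (2 * real CARD('n) + 2) ^ CARD('n) * measure lebesgue E"
proof -
  let ?n = "real CARD('n)"
  have n1: "1 \<le> ?n" by (simp add: Suc_leI)
  have "closed E"
    unfolding E_def
    by (intro closed_Collect_conj closed_Collect_le continuous_intros
        linear_continuous_on[OF linear_conv_bounded_linear[THEN iffD1, OF linear_orth_proj[OF K]]])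
  moreover have "bounded E" unfolding E_def bounded_iff by auto
  ultimately show E: "compact E" by (simp add: compact_eq_bounded_closed)
  define b :: "real ^ 'n" where "b = (\<chi> i. R / (2 * ?n))"
  define S where "S = cbox (- b) b"
  have Sball: "norm x \<le> R / 2" if "x \<in> S" for x
  proof -
    have "\<bar>x $ i\<bar> \<le> R / (2 * ?n)" for i using that by (auto simp: S_def b_def mem_box_cart abs_le_iff minus_le_iff)
    from norm_le_card[OF this] show ?thesis using n1 by simp
  qed
  have S: "measure lebesgue S = (R / ?n) ^ CARD('n)"
  proof -
    have "S \<noteq> {}" unfolding S_def using R n1 by (auto simp: b_def interval_ne_empty_cart)
    then have "measure lborel S = (\<Prod>i\<in>UNIV. b $ i - (- b) $ i)"
      unfolding S_def by (rule content_cbox_cart)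
    moreover have "measure lebesgue S = measure lborel S" by (simp add: S_def measure_completion)
    ultimately have "measure lebesgue S = (\<Prod>i\<in>UNIV. b $ i - (- b) $ i)" by simp
    also have "\<dots> = (R / ?n) ^ CARD('n)" by (simp add: b_def)
    finally show ?thesis .
  qed
  let ?Q = "rproj K ` S"
  have Ssub: "S \<subseteq> {x. norm x \<le> R}" using Sball R by fastforce
  have finQ: "finite ?Q" by (rule card_rproj_ball_le(1)[OF K R Ssub])
  define c where "c q = (SOME x. x \<in> S \<and> rproj K x = q)" for q
  have c: "c q \<in> S \<and> rproj K (c q) = q" if "q \<in> ?Q" for q
    unfolding c_def using that by (intro someI_ex[of "\<lambda>x. x \<in> S \<and> rproj K x = q"]) auto
  have cover: "S \<subseteq> (\<Union>q\<in>?Q. (+) (c q) ` E)"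
  proof
    fix x assume x: "x \<in> S"
    let ?q = "rproj K x"
    have q: "?q \<in> ?Q" using x by blast
    have "norm (x - c ?q) \<le> R" using Sball[OF x] Sball c[OF q] norm_triangle_ineq4[of x "c ?q"] by fastforce
    moreover have "norm (orth_proj K (x - c ?q)) \<le> ?n"
      using c[OF q] by (intro norm_orth_proj_diff_if_rproj_eq K) simp
    ultimately have "x - c ?q \<in> E" by (simp add: E_def)
    then have "x \<in> (+) (c ?q) ` E" by (intro image_eqI[of _ _ "x - c ?q"]) auto
    with q show "x \<in> (\<Union>q\<in>?Q. (+) (c q) ` E)" by blast
  qed
  have meas: "(+) a ` E \<in> lmeasurable" for a
    by (intro lmeasurable_compact compact_translation E)
  have "measure lebesgue S \<le> measure lebesgue (\<Union>q\<in>?Q. (+) (c q) ` E)"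
  proof (rule measure_mono_fmeasurable[OF cover])
    show "(\<Union>q\<in>?Q. (+) (c q) ` E) \<in> lmeasurable"
      using finQ by (rule fmeasurable.finite_UN) (rule meas)
  qed (simp add: S_def)
  also have "\<dots> \<le> (\<Sum>q\<in>?Q. measure lebesgue ((+) (c q) ` E))"
    by (rule measure_UNION_le[OF finQ]) (use meas in auto)
  also have "\<dots> = real (card ?Q) * measure lebesgue E"
    by (simp add: measure_translation)
  also have "\<dots> \<le> ((6 * R) ^ dim K * (2 * ?n + 2) ^ CARD('n)) * measure lebesgue E"
    by (intro mult_right_mono card_rproj_ball_le(2)[OF K R Ssub]) simp
  finally show "(R / ?n) ^ CARD('n) \<le> (6 * R) ^ dim K * (2 * ?n + 2) ^ CARD('n) * measure lebesgue E"
    by (simp add: S)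
qed

lemma measure_unit_cells_le:
  assumes Q: "finite Q" "Q \<subseteq> floors {1..k} ` UNIV"
  defines "G \<equiv> {y\<in>space (Rdim k). floors {1..k} y \<in> Q}"
  shows "G \<in> sets (Rdim k)" "emeasure (Rdim k) G \<le> ennreal (real (card Q))"
proof -
  define box where "box q = PiE {1..k} (\<lambda>i. {real_of_int (q i)..<real_of_int (q i) + 1})" for q :: "nat \<Rightarrow> int"
  interpret product_sigma_finite "\<lambda>_ :: nat. lborel :: real measure" by standard
  have box: "box q \<in> sets (Rdim k)" for q
    unfolding box_def Rdim_def by (intro sets_PiM_I_finite) auto
  have ebox: "emeasure (Rdim k) (box q) = 1" for q
    unfolding box_def Rdim_def by (subst emeasure_PiM) auto
  have G: "G = (\<Union>q\<in>Q. box q)"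
  proof -
    have "floors {1..k} y = q \<longleftrightarrow> y \<in> box q"
      if "q \<in> Q" "y \<in> space (Rdim k)" for q y
    proof -
      have ext: "q i = undefined" if "i \<notin> {1..k}" for i
        using \<open>q \<in> Q\<close> that Q(2) by (auto simp: floors_def)
      have "floors {1..k} y = q \<longleftrightarrow> (\<forall>i\<in>{1..k}. \<lfloor>y i\<rfloor> = q i)"
        using ext by (auto simp: floors_def fun_eq_iff restrict_def)
      also have "\<dots> \<longleftrightarrow> y \<in> box q"
        using \<open>y \<in> space (Rdim k)\<close> by (auto simp: box_def space_Rdim PiE_iff floor_eq_iff)
      finally show ?thesis .
    qed
    moreover have "box q \<subseteq> space (Rdim k)" for q by (auto simp: box_def space_Rdim PiE_iff)
    ultimately show ?thesis by (auto simp: G_def)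
  qed
  show "G \<in> sets (Rdim k)" unfolding G using Q(1) box by auto
  have "emeasure (Rdim k) G \<le> (\<Sum>q\<in>Q. emeasure (Rdim k) (box q))"
    unfolding G by (rule emeasure_subadditive_finite) (use Q box in auto)
  also have "\<dots> = ennreal (real (card Q))" by (simp add: ebox ennreal_of_nat_eq_real_of_nat)
  finally show "emeasure (Rdim k) G \<le> ennreal (real (card Q))" .
qed

text \<open>The counterpart for the images: on the slab, \<open>L x\<close> is determined by the projection of \<open>x\<close> to \<open>U\<close>,
  and this by the projection to the image \<open>W\<close> of \<open>K\<^sup>\<bottom>\<close> up to a bounded error, because the component
  of \<open>x\<close> in \<open>K\<close> is bounded. So \<open>L\<close> maps the slab into \<open>O(R ^ dim W)\<close> unit cells.\<close>

lemma card_slab_cells_le: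
  fixes K :: "(real ^ 'n) set" and L :: "real ^ 'n \<Rightarrow> nat \<Rightarrow> real"
  assumes K: "subspace K" and L: "surj_linear_map k L"
  defines "U \<equiv> (ker k L)\<^sup>\<bottom>"
  defines "r \<equiv> dim (orth_proj U ` (K\<^sup>\<bottom>))"
  shows "\<exists>C>0. \<forall>R\<ge>1. finite ((\<lambda>x. floors {1..k} (L x)) ` {x. norm x \<le> R \<and> norm (orth_proj K x) \<le> real CARD('n)}) \<and>
    real (card ((\<lambda>x. floors {1..k} (L x)) ` {x. norm x \<le> R \<and> norm (orth_proj K x) \<le> real CARD('n)})) \<le> C * R ^ r"
proof -
  let ?n = "real CARD('n)"
  have kerS: "subspace (ker k L)" by (rule subspace_ker[OF L])
  have U: "subspace U" unfolding U_def by (rule subspace_orthogonal_comp)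
  define W where "W = orth_proj U ` (K\<^sup>\<bottom>)"
  have W: "subspace W" unfolding W_def
    by (intro linear_subspace_image linear_orth_proj U subspace_orthogonal_comp)
  have WU: "W \<subseteq> U" unfolding W_def using orth_proj(1)[OF U] by auto
  have lin: "linear (\<lambda>x. L x i)" if "i \<in> {1..k}" for i using L that by (auto simp: surj_linear_map_def)
  have LU: "L (orth_proj U x) i = L x i" if "i \<in> {1..k}" for x i
  proof -
    have "x - orth_proj U x \<in> ker k L"
      using orth_proj(1)[OF kerS, of x] by (simp add: U_def orth_proj_comp[OF kerS])
    then have "L (x - orth_proj U x) i = 0" using that by (auto simp: ker_def)
    then show ?thesis using linear_diff[OF lin[OF that], of x "orth_proj U x"] by simp
  qed
  have "\<exists>b. \<forall>x. \<bar>L x i\<bar> \<le> b * norm x" if "i \<in> {1..k}" for i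
    using bounded_linear.bounded[OF linear_conv_bounded_linear[THEN iffD1, OF lin[OF that]]]
    by (auto simp: mult.commute)
  then obtain b where b: "\<And>i x. i \<in> {1..k} \<Longrightarrow> \<bar>L x i\<bar> \<le> b i * norm x" by metis
  define B where "B = (\<Sum>i\<in>{1..k}. \<bar>b i\<bar>)"
  have B: "0 \<le> B" "\<bar>L x i\<bar> \<le> B * norm x" if "i \<in> {1..k}" for i x
  proof -
    show "0 \<le> B" unfolding B_def by (intro sum_nonneg) auto
    have "b i \<le> B" unfolding B_def using that member_le_sum[of i "{1..k}" "\<lambda>i. \<bar>b i\<bar>"] by auto
    then have "b i * norm x \<le> B * norm x" by (intro mult_right_mono) auto
    with b[OF that, of x] show "\<bar>L x i\<bar> \<le> B * norm x" by linarith
  qed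
  have B0: "0 \<le> B" unfolding B_def by (intro sum_nonneg) auto
  define C where "C = 6 ^ r * (2 * ?n + 2) ^ CARD('n) * (2 * (B * (5 * ?n)) + 2) ^ k"
  show ?thesis
  proof (intro exI[of _ C] conjI allI impI)
    have "0 < 2 * ?n + 2" "0 < 2 * (B * (5 * ?n)) + 2" using B0 by (simp_all add: add_nonneg_pos)
    then show "0 < C" by (simp add: C_def)
    fix R :: real assume R: "1 \<le> R"
    let ?E = "{x. norm x \<le> R \<and> norm (orth_proj K x) \<le> ?n}"
    have fin: "finite (rproj W ` ?E)" and card: "real (card (rproj W ` ?E)) \<le> (6 * R) ^ dim W * (2 * ?n + 2) ^ CARD('n)"
      by (rule card_rproj_ball_le[OF W R]; blast)+
    have close: "\<bar>L x i - L x' i\<bar> \<le> B * (5 * ?n)"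
      if x: "x \<in> ?E" "x' \<in> ?E" and i: "i \<in> {1..k}" and eq: "rproj W x = rproj W x'" for x x' i
    proof -
      define u where "u = x - x'"
      have Wu: "norm (orth_proj W u) \<le> ?n"
        unfolding u_def by (rule norm_orth_proj_diff_if_rproj_eq[OF W eq])
      have Ku: "norm (orth_proj K u) \<le> 2 * ?n"
        using x norm_triangle_ineq4[of "orth_proj K x" "orth_proj K x'"] by (simp add: u_def orth_proj_diff[OF K])
      define v where "v = u - orth_proj K u"
      have "v \<in> K\<^sup>\<bottom>" unfolding v_def orth_proj_comp[OF K, symmetric] by (rule orth_proj(1)[OF subspace_orthogonal_comp])
      then have "orth_proj U v \<in> W" by (simp add: W_def)
      then have "orth_proj U v = orth_proj W v"
        using orth_proj_mem_eq[OF W, of "orth_proj U v"] orth_proj_orth_proj[OF W U WU, of v] by simp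
      also have "\<dots> = orth_proj W u - orth_proj W (orth_proj K u)" by (simp add: v_def orth_proj_diff[OF W])
      finally have "norm (orth_proj U v) \<le> norm (orth_proj W u) + norm (orth_proj W (orth_proj K u))"
        by (metis norm_triangle_ineq4)
      then have 1: "norm (orth_proj U v) \<le> 3 * ?n"
        using Wu Ku norm_orth_proj_le[OF W, of "orth_proj K u"] by linarith
      have "orth_proj U u = orth_proj U v + orth_proj U (orth_proj K u)"
        by (simp add: v_def orth_proj_diff[OF U])
      then have "norm (orth_proj U u) \<le> norm (orth_proj U v) + norm (orth_proj U (orth_proj K u))"
        by (metis norm_triangle_ineq)
      then have 2: "norm (orth_proj U u) \<le> 5 * ?n"
        using 1 Ku norm_orth_proj_le[OF U, of "orth_proj K u"] by linarith
      have "L x i - L x' i = L (orth_proj U u) i"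
        using linear_diff[OF lin[OF i], of x x'] LU[OF i, of u] by (simp add: u_def)
      then have "\<bar>L x i - L x' i\<bar> \<le> B * norm (orth_proj U u)" using B(2)[OF i] by simp
      also have "\<dots> \<le> B * (5 * ?n)" using 2 B0 by (intro mult_left_mono) auto
      finally show ?thesis .
    qed
    have main: "finite ((\<lambda>x. floors {1..k} (L x)) ` ?E) \<and> real (card ((\<lambda>x. floors {1..k} (L x)) ` ?E))
        \<le> real (card (rproj W ` ?E)) * (2 * (B * (5 * ?n)) + 2) ^ card {1..k}"
      by (rule card_floors_fibres_le[OF _ _ fin]) (use B0 close in auto)
    then show "finite ((\<lambda>x. floors {1..k} (L x)) ` ?E)" by blast
    have "real (card (rproj W ` ?E)) * (2 * (B * (5 * ?n)) + 2) ^ k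
        \<le> ((6 * R) ^ dim W * (2 * ?n + 2) ^ CARD('n)) * (2 * (B * (5 * ?n)) + 2) ^ k"
      using card B0 by (intro mult_right_mono) auto
    also have "\<dots> = C * R ^ r" by (simp add: C_def r_def W_def power_mult_distrib)
    finally show "real (card ((\<lambda>x. floors {1..k} (L x)) ` ?E)) \<le> C * R ^ r" using main by simp
  qed
qed

lemma powr_bounded_imp_nonpos:
  fixes e M :: real
  assumes "\<And>R. 1 \<le> R \<Longrightarrow> R powr e \<le> M"
  shows "e \<le> 0"
proof (rule ccontr)
  assume "\<not> ?thesis"
  then have e: "0 < e" by simp
  have M: "1 \<le> M" using assms[of 1] by simp
  have "((M + 1) powr (1 / e)) powr e \<le> M"
    using M e by (intro assms ge_one_powr_ge_zero) auto
  then show False using e M by (simp add: powr_powr)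
qed

text \<open>The inequality is tested on the indicator functions of the unions of the unit cells that meet the
  images of the slab around \<open>K\<^sup>\<bottom>\<close> of radius \<open>R\<close>. Volume and number of cells being powers of \<open>R\<close> up
  to constants, \<open>R \<rightarrow> \<infinity>\<close> compares the exponents.\<close>

theorem BL_condition_necessary:
  fixes L :: "nat \<Rightarrow> real ^ 'n \<Rightarrow> nat \<Rightarrow> real"
  assumes datum: "BL_datum m d L p" and finite_const: "BL_const m d L p < \<infinity>"
  shows "BL_condition m (\<lambda>j. (ker (d j) (L j))\<^sup>\<bottom>) p"
  unfolding BL_condition_def
proof (intro allI impI)
  let ?n = "real CARD('n)"
  fix K :: "(real ^ 'n) set" assume K: "subspace K"
  define U where "U j = (ker (d j) (L j))\<^sup>\<bottom>" for j
  define r where "r j = dim (orth_proj (U j) ` (K\<^sup>\<bottom>))" for j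
  have L: "surj_linear_map (d j) (L j)" and p: "0 \<le> p j" if "j \<in> {1..m}" for j
    using datum that by (auto simp: BL_datum_def)
  obtain C0 :: ennreal where "C0 < \<infinity>" and C0: "\<And>f :: nat \<Rightarrow> (nat \<Rightarrow> real) \<Rightarrow> real.
       (\<And>j. j \<in> {1..m} \<Longrightarrow> integrable (Rdim (d j)) (f j) \<and> (\<forall>y\<in>space (Rdim (d j)). 0 \<le> f j y)) \<Longrightarrow>
       (\<integral>\<^sup>+ x. ennreal (\<Prod>j\<in>{1..m}. nnpow (f j (L j x)) (p j)) \<partial>lborel)
         \<le> C0 * ennreal (\<Prod>j\<in>{1..m}. nnpow (\<integral>y. f j y \<partial>Rdim (d j)) (p j))"
    using finite_const unfolding BL_const_def Inf_less_iff by blast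
  then obtain c0 where c0: "0 \<le> c0" "C0 = ennreal c0" by (cases C0) auto
  define E where "E R = {x. norm x \<le> R \<and> norm (orth_proj K x) \<le> ?n}" for R
  define Q where "Q R j = (\<lambda>x. floors {1..d j} (L j x)) ` E R" for R j
  have "\<exists>C>0. \<forall>R\<ge>1. finite (Q R j) \<and> real (card (Q R j)) \<le> C * R ^ r j" if "j \<in> {1..m}" for j
    using card_slab_cells_le[OF K L[OF that]] unfolding Q_def E_def r_def U_def .
  then obtain c where c: "\<And>j. j \<in> {1..m} \<Longrightarrow> 0 < c j"
      "\<And>j R. j \<in> {1..m} \<Longrightarrow> 1 \<le> R \<Longrightarrow> finite (Q R j) \<and> real (card (Q R j)) \<le> c j * R ^ r j"
    by metis
  define s where "s = (\<Sum>j\<in>{1..m}. p j * real (r j))"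
  define M1 where "M1 = c0 * (\<Prod>j\<in>{1..m}. nnpow (c j) (p j))"
  have volume: "measure lebesgue (E R) \<le> M1 * R powr s" if R: "1 \<le> R" for R
  proof -
    define G where "G j = {y\<in>space (Rdim (d j)). floors {1..d j} y \<in> Q R j}" for j
    have G: "G j \<in> sets (Rdim (d j))" "emeasure (Rdim (d j)) (G j) \<le> ennreal (real (card (Q R j)))"
      if "j \<in> {1..m}" for j
      using measure_unit_cells_le[of "Q R j" "d j"] c(2)[OF that R] unfolding G_def by (auto simp: Q_def)
    define f where "f j = (indicator (G j) :: (nat \<Rightarrow> real) \<Rightarrow> real)" for j
    have Ecomp: "compact (E R)" unfolding E_def by (rule slab_volume_ge(1)[OF K R])
    have EL: "E R \<in> sets lborel" using Ecomp by (simp add: borel_compact)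
    have "emeasure lborel (E R) = (\<integral>\<^sup>+ x. indicator (E R) x \<partial>lborel)"
      using EL by simp
    also have "\<dots> \<le> (\<integral>\<^sup>+ x. ennreal (\<Prod>j\<in>{1..m}. nnpow (f j (L j x)) (p j)) \<partial>lborel)"
    proof (rule nn_integral_mono)
      fix x
      show "indicator (E R) x \<le> ennreal (\<Prod>j\<in>{1..m}. nnpow (f j (L j x)) (p j))"
      proof (cases "x \<in> E R")
        case True
        have "f j (L j x) = 1" if "j \<in> {1..m}" for j
        proof -
          have "L j x \<in> space (Rdim (d j))" using L[OF that] unfolding surj_linear_map_def by blast
          with True have "L j x \<in> G j" unfolding G_def Q_def by blast
          then show ?thesis by (simp add: f_def)
        qed
        moreover have "nnpow 1 q = 1" for q by (simp add: nnpow_def)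
        ultimately show ?thesis using True by simp
      qed simp
    qed
    also have "\<dots> \<le> C0 * ennreal (\<Prod>j\<in>{1..m}. nnpow (\<integral>y. f j y \<partial>Rdim (d j)) (p j))"
    proof (rule C0, intro conjI ballI)
      fix j assume j: "j \<in> {1..m}"
      show "integrable (Rdim (d j)) (f j)"
        unfolding f_def using G[OF j] by (intro integrable_real_indicator) (auto intro: le_less_trans)
      show "0 \<le> f j y" for y by (simp add: f_def)
    qed
    also have "\<dots> \<le> ennreal (M1 * R powr s)"
    proof -
      have "(\<Prod>j\<in>{1..m}. nnpow (\<integral>y. f j y \<partial>Rdim (d j)) (p j)) \<le> (\<Prod>j\<in>{1..m}. nnpow (c j * R ^ r j) (p j))"
      proof (intro prod_mono conjI nnpow_nonneg nnpow_mono p)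
        fix j assume j: "j \<in> {1..m}"
        have "(\<integral>y. f j y \<partial>Rdim (d j)) = measure (Rdim (d j)) (G j)"
          using G[OF j] by (simp add: f_def Int_absorb1 sets.sets_into_space)
        also have "\<dots> \<le> real (card (Q R j))"
          using G(2)[OF j] by (simp add: measure_def enn2real_leI)
        also have "\<dots> \<le> c j * R ^ r j" using c(2)[OF j R] by blast
        finally show "(\<integral>y. f j y \<partial>Rdim (d j)) \<le> c j * R ^ r j" .
        show "0 \<le> (\<integral>y. f j y \<partial>Rdim (d j))" by (intro integral_nonneg_AE) (simp add: f_def)
      qed auto
      also have "\<dots> = (\<Prod>j\<in>{1..m}. nnpow (c j) (p j) * R powr (p j * real (r j)))"
      proof (intro prod.cong refl)
        fix j assume j: "j \<in> {1..m}"
        have "nnpow (R ^ r j) (p j) = R powr (p j * real (r j))"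
          using R by (simp add: nnpow_def powr_realpow[symmetric] powr_powr mult.commute)
        then show "nnpow (c j * R ^ r j) (p j) = nnpow (c j) (p j) * R powr (p j * real (r j))"
          using R c(1)[OF j] by (simp add: nnpow_mult)
      qed
      also have "\<dots> = (\<Prod>j\<in>{1..m}. nnpow (c j) (p j)) * R powr s"
        using R by (simp add: prod.distrib s_def powr_sum)
      finally have "c0 * (\<Prod>j\<in>{1..m}. nnpow (\<integral>y. f j y \<partial>Rdim (d j)) (p j)) \<le> M1 * R powr s"
        using c0(1) by (simp add: M1_def mult_left_mono mult.assoc)
      then show ?thesis using c0 by (simp add: ennreal_mult'[symmetric] ennreal_leI)
    qed
    finally have "emeasure lborel (E R) \<le> ennreal (M1 * R powr s)" .
    moreover have "0 \<le> M1 * R powr s"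
      unfolding M1_def using c0 by (intro mult_nonneg_nonneg prod_nonneg) (auto simp: nnpow_nonneg)
    moreover have "measure lebesgue (E R) = measure lborel (E R)" using EL by (simp add: measure_completion)
    ultimately show ?thesis by (simp add: measure_def enn2real_leI)
  qed
  define M2 where "M2 = ?n ^ CARD('n) * (6 ^ dim K * (2 * ?n + 2) ^ CARD('n) * M1)"
  have "R powr (?n - real (dim K) - s) \<le> M2" if R: "1 \<le> R" for R
  proof -
    have "(R / ?n) ^ CARD('n) \<le> (6 * R) ^ dim K * (2 * ?n + 2) ^ CARD('n) * measure lebesgue (E R)"
      unfolding E_def by (rule slab_volume_ge(2)[OF K R])
    also have "\<dots> \<le> (6 * R) ^ dim K * (2 * ?n + 2) ^ CARD('n) * (M1 * R powr s)"
      using R volume[OF R] by (intro mult_left_mono) auto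
    also have "\<dots> = (R ^ dim K * R powr s) * (6 ^ dim K * (2 * ?n + 2) ^ CARD('n) * M1)"
      by (simp add: power_mult_distrib)
    finally have "R ^ CARD('n) \<le> (R ^ dim K * R powr s) * M2"
      by (simp add: M2_def power_divide field_simps)
    moreover have "R ^ CARD('n) = R powr (?n - real (dim K) - s) * (R ^ dim K * R powr s)"
      using R by (simp add: powr_realpow[symmetric] powr_add[symmetric])
    ultimately have "R powr (?n - real (dim K) - s) * (R ^ dim K * R powr s) \<le> M2 * (R ^ dim K * R powr s)"
      by (simp add: mult.commute)
    moreover have "0 < R ^ dim K * R powr s" using R by simp
    ultimately show ?thesis by (rule mult_right_le_imp_le)
  qed
  then have "?n - real (dim K) - s \<le> 0" by (rule powr_bounded_imp_nonpos)
  moreover have "s = (\<Sum>j\<in>{1..m}. p j * (real (dim (U j)) - real (dim (U j \<inter> K))))"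
    unfolding s_def r_def
    by (intro sum.cong refl) (simp add: dim_orth_proj_image K U_def subspace_orthogonal_comp)
  ultimately show "?n - real (dim K) \<le> (\<Sum>j\<in>{1..m}. p j *
      (real (dim ((ker (d j) (L j))\<^sup>\<bottom>)) - real (dim ((ker (d j) (L j))\<^sup>\<bottom> \<inter> K))))"
    by (simp add: U_def)
qed

section \<open>The Grassmannian\<close>

text \<open>As elements of the normed space of bounded operators, projections carry the metric of the
  Grassmannian, and compactness becomes closedness and boundedness.\<close>

definition proj :: "(real ^ 'n) set \<Rightarrow> (real ^ 'n) \<Rightarrow>\<^sub>L (real ^ 'n)" where
  "proj V = Blinfun (orth_proj V)"

definition Grassmannian :: "((real ^ 'n) \<Rightarrow>\<^sub>L (real ^ 'n)) set" where
  "Grassmannian = proj ` {V. subspace V}"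

lemma proj_apply: "subspace V \<Longrightarrow> blinfun_apply (proj V) x = orth_proj V x"
  unfolding proj_def
  by (subst bounded_linear_Blinfun_apply) (auto simp: linear_conv_bounded_linear[symmetric] linear_orth_proj)

lemma dist_proj:
  assumes "subspace V" "subspace W"
  shows "dist (proj V) (proj W) = grassmann_dist V W"
proof -
  have "blinfun_apply (proj V - proj W) = (\<lambda>x. orth_proj V x - orth_proj W x)"
    using assms by (auto simp: blinfun.diff_left proj_apply)
  then show ?thesis by (simp add: dist_norm norm_blinfun.rep_eq grassmann_dist_def)
qed

lemma norm_orth_proj_diff_le:
  assumes "subspace V" "subspace W"
  shows "norm (orth_proj V x - orth_proj W x) \<le> dist (proj V) (proj W) * norm x"
  using norm_blinfun[of "proj V - proj W" x] assms by (simp add: dist_norm blinfun.diff_left proj_apply)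

lemma dist_proj_comp:
  assumes "subspace V" "subspace W"
  shows "dist (proj (V\<^sup>\<bottom>)) (proj (W\<^sup>\<bottom>)) = dist (proj V) (proj W)"
proof -
  have "proj (V\<^sup>\<bottom>) - proj (W\<^sup>\<bottom>) = proj W - proj V"
    by (rule blinfun_eqI)
      (simp add: blinfun.diff_left proj_apply assms subspace_orthogonal_comp orth_proj_comp)
  then show ?thesis by (simp add: dist_norm norm_minus_commute)
qed

text \<open>Symmetric idempotents are exactly the orthogonal projections; in this form the set is visibly closed.\<close>

lemma Grassmannian_eq:
  "Grassmannian = {P :: (real ^ 'n) \<Rightarrow>\<^sub>L (real ^ 'n).
     (\<forall>x. blinfun_apply P (blinfun_apply P x) = blinfun_apply P x)
     \<and> (\<forall>x y. blinfun_apply P x \<bullet> y = x \<bullet> blinfun_apply P y)}"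
proof (intro equalityI subsetI)
  fix P :: "(real ^ 'n) \<Rightarrow>\<^sub>L (real ^ 'n)" assume "P \<in> Grassmannian"
  then obtain V where "subspace V" "P = proj V" by (auto simp: Grassmannian_def)
  then show "P \<in> {P. (\<forall>x. blinfun_apply P (blinfun_apply P x) = blinfun_apply P x)
     \<and> (\<forall>x y. blinfun_apply P x \<bullet> y = x \<bullet> blinfun_apply P y)}"
    by (simp add: proj_apply orth_proj_mem_eq orth_proj(1) orth_proj_symmetric)
next
  fix P :: "(real ^ 'n) \<Rightarrow>\<^sub>L (real ^ 'n)"
  assume "P \<in> {P. (\<forall>x. blinfun_apply P (blinfun_apply P x) = blinfun_apply P x)
     \<and> (\<forall>x y. blinfun_apply P x \<bullet> y = x \<bullet> blinfun_apply P y)}"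
  then have P: "\<And>x. blinfun_apply P (blinfun_apply P x) = blinfun_apply P x"
     "\<And>x y. blinfun_apply P x \<bullet> y = x \<bullet> blinfun_apply P y" by auto
  define V where "V = {x. blinfun_apply P x = x}"
  have V: "subspace V"
    by (auto simp: V_def subspace_def blinfun.add_right blinfun.scaleR_right blinfun.zero_right)
  have "orth_proj V x = blinfun_apply P x" for x
    by (rule orth_proj_eqI[OF V])
      (auto simp: V_def P(1) orthogonal_def inner_diff_left P(2))
  then have "P = proj V" by (intro blinfun_eqI) (simp add: proj_apply V)
  then show "P \<in> Grassmannian" using V by (auto simp: Grassmannian_def)
qed

lemma compact_Grassmannian: "compact (Grassmannian :: ((real ^ 'n) \<Rightarrow>\<^sub>L (real ^ 'n)) set)"
proof -
  have "norm P \<le> 1" if "P \<in> Grassmannian" for P :: "(real ^ 'n) \<Rightarrow>\<^sub>L (real ^ 'n)"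
    using that by (auto simp: Grassmannian_def proj_apply norm_orth_proj_le intro!: norm_blinfun_bound)
  then have "bounded (Grassmannian :: ((real ^ 'n) \<Rightarrow>\<^sub>L (real ^ 'n)) set)" by (auto simp: bounded_iff)
  moreover have "closed (Grassmannian :: ((real ^ 'n) \<Rightarrow>\<^sub>L (real ^ 'n)) set)"
    unfolding Grassmannian_eq
    by (intro closed_Collect_conj closed_Collect_all closed_Collect_eq continuous_intros)
  ultimately show ?thesis by (simp add: compact_eq_bounded_closed)
qed

section \<open>Stability of the dimension condition\<close>

lemma dim_le_if_orth_proj_inj:
  fixes A D :: "(real ^ 'n) set"
  assumes A: "subspace A" and D: "subspace D"
    and inj: "\<And>x. x \<in> A \<Longrightarrow> orth_proj D x = 0 \<Longrightarrow> x = 0"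
  shows "dim A \<le> dim D"
proof -
  have "span A = A" using A by (simp add: span_eq_iff)
  moreover have "inj_on (orth_proj D) A"
  proof (rule inj_onI)
    fix x y assume "x \<in> A" "y \<in> A" "orth_proj D x = orth_proj D y"
    then have "x - y \<in> A" "orth_proj D (x - y) = 0" using A by (auto simp: subspace_diff orth_proj_diff[OF D])
    then have "x - y = 0" by (rule inj)
    then show "x = y" by simp
  qed
  ultimately have "inj_on (orth_proj D) (span A)" by (simp only:)
  then have "dim A = dim (orth_proj D ` A)"
    using dim_image_eq[OF linear_orth_proj[OF D], of A] by simp
  also have "\<dots> \<le> dim D" using orth_proj(1)[OF D] by (intro dim_subset) auto
  finally show ?thesis .
qed

lemma dim_le_if_proj_close:
  fixes A B :: "(real ^ 'n) set"
  assumes A: "subspace A" and B: "subspace B" and close: "dist (proj A) (proj B) < 1"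
  shows "dim A \<le> dim B"
proof (rule dim_le_if_orth_proj_inj[OF A B])
  fix x assume "x \<in> A" "orth_proj B x = 0"
  then have "norm x \<le> dist (proj A) (proj B) * norm x"
    using norm_orth_proj_diff_le[OF A B, of x] by (simp add: orth_proj_mem_eq A)
  then show "x = 0" using close by (cases "x = 0") auto
qed

text \<open>On the orthogonal complement of \<open>U \<inter> K\<close> the distances to \<open>U\<close> and \<open>K\<close> together are bounded below
  by a multiple \<open>e\<close> of the norm. A vector of \<open>U' \<inter> K'\<close> violates this bound unless it is \<open>0\<close>, so the
  projection to \<open>U \<inter> K\<close> is injective on \<open>U' \<inter> K'\<close>.\<close>

lemma dim_Int_upper_semicontinuous:
  fixes U K :: "(real ^ 'n) set"
  assumes U: "subspace U" and K: "subspace K"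
  shows "\<exists>\<nu>>0. \<forall>U' K'. subspace U' \<and> subspace K' \<and> dist (proj U') (proj U) < \<nu> \<and> dist (proj K') (proj K) < \<nu>
    \<longrightarrow> dim (U' \<inter> K') \<le> dim (U \<inter> K)"
proof -
  define D where "D = U \<inter> K"
  have D: "subspace D" unfolding D_def using U K by (rule subspace_inter)
  define f where "f x = (x - orth_proj U x, x - orth_proj K x)" for x
  have "linear f"
    using linear_orth_proj[OF U] linear_orth_proj[OF K]
    by (auto simp: f_def linear_iff scaleR_diff_right)
  then have f: "bounded_linear f" by (rule linear_conv_bounded_linear[THEN iffD1])
  have "x = 0" if x: "x \<in> D\<^sup>\<bottom>" "f x = 0" for x
  proof -
    have "orth_proj U x = x" "orth_proj K x = x" using x by (auto simp: f_def zero_prod_def)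
    then have "x \<in> D" using orth_proj(1)[OF U, of x] orth_proj(1)[OF K, of x] by (simp add: D_def)
    with x show "x = 0" by (auto simp: orthogonal_comp_def orthogonal_self)
  qed
  then obtain e where e: "0 < e" "\<And>x. x \<in> D\<^sup>\<bottom> \<Longrightarrow> e * norm x \<le> norm (f x)"
    using injective_imp_isometric[OF closed_subspace[OF subspace_orthogonal_comp] subspace_orthogonal_comp f, of D]
    by (auto simp: mult.commute)
  show ?thesis
    unfolding D_def[symmetric]
  proof (intro exI[of _ "e / 2"] conjI allI impI, goal_cases)
    case 1
    show ?case using e by simp
  next
    case (2 U' K')
    then have U': "subspace U'" and K': "subspace K'"
      and close: "dist (proj U') (proj U) < e / 2" "dist (proj K') (proj K) < e / 2" by auto
    show "dim (U' \<inter> K') \<le> dim D"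
    proof (rule dim_le_if_orth_proj_inj[OF subspace_inter[OF U' K'] D])
      fix x assume x: "x \<in> U' \<inter> K'" "orth_proj D x = 0"
      show "x = 0"
      proof (rule ccontr)
        assume "x \<noteq> 0"
        have "norm (f x) \<le> norm (x - orth_proj U x) + norm (x - orth_proj K x)"
          unfolding f_def by (rule norm_Pair_le)
        also have "\<dots> \<le> dist (proj U') (proj U) * norm x + dist (proj K') (proj K) * norm x"
          using norm_orth_proj_diff_le[OF U' U, of x] norm_orth_proj_diff_le[OF K' K, of x] x
          by (simp add: orth_proj_mem_eq U' K')
        also have "\<dots> < e / 2 * norm x + e / 2 * norm x"
          using close \<open>x \<noteq> 0\<close> by (intro add_strict_mono mult_strict_right_mono) auto
        finally have "norm (f x) < e * norm x" by simp
        moreover have "x \<in> D\<^sup>\<bottom>" using x orth_proj_eq_0_iff[OF D] by blast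
        ultimately show False using e(2)[of x] by linarith
      qed
    qed
  qed
qed

text \<open>For a single \<open>K\<close> the condition survives a perturbation of the \<open>U j\<close>, even simultaneously with one of
  \<open>K\<close>, because the dimensions of the \<open>U j\<close> do not change and those of the \<open>U j \<inter> K\<close> do not
  increase. Compactness of the Grassmannian makes the size of the perturbation independent of \<open>K\<close>.\<close>

theorem BL_condition_stable:
  fixes U :: "nat \<Rightarrow> (real ^ 'n) set"
  assumes cond: "BL_condition m U p" and p: "\<forall>j\<in>{1..m}. 0 \<le> p j" and U: "\<forall>j\<in>{1..m}. subspace (U j)"
  shows "\<exists>\<nu>>0. \<forall>U'. (\<forall>j\<in>{1..m}. subspace (U' j) \<and> dist (proj (U' j)) (proj (U j)) < \<nu>)
    \<longrightarrow> BL_condition m U' p"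
proof -
  have "\<exists>\<nu>. 0 < \<nu> \<and> \<nu> \<le> 1 \<and> (\<forall>j\<in>{1..m}. \<forall>U' K'. subspace U' \<and> subspace K' \<and>
      dist (proj U') (proj (U j)) < \<nu> \<and> dist (proj K') (proj K) < \<nu> \<longrightarrow> dim (U' \<inter> K') \<le> dim (U j \<inter> K))"
    if K: "subspace K" for K
  proof -
    have "\<exists>\<nu>>0. \<forall>U' K'. subspace U' \<and> subspace K' \<and>
      dist (proj U') (proj (U j)) < \<nu> \<and> dist (proj K') (proj K) < \<nu> \<longrightarrow> dim (U' \<inter> K') \<le> dim (U j \<inter> K)"
      if "j \<in> {1..m}" for j
      using dim_Int_upper_semicontinuous[of "U j" K] U K that by blast
    then obtain \<nu> where \<nu>: "\<And>j. j \<in> {1..m} \<Longrightarrow> 0 < \<nu> j"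
      "\<And>j U' K'. j \<in> {1..m} \<Longrightarrow> subspace U' \<and> subspace K' \<and>
      dist (proj U') (proj (U j)) < \<nu> j \<and> dist (proj K') (proj K) < \<nu> j \<Longrightarrow> dim (U' \<inter> K') \<le> dim (U j \<inter> K)"
      by metis
    define \<mu> where "\<mu> = Min (insert 1 (\<nu> ` {1..m}))"
    have \<mu>: "0 < \<mu>" "\<mu> \<le> 1" using \<nu>(1) by (auto simp: \<mu>_def)
    have \<mu>\<nu>: "\<mu> \<le> \<nu> j" if "j \<in> {1..m}" for j unfolding \<mu>_def using that by (intro Min_le) auto
    show ?thesis
    proof (intro exI[of _ \<mu>] conjI ballI allI impI \<mu>)
      fix j U' K' assume j: "j \<in> {1..m}" and "subspace U' \<and> subspace K' \<and>
        dist (proj U') (proj (U j)) < \<mu> \<and> dist (proj K') (proj K) < \<mu>"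
      then show "dim (U' \<inter> K') \<le> dim (U j \<inter> K)"
        using \<mu>\<nu>[OF j] by (intro \<nu>(2)[OF j]) auto
    qed
  qed
  then obtain \<nu> where \<nu>: "\<And>K. subspace K \<Longrightarrow> 0 < \<nu> K" "\<And>K. subspace K \<Longrightarrow> \<nu> K \<le> 1"
    "\<And>K j U' K'. subspace K \<Longrightarrow> j \<in> {1..m} \<Longrightarrow> subspace U' \<and> subspace K' \<and>
      dist (proj U') (proj (U j)) < \<nu> K \<and> dist (proj K') (proj K) < \<nu> K \<Longrightarrow> dim (U' \<inter> K') \<le> dim (U j \<inter> K)"
    by metis
  obtain F where F: "F \<subseteq> {K. subspace K}" "finite F" "Grassmannian \<subseteq> (\<Union>K\<in>F. ball (proj K) (\<nu> K))"
  proof (rule compactE_image[OF compact_Grassmannian, of "{K. subspace K}" "\<lambda>K. ball (proj K) (\<nu> K)"])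
    show "Grassmannian \<subseteq> (\<Union>K\<in>{K. subspace K}. ball (proj K) (\<nu> K))"
      using \<nu>(1) by (auto simp: Grassmannian_def)
  qed auto
  define \<mu> where "\<mu> = Min (insert 1 (\<nu> ` F))"
  have \<mu>: "0 < \<mu>" "\<mu> \<le> 1" using \<nu>(1) F by (auto simp: \<mu>_def)
  have \<mu>\<nu>: "\<mu> \<le> \<nu> K" if "K \<in> F" for K unfolding \<mu>_def using that F(2) by (intro Min_le) auto
  show ?thesis
  proof (intro exI[of _ \<mu>] conjI allI impI)
    show "0 < \<mu>" by fact
    fix U' assume U': "\<forall>j\<in>{1..m}. subspace (U' j) \<and> dist (proj (U' j)) (proj (U j)) < \<mu>"
    show "BL_condition m U' p"
      unfolding BL_condition_def
    proof (intro allI impI)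
      fix K' :: "(real ^ 'n) set" assume K': "subspace K'"
      then have "proj K' \<in> Grassmannian" by (simp add: Grassmannian_def)
      then obtain K where "K \<in> F" and dK: "dist (proj K') (proj K) < \<nu> K"
        using F(3) by (auto simp: dist_commute)
      then have K: "subspace K" "\<mu> \<le> \<nu> K" using F \<mu>\<nu> by auto
      have "dim K \<le> dim K'"
        using dK \<nu>(2)[OF K(1)] by (intro dim_le_if_proj_close K K') (simp add: dist_commute)
      then have "real CARD('n) - real (dim K') \<le> real CARD('n) - real (dim K)" by simp
      also have "\<dots> \<le> (\<Sum>j\<in>{1..m}. p j * (real (dim (U j)) - real (dim (U j \<inter> K))))"
        using cond K by (auto simp: BL_condition_def)
      also have "\<dots> \<le> (\<Sum>j\<in>{1..m}. p j * (real (dim (U' j)) - real (dim (U' j \<inter> K'))))"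
      proof (intro sum_mono mult_left_mono)
        fix j assume j: "j \<in> {1..m}"
        then show "0 \<le> p j" using p by blast
        have Uj: "subspace (U j)" "subspace (U' j)" "dist (proj (U' j)) (proj (U j)) < \<mu>" using U U' j by auto
        have "dim (U j) \<le> dim (U' j)"
          using Uj \<mu>(2) by (intro dim_le_if_proj_close) (auto simp: dist_commute)
        moreover have "dim (U' j \<inter> K') \<le> dim (U j \<inter> K)"
          using Uj K dK K' j by (intro \<nu>(3)) auto
        ultimately show "real (dim (U j)) - real (dim (U j \<inter> K)) \<le> real (dim (U' j)) - real (dim (U' j \<inter> K'))"
          by linarith
      qed
      finally show "real CARD('n) - real (dim K') \<le> \<dots>" .
    qed
  qed
qed

section \<open>Uniformity in the directions\<close>

text \<open>The directions are given by a tuple of operators instead of subspaces, so that the possible tuples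
  form a compact subset of a product space. A set \<open>A\<close> enters only through its difference set, which
  lies in a subspace close to the prescribed one.\<close>

definition Kakeya_bound ::
    "nat \<Rightarrow> (nat \<Rightarrow> real) \<Rightarrow> real \<Rightarrow> (nat \<Rightarrow> (real ^ 'n) \<Rightarrow>\<^sub>L (real ^ 'n)) \<Rightarrow> real \<Rightarrow> real \<Rightarrow> bool" where
  "Kakeya_bound m p \<epsilon> P \<nu> C \<longleftrightarrow> (\<forall>\<delta> \<A>. 0 < \<delta> \<and> \<delta> \<le> 1 \<and>
     (\<forall>j\<in>{1..m}. finite (\<A> j) \<and> (\<forall>A\<in>\<A> j. \<exists>W. subspace W \<and> dist (proj W) (P j) \<le> \<nu> \<and>
        (\<forall>a\<in>A. \<forall>a'\<in>A. a - a' \<in> W))) \<longrightarrow>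
     (\<Sum>z\<in>cells \<delta>. mult_product m p \<A> \<delta> z)
       \<le> C * \<delta> powr - \<epsilon> * (\<Prod>j\<in>{1..m}. nnpow (real (card (\<A> j))) (p j)))"

lemma Kakeya_boundD:
  assumes "Kakeya_bound m p \<epsilon> P \<nu> C" "0 < \<delta>" "\<delta> \<le> 1" "\<And>j. j \<in> {1..m} \<Longrightarrow> finite (\<A> j)"
    "\<And>j A. j \<in> {1..m} \<Longrightarrow> A \<in> \<A> j \<Longrightarrow> \<exists>W. subspace W \<and> dist (proj W) (P j) \<le> \<nu> \<and>
        (\<forall>a\<in>A. \<forall>a'\<in>A. a - a' \<in> W)"
  shows "(\<Sum>z\<in>cells \<delta>. mult_product m p \<A> \<delta> z)
       \<le> C * \<delta> powr - \<epsilon> * (\<Prod>j\<in>{1..m}. nnpow (real (card (\<A> j))) (p j))"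
  using assms unfolding Kakeya_bound_def by blast

lemma Kakeya_bound_perturb:
  fixes P Q :: "nat \<Rightarrow> (real ^ 'n) \<Rightarrow>\<^sub>L (real ^ 'n)"
  assumes K: "Kakeya_bound m p \<epsilon> P \<nu> C" and PQ: "\<forall>j\<in>{1..m}. dist (Q j) (P j) + \<nu>' \<le> \<nu>" and C: "C \<le> C'"
  shows "Kakeya_bound m p \<epsilon> Q \<nu>' C'"
  unfolding Kakeya_bound_def
proof (intro allI impI, elim conjE)
  fix \<delta> :: real and \<A> :: "nat \<Rightarrow> (real ^ 'n) set set"
  assume \<delta>: "0 < \<delta>" "\<delta> \<le> 1" and \<A>: "\<forall>j\<in>{1..m}. finite (\<A> j) \<and> (\<forall>A\<in>\<A> j. \<exists>W. subspace W \<and>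
    dist (proj W) (Q j) \<le> \<nu>' \<and> (\<forall>a\<in>A. \<forall>a'\<in>A. a - a' \<in> W))"
  let ?P = "\<Prod>j\<in>{1..m}. nnpow (real (card (\<A> j))) (p j)"
  have "(\<Sum>z\<in>cells \<delta>. mult_product m p \<A> \<delta> z) \<le> C * \<delta> powr - \<epsilon> * ?P"
  proof (rule Kakeya_boundD[OF K \<delta>])
    fix j assume j: "j \<in> {1..m}"
    show "finite (\<A> j)" using \<A> j by blast
    fix A assume "A \<in> \<A> j"
    then obtain W where W: "subspace W" "dist (proj W) (Q j) \<le> \<nu>'" "\<forall>a\<in>A. \<forall>a'\<in>A. a - a' \<in> W"
      using \<A> j by blast
    have "dist (proj W) (P j) \<le> \<nu>"
      using dist_triangle[of "proj W" "P j" "Q j"] W(2) PQ j by fastforce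
    with W show "\<exists>W. subspace W \<and> dist (proj W) (P j) \<le> \<nu> \<and> (\<forall>a\<in>A. \<forall>a'\<in>A. a - a' \<in> W)" by blast
  qed
  also have "\<dots> \<le> C' * \<delta> powr - \<epsilon> * ?P"
    using C by (intro mult_right_mono prod_nonneg) (auto simp: nnpow_nonneg)
  finally show "(\<Sum>z\<in>cells \<delta>. mult_product m p \<A> \<delta> z) \<le> C' * \<delta> powr - \<epsilon> * ?P" .
qed

text \<open>If \<open>a - a'\<close> lies in a subspace \<open>W'\<close>, its projection to the complement of \<open>W j\<close> is the difference of
  the projections to \<open>W'\<close> and to \<open>W j\<close>, so closeness of the two subspaces is the angle condition of
  the discrete inequality.\<close>

lemma Kakeya_bound_exists:
  fixes W :: "nat \<Rightarrow> (real ^ 'n) set"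
  assumes W: "\<forall>j\<in>{1..m}. subspace (W j)" and cond: "BL_condition m (\<lambda>j. (W j)\<^sup>\<bottom>) p"
    and p: "\<forall>j\<in>{1..m}. 0 \<le> p j" and \<epsilon>: "0 < \<epsilon>"
  shows "\<exists>\<nu>>0. \<exists>C\<ge>0. Kakeya_bound m p \<epsilon> (\<lambda>j. proj (W j)) \<nu> C"
proof -
  have U: "\<forall>j\<in>{1..m}. subspace ((W j)\<^sup>\<bottom>)" by (simp add: subspace_orthogonal_comp)
  obtain \<nu> C where \<nu>: "0 < \<nu>" "0 \<le> C" and bound: "\<forall>\<delta> \<A>. 0 < \<delta> \<and> \<delta> \<le> 1 \<and>
      (\<forall>j\<in>{1..m}. finite (\<A> j) \<and>
        (\<forall>A\<in>\<A> j. \<forall>a\<in>A. \<forall>a'\<in>A. norm (orth_proj ((W j)\<^sup>\<bottom>) (a - a')) \<le> \<nu> * norm (a - a'))) \<longrightarrow>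
      (\<Sum>z\<in>cells \<delta>. mult_product m p \<A> \<delta> z)
        \<le> C * \<delta> powr - \<epsilon> * (\<Prod>j\<in>{1..m}. nnpow (real (card (\<A> j))) (p j))"
    using discrete_Kakeya[OF cond p U \<epsilon>] by (elim exE conjE) (rule that; assumption)
  have "Kakeya_bound m p \<epsilon> (\<lambda>j. proj (W j)) \<nu> C"
    unfolding Kakeya_bound_def
  proof (intro allI impI, elim conjE)
    fix \<delta> :: real and \<A> :: "nat \<Rightarrow> (real ^ 'n) set set"
    assume \<delta>: "0 < \<delta>" "\<delta> \<le> 1" and \<A>: "\<forall>j\<in>{1..m}. finite (\<A> j) \<and> (\<forall>A\<in>\<A> j. \<exists>W'. subspace W' \<and>
      dist (proj W') (proj (W j)) \<le> \<nu> \<and> (\<forall>a\<in>A. \<forall>a'\<in>A. a - a' \<in> W'))"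
    show "(\<Sum>z\<in>cells \<delta>. mult_product m p \<A> \<delta> z)
        \<le> C * \<delta> powr - \<epsilon> * (\<Prod>j\<in>{1..m}. nnpow (real (card (\<A> j))) (p j))"
    proof (rule bound[rule_format], intro conjI ballI \<delta>)
      fix j assume j: "j \<in> {1..m}"
      show "finite (\<A> j)" using \<A> j by blast
      fix A a a' assume A: "A \<in> \<A> j" and a: "a \<in> A" "a' \<in> A"
      have Wj: "subspace (W j)" using W j by blast
      obtain W' where W': "subspace W'" "dist (proj W') (proj (W j)) \<le> \<nu>" "a - a' \<in> W'"
        using \<A> j A a by blast
      have "norm (orth_proj ((W j)\<^sup>\<bottom>) (a - a')) = norm (orth_proj W' (a - a') - orth_proj (W j) (a - a'))"
        by (simp add: orth_proj_comp[OF Wj] orth_proj_mem_eq[OF W'(1,3)])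
      also have "\<dots> \<le> dist (proj W') (proj (W j)) * norm (a - a')"
        by (rule norm_orth_proj_diff_le[OF W'(1) Wj])
      also have "\<dots> \<le> \<nu> * norm (a - a')" using W'(2) by (intro mult_right_mono) auto
      finally show "norm (orth_proj ((W j)\<^sup>\<bottom>) (a - a')) \<le> \<nu> * norm (a - a')" .
    qed
  qed
  with \<nu> show ?thesis by blast
qed

lemma compact_tuples:
  fixes S :: "nat \<Rightarrow> 'a::t2_space set"
  assumes "\<And>j. compact (S j)"
  shows "compact (PiE UNIV S)"
proof -
  have "compactin (product_topology (\<lambda>_. euclidean) UNIV) (PiE UNIV S)"
    using assms by (simp add: compactin_PiE)
  then show ?thesis by (simp add: euclidean_product_topology)
qed

text \<open>A bound at \<open>P\<close> with angle \<open>\<nu> P\<close> holds at all tuples within \<open>\<nu> P / 2\<close> of \<open>P\<close> with angle \<open>\<nu> P / 2\<close>.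
  Finitely many such neighbourhoods cover the compact set of tuples.\<close>

lemma Kakeya_bound_uniform:
  fixes S :: "nat \<Rightarrow> ((real ^ 'n) \<Rightarrow>\<^sub>L (real ^ 'n)) set"
  assumes S: "\<And>j. compact (S j)"
    and bound: "\<And>P. P \<in> PiE UNIV S \<Longrightarrow> \<exists>\<nu>>0. \<exists>C\<ge>0. Kakeya_bound m p \<epsilon> P \<nu> C"
  shows "\<exists>\<nu>>0. \<exists>C\<ge>0. \<forall>P\<in>PiE UNIV S. Kakeya_bound m p \<epsilon> P \<nu> C"
proof -
  obtain \<nu> C where \<nu>C: "\<And>P. P \<in> PiE UNIV S \<Longrightarrow> 0 < \<nu> P" "\<And>P. P \<in> PiE UNIV S \<Longrightarrow> 0 \<le> C P"
      "\<And>P. P \<in> PiE UNIV S \<Longrightarrow> Kakeya_bound m p \<epsilon> P (\<nu> P) (C P)"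
    using bound by metis
  define B where "B P = PiE UNIV (\<lambda>j. if j \<in> {1..m} then ball (P j) (\<nu> P / 2) else UNIV)" for P
  have B: "Q \<in> B P \<longleftrightarrow> (\<forall>j\<in>{1..m}. dist (P j) (Q j) < \<nu> P / 2)" for P Q
    by (auto simp: B_def PiE_iff)
  obtain F where F: "F \<subseteq> PiE UNIV S" "finite F" "PiE UNIV S \<subseteq> (\<Union>P\<in>F. B P)"
  proof (rule compactE_image[OF compact_tuples[of S], of "PiE UNIV S" B])
    show "compact (S j)" for j by (rule S)
    show "open (B P)" for P
      unfolding B_def
    proof (rule open_PiE)
      show "finite {i. (if i \<in> {1..m} then ball (P i) (\<nu> P / 2) else UNIV) \<noteq> UNIV}"
        by (rule finite_subset[of _ "{1..m}"]) auto
    qed simp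
    show "PiE UNIV S \<subseteq> (\<Union>P\<in>PiE UNIV S. B P)" using \<nu>C(1) B by fastforce
  qed
  define \<nu>' where "\<nu>' = Min (insert 1 ((\<lambda>P. \<nu> P / 2) ` F))"
  define C' where "C' = Max (insert 0 (C ` F))"
  have "0 < \<nu>'" using F \<nu>C(1) unfolding \<nu>'_def by (subst Min_gr_iff) auto
  moreover have "\<nu>' \<le> \<nu> P / 2" if "P \<in> F" for P
    unfolding \<nu>'_def using that F(2) by (intro Min_le) auto
  ultimately have \<nu>': "0 < \<nu>'" "\<And>P. P \<in> F \<Longrightarrow> \<nu>' \<le> \<nu> P / 2" by blast+
  have "0 \<le> C'" unfolding C'_def using F(2) by (intro Max_ge) auto
  moreover have "C P \<le> C'" if "P \<in> F" for P
    unfolding C'_def using that F(2) by (intro Max_ge) auto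
  ultimately have C': "0 \<le> C'" "\<And>P. P \<in> F \<Longrightarrow> C P \<le> C'" by blast+
  have "Kakeya_bound m p \<epsilon> Q \<nu>' C'" if Q: "Q \<in> PiE UNIV S" for Q
  proof -
    obtain P where P: "P \<in> F" "Q \<in> B P" using F(3) Q by blast
    have "Kakeya_bound m p \<epsilon> P (\<nu> P) (C P)" using \<nu>C(3) F P by blast
    then show ?thesis
    proof (rule Kakeya_bound_perturb)
      show "\<forall>j\<in>{1..m}. dist (Q j) (P j) + \<nu>' \<le> \<nu> P"
      proof
        fix j assume "j \<in> {1..m}"
        with P(2) have "dist (P j) (Q j) < \<nu> P / 2" unfolding B by blast
        then show "dist (Q j) (P j) + \<nu>' \<le> \<nu> P" using \<nu>'(2)[OF P(1)] by (simp add: dist_commute)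
      qed
    qed (rule C'(2)[OF P(1)])
  qed
  with \<nu>' C' show ?thesis by blast
qed

text \<open>The angle \<open>\<nu>0\<close> is the one up to which the dimension condition is stable. For a given \<open>\<epsilon>\<close>, all
  tuples of directions within \<open>\<nu>0\<close> have a bound with a common, possibly much smaller, angle \<open>\<nu>\<close>.
  Each family is split into finitely many classes of directions that agree up to \<open>\<nu>\<close>. As the exponents
  are at most \<open>1\<close>, the multiplicity product is at most the sum of the products over all choices of one
  class for each \<open>j\<close>, and each choice is covered by a bound.\<close>

theorem Kakeya_bound_fixed_angle:
  fixes V :: "nat \<Rightarrow> (real ^ 'n) set"
  assumes V: "\<forall>j\<in>{1..m}. subspace (V j)" and cond: "BL_condition m (\<lambda>j. (V j)\<^sup>\<bottom>) p"
    and p: "\<forall>j\<in>{1..m}. 0 \<le> p j \<and> p j \<le> 1"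
  shows "\<exists>\<nu>>0. \<forall>\<epsilon>>0. \<exists>C\<ge>0. Kakeya_bound m p \<epsilon> (\<lambda>j. proj (V j)) \<nu> C"
proof -
  have p0: "\<forall>j\<in>{1..m}. 0 \<le> p j" using p by blast
  have "\<forall>j\<in>{1..m}. subspace ((V j)\<^sup>\<bottom>)" by (simp add: subspace_orthogonal_comp)
  then obtain \<nu>1 where \<nu>1: "0 < \<nu>1" "\<And>U'. \<forall>j\<in>{1..m}. subspace (U' j) \<and> dist (proj (U' j)) (proj ((V j)\<^sup>\<bottom>)) < \<nu>1
      \<Longrightarrow> BL_condition m U' p"
    using BL_condition_stable[OF cond p0] by blast
  define \<nu>0 where "\<nu>0 = \<nu>1 / 2"
  have \<nu>0: "0 < \<nu>0" "\<nu>0 < \<nu>1" using \<nu>1(1) by (auto simp: \<nu>0_def)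
  define S where "S j = (if j \<in> {1..m} then Grassmannian \<inter> cball (proj (V j)) \<nu>0 else {0})" for j
  have S: "compact (S j)" for j
    by (auto simp: S_def intro!: compact_Int_closed compact_Grassmannian)
  show ?thesis
  proof (rule exI[of _ \<nu>0], intro conjI allI impI \<nu>0)
    fix \<epsilon> :: real assume \<epsilon>: "0 < \<epsilon>"
    have "\<exists>\<nu>>0. \<exists>C\<ge>0. \<forall>P\<in>PiE UNIV S. Kakeya_bound m p \<epsilon> P \<nu> C"
    proof (rule Kakeya_bound_uniform[OF S])
      fix P assume P: "P \<in> PiE UNIV S"
      have "\<exists>W. subspace W \<and> P j = proj W \<and> dist (proj W) (proj (V j)) \<le> \<nu>0" if "j \<in> {1..m}" for j
        using PiE_mem[OF P, of j] that by (auto simp: S_def Grassmannian_def dist_commute)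
      then obtain W where W: "\<And>j. j \<in> {1..m} \<Longrightarrow> subspace (W j)" "\<And>j. j \<in> {1..m} \<Longrightarrow> P j = proj (W j)"
          "\<And>j. j \<in> {1..m} \<Longrightarrow> dist (proj (W j)) (proj (V j)) \<le> \<nu>0" by metis
      have "BL_condition m (\<lambda>j. (W j)\<^sup>\<bottom>) p"
      proof (rule \<nu>1(2), intro ballI conjI subspace_orthogonal_comp)
        fix j assume j: "j \<in> {1..m}"
        have "dist (proj ((W j)\<^sup>\<bottom>)) (proj ((V j)\<^sup>\<bottom>)) = dist (proj (W j)) (proj (V j))"
          using V W j by (intro dist_proj_comp) auto
        also have "\<dots> < \<nu>1" using W(3)[OF j] \<nu>0 by linarith
        finally show "dist (proj ((W j)\<^sup>\<bottom>)) (proj ((V j)\<^sup>\<bottom>)) < \<nu>1" .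
      qed
      then obtain \<nu> C where "0 < \<nu>" "0 \<le> C" and K: "Kakeya_bound m p \<epsilon> (\<lambda>j. proj (W j)) \<nu> C"
        using Kakeya_bound_exists[of m W p \<epsilon>] W p0 \<epsilon> by blast
      moreover have "Kakeya_bound m p \<epsilon> P \<nu> C"
        using K by (rule Kakeya_bound_perturb) (auto simp: W(2))
      ultimately show "\<exists>\<nu>>0. \<exists>C\<ge>0. Kakeya_bound m p \<epsilon> P \<nu> C" by blast
    qed
    then obtain \<nu> C where \<nu>: "0 < \<nu>" and C: "0 \<le> C"
      and bound: "\<And>P. P \<in> PiE UNIV S \<Longrightarrow> Kakeya_bound m p \<epsilon> P \<nu> C" by blast
    have "\<exists>F. F \<subseteq> S j \<and> finite F \<and> S j \<subseteq> (\<Union>P\<in>F. ball P \<nu>)" for j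
      by (rule compactE_image[OF S, of "S j" "\<lambda>P. ball P \<nu>"]) (use \<nu> in auto)
    then obtain F where F: "\<And>j. F j \<subseteq> S j" "\<And>j. finite (F j)" "\<And>j. S j \<subseteq> (\<Union>P\<in>F j. ball P \<nu>)" by metis
    define M where "M = real (card (PiE {1..m} F))"
    have finPiE: "finite (PiE {1..m} F)" using F by (intro finite_PiE) auto
    show "\<exists>C\<ge>0. Kakeya_bound m p \<epsilon> (\<lambda>j. proj (V j)) \<nu>0 C"
    proof (intro exI[of _ "M * C"] conjI)
      show "0 \<le> M * C" using C by (simp add: M_def)
      show "Kakeya_bound m p \<epsilon> (\<lambda>j. proj (V j)) \<nu>0 (M * C)"
        unfolding Kakeya_bound_def
      proof (intro allI impI, elim conjE)
        fix \<delta> :: real and \<A> :: "nat \<Rightarrow> (real ^ 'n) set set"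
        assume \<delta>: "0 < \<delta>" "\<delta> \<le> 1" and \<A>: "\<forall>j\<in>{1..m}. finite (\<A> j) \<and> (\<forall>A\<in>\<A> j. \<exists>W. subspace W \<and>
          dist (proj W) (proj (V j)) \<le> \<nu>0 \<and> (\<forall>a\<in>A. \<forall>a'\<in>A. a - a' \<in> W))"
        let ?P = "\<Prod>j\<in>{1..m}. nnpow (real (card (\<A> j))) (p j)"
        have "\<exists>Q W. Q \<in> F j \<and> subspace W \<and> dist (proj W) Q \<le> \<nu> \<and> (\<forall>a\<in>A. \<forall>a'\<in>A. a - a' \<in> W)"
          if j: "j \<in> {1..m}" and A: "A \<in> \<A> j" for j A
        proof -
          obtain W where W: "subspace W" "dist (proj W) (proj (V j)) \<le> \<nu>0" "\<forall>a\<in>A. \<forall>a'\<in>A. a - a' \<in> W"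
            using \<A> j A by blast
          have "proj W \<in> S j" using W j by (auto simp: S_def Grassmannian_def dist_commute)
          then obtain Q where "Q \<in> F j" "dist (proj W) Q \<le> \<nu>" using F(3)[of j] by (force simp: dist_commute)
          with W show ?thesis by blast
        qed
        then obtain cl where cl: "\<And>j A. j \<in> {1..m} \<Longrightarrow> A \<in> \<A> j \<Longrightarrow> cl j A \<in> F j"
          "\<And>j A. j \<in> {1..m} \<Longrightarrow> A \<in> \<A> j \<Longrightarrow>
             \<exists>W. subspace W \<and> dist (proj W) (cl j A) \<le> \<nu> \<and> (\<forall>a\<in>A. \<forall>a'\<in>A. a - a' \<in> W)"
          by metis
        define \<A>' where "\<A>' g j = {A\<in>\<A> j. cl j A = g j}" for g j
        have split: "mult_product m p \<A> \<delta> z \<le> (\<Sum>g\<in>PiE {1..m} F. mult_product m p (\<A>' g) \<delta> z)" for z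
        proof -
          have "nnpow (real (card {A\<in>\<A> j. near \<delta> z A})) (p j)
              \<le> (\<Sum>q\<in>F j. nnpow (real (card {A\<in>{A\<in>\<A> j. cl j A = q}. near \<delta> z A})) (p j))"
            if j: "j \<in> {1..m}" for j
          proof -
            have fin: "finite {A\<in>\<A> j. near \<delta> z A}" using \<A> j by auto
            have "card {A\<in>\<A> j. near \<delta> z A} = (\<Sum>q\<in>F j. card {A\<in>{A\<in>\<A> j. near \<delta> z A}. cl j A = q})"
              using sum.group[OF fin F(2)[of j], of "cl j" "\<lambda>_. 1 :: nat"] cl(1)[OF j] by (auto simp: image_subset_iff)
            also have "\<dots> = (\<Sum>q\<in>F j. card {A\<in>{A\<in>\<A> j. cl j A = q}. near \<delta> z A})"
              by (intro sum.cong refl arg_cong[where f = card]) auto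
            finally have eq: "real (card {A\<in>\<A> j. near \<delta> z A})
                = (\<Sum>q\<in>F j. real (card {A\<in>{A\<in>\<A> j. cl j A = q}. near \<delta> z A}))" by simp
            have "proj (V j) \<in> S j" using V j \<nu>0 by (auto simp: S_def Grassmannian_def)
            then have "F j \<noteq> {}" using F(3)[of j] by auto
            then show ?thesis unfolding eq using F(2) p j by (intro nnpow_sum_le) auto
          qed
          then have "mult_product m p \<A> \<delta> z
              \<le> (\<Prod>j\<in>{1..m}. \<Sum>q\<in>F j. nnpow (real (card {A\<in>{A\<in>\<A> j. cl j A = q}. near \<delta> z A})) (p j))"
            unfolding mult_product_def by (intro prod_mono) (auto simp: nnpow_nonneg)
          also have "\<dots> = (\<Sum>g\<in>PiE {1..m} F. mult_product m p (\<A>' g) \<delta> z)"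
            unfolding mult_product_def \<A>'_def
            by (rule prod_sum_PiE) (use F in auto)
          finally show ?thesis .
        qed
        have each: "(\<Sum>z\<in>cells \<delta>. mult_product m p (\<A>' g) \<delta> z) \<le> C * \<delta> powr - \<epsilon> * ?P"
          if g: "g \<in> PiE {1..m} F" for g
        proof -
          \<comment> \<open>Outside \<open>{1..m}\<close> tuples are normalised to \<open>0\<close>, so that the set of tuples is compact.\<close>
          define P where "P j = (if j \<in> {1..m} then g j else 0)" for j
          have "P j \<in> S j" for j
          proof (cases "j \<in> {1..m}")
            case True
            then have "g j \<in> F j" by (rule PiE_mem[OF g])
            then show ?thesis using F(1)[of j] True by (auto simp: P_def)
          next
            case False
            then show ?thesis by (auto simp: P_def S_def)
          qed
          then have PS: "P \<in> PiE UNIV S" by (simp add: PiE_iff)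
          from bound[OF PS] have "(\<Sum>z\<in>cells \<delta>. mult_product m p (\<A>' g) \<delta> z)
              \<le> C * \<delta> powr - \<epsilon> * (\<Prod>j\<in>{1..m}. nnpow (real (card (\<A>' g j))) (p j))"
          proof (rule Kakeya_boundD[OF _ \<delta>])
            fix j assume j: "j \<in> {1..m}"
            show "finite (\<A>' g j)" using \<A> j by (simp add: \<A>'_def)
            fix A assume "A \<in> \<A>' g j"
            then have "A \<in> \<A> j" "cl j A = P j" using j by (auto simp: \<A>'_def P_def)
            then show "\<exists>W. subspace W \<and> dist (proj W) (P j) \<le> \<nu> \<and> (\<forall>a\<in>A. \<forall>a'\<in>A. a - a' \<in> W)"
              using cl(2)[OF j, of A] by simp
          qed
          also have "\<dots> \<le> C * \<delta> powr - \<epsilon> * ?P"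
          proof (intro mult_left_mono prod_mono conjI nnpow_nonneg nnpow_mono)
            fix j assume j: "j \<in> {1..m}"
            show "real (card (\<A>' g j)) \<le> real (card (\<A> j))"
              using \<A> j by (auto simp: \<A>'_def intro!: card_mono)
          qed (use p C in auto)
          finally show ?thesis .
        qed
        have "(\<Sum>z\<in>cells \<delta>. mult_product m p \<A> \<delta> z)
            \<le> (\<Sum>z\<in>cells \<delta>. \<Sum>g\<in>PiE {1..m} F. mult_product m p (\<A>' g) \<delta> z)"
          by (intro sum_mono split)
        also have "\<dots> = (\<Sum>g\<in>PiE {1..m} F. \<Sum>z\<in>cells \<delta>. mult_product m p (\<A>' g) \<delta> z)"
          by (rule sum.swap)
        also have "\<dots> \<le> (\<Sum>g\<in>PiE {1..m} F. C * \<delta> powr - \<epsilon> * ?P)" by (intro sum_mono each)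
        also have "\<dots> = M * C * \<delta> powr - \<epsilon> * ?P" by (simp add: M_def)
        finally show "(\<Sum>z\<in>cells \<delta>. mult_product m p \<A> \<delta> z) \<le> M * C * \<delta> powr - \<epsilon> * ?P" .
      qed
    qed
  qed
qed

section \<open>From cells to the integral\<close>

definition grid_cube :: "real \<Rightarrow> ('n \<Rightarrow> int) \<Rightarrow> (real ^ 'n) set" where
  "grid_cube \<delta> z = cbox (\<delta> *\<^sub>R ivec z) (\<delta> *\<^sub>R (ivec z + (\<chi> i. 1)))"

lemma emeasure_grid_cube:
  fixes z :: "'n::finite \<Rightarrow> int"
  assumes "0 < \<delta>"
  shows "emeasure lborel (grid_cube \<delta> z) = ennreal (\<delta> ^ CARD('n))"
proof -
  let ?a = "\<delta> *\<^sub>R ivec z :: real ^ 'n" and ?b = "\<delta> *\<^sub>R (ivec z + (\<chi> i. 1)) :: real ^ 'n"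
  have "cbox ?a ?b \<noteq> {}"
    using assms by (auto simp: interval_ne_empty_cart ivec_def)
  then have "measure lborel (cbox ?a ?b) = (\<Prod>i\<in>UNIV. ?b $ i - ?a $ i)" by (rule content_cbox_cart)
  also have "\<dots> = \<delta> ^ CARD('n)" by (simp add: algebra_simps)
  finally have "measure lborel (grid_cube \<delta> z) = \<delta> ^ CARD('n)" by (simp add: grid_cube_def)
  then show ?thesis using emeasure_eq_ennreal_measure[of lborel "grid_cube \<delta> z"]
    by (simp add: grid_cube_def emeasure_lborel_cbox_eq)
qed

lemma mem_grid_cube:
  fixes x :: "real ^ 'n"
  assumes "0 < \<delta>"
  shows "x \<in> grid_cube \<delta> (rnd ((1 / \<delta>) *\<^sub>R x))"
proof -
  have "\<delta> * of_int \<lfloor>x $ i / \<delta>\<rfloor> \<le> x $ i \<and> x $ i \<le> \<delta> * (of_int \<lfloor>x $ i / \<delta>\<rfloor> + 1)" for i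
  proof -
    show ?thesis
      using floor_divide_lower[OF assms, of "x $ i"] floor_divide_upper[OF assms, of "x $ i"]
      by (simp add: mult.commute)
  qed
  then show ?thesis by (simp add: grid_cube_def mem_box_cart ivec_def rnd_apply)
qed

lemma near_of_mem_nbhd:
  fixes x :: "real ^ 'n"
  assumes \<delta>: "0 < \<delta>" and x: "x \<in> nbhd \<delta> A"
  shows "near \<delta> (rnd ((1 / \<delta>) *\<^sub>R x)) A"
proof -
  let ?y = "(1 / \<delta>) *\<^sub>R x"
  obtain a where a: "a \<in> A" "norm (a - x) < \<delta>" using x by (auto simp: nbhd_def dist_norm)
  have "rnd (ivec (rnd ?y) :: real ^ 'n) = rnd ?y" by (simp add: fun_eq_iff rnd_apply ivec_def)
  then have "norm (?y - ivec (rnd ?y)) \<le> real CARD('n)" by (intro norm_diff_le_if_rnd_eq) simp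
  then have "\<delta> * norm (?y - ivec (rnd ?y)) \<le> \<delta> * real CARD('n)" using \<delta> by (intro mult_left_mono) auto
  moreover have "x - \<delta> *\<^sub>R ivec (rnd ?y) = \<delta> *\<^sub>R (?y - ivec (rnd ?y))" using \<delta> by (simp add: scaleR_diff_right)
  then have "norm (x - \<delta> *\<^sub>R ivec (rnd ?y)) = \<delta> * norm (?y - ivec (rnd ?y))" using \<delta> by simp
  ultimately have "norm (x - \<delta> *\<^sub>R ivec (rnd ?y)) \<le> \<delta> * real CARD('n)" by simp
  then have "norm (a - \<delta> *\<^sub>R ivec (rnd ?y)) \<le> (real CARD('n) + 1) * \<delta>"
    using a(2) norm_triangle_ineq[of "a - x" "x - \<delta> *\<^sub>R ivec (rnd ?y)"] by (simp add: algebra_simps)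
  with a(1) show ?thesis by (auto simp: near_def)
qed

lemma integral_le_sum_cells:
  fixes \<A> :: "nat \<Rightarrow> (real ^ 'n) set set"
  assumes \<delta>: "0 < \<delta>" and p: "\<forall>j\<in>{1..m}. 0 \<le> p j" and fin: "\<forall>j\<in>{1..m}. finite (\<A> j)"
    and inj: "\<forall>j\<in>{1..m}. inj_on (nbhd \<delta>) (\<A> j)"
  shows "(\<integral>\<^sup>+ x \<in> {x. \<forall>i. -1 \<le> x $ i \<and> x $ i \<le> 1}.
      ennreal (\<Prod>j\<in>{1..m}. nnpow (\<Sum>S\<in>nbhd \<delta> ` \<A> j. indicator S x) (p j)) \<partial>lborel)
    \<le> ennreal (\<delta> ^ CARD('n) * (\<Sum>z\<in>cells \<delta>. mult_product m p \<A> \<delta> z))"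
proof -
  let ?Z = "cells \<delta> :: ('n \<Rightarrow> int) set"
  have finZ: "finite ?Z" using card_cells_le(1)[OF \<delta>] .
  have m0: "0 \<le> mult_product m p \<A> \<delta> z" for z
    unfolding mult_product_def by (intro prod_nonneg) (simp add: nnpow_nonneg)
  have "(\<integral>\<^sup>+ x \<in> {x. \<forall>i. -1 \<le> x $ i \<and> x $ i \<le> 1}.
      ennreal (\<Prod>j\<in>{1..m}. nnpow (\<Sum>S\<in>nbhd \<delta> ` \<A> j. indicator S x) (p j)) \<partial>lborel)
    \<le> (\<integral>\<^sup>+ x. (\<Sum>z\<in>?Z. ennreal (mult_product m p \<A> \<delta> z) * indicator (grid_cube \<delta> z) x) \<partial>lborel)"
  proof (rule nn_integral_mono)
    fix x :: "real ^ 'n"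
    let ?z = "rnd ((1 / \<delta>) *\<^sub>R x)"
    show "ennreal (\<Prod>j\<in>{1..m}. nnpow (\<Sum>S\<in>nbhd \<delta> ` \<A> j. indicator S x) (p j))
          * indicator {x. \<forall>i. -1 \<le> x $ i \<and> x $ i \<le> 1} x
        \<le> (\<Sum>z\<in>?Z. ennreal (mult_product m p \<A> \<delta> z) * indicator (grid_cube \<delta> z) x)"
    proof (cases "\<forall>i. -1 \<le> x $ i \<and> x $ i \<le> 1")
      case True
      then have z: "?z \<in> ?Z" by (auto simp: cells_def)
      have "(\<Prod>j\<in>{1..m}. nnpow (\<Sum>S\<in>nbhd \<delta> ` \<A> j. indicator S x) (p j)) \<le> mult_product m p \<A> \<delta> ?z"
        unfolding mult_product_def
      proof (intro prod_mono conjI nnpow_nonneg nnpow_mono)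
        fix j assume j: "j \<in> {1..m}"
        have "(\<Sum>S\<in>nbhd \<delta> ` \<A> j. indicator S x) = (\<Sum>A\<in>\<A> j. indicator (nbhd \<delta> A) x :: real)"
          using inj j by (subst sum.reindex) auto
        also have "\<dots> = real (card {A\<in>\<A> j. x \<in> nbhd \<delta> A})"
          using fin j by (simp add: indicator_def sum.If_cases Int_def)
        also have "\<dots> \<le> real (card {A\<in>\<A> j. near \<delta> ?z A})"
          using fin j near_of_mem_nbhd[OF \<delta>] by (auto intro!: card_mono)
        finally show "(\<Sum>S\<in>nbhd \<delta> ` \<A> j. indicator S x) \<le> real (card {A\<in>\<A> j. near \<delta> ?z A})" .
        show "0 \<le> (\<Sum>S\<in>nbhd \<delta> ` \<A> j. indicator S x :: real)" by (intro sum_nonneg) simp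
        show "0 \<le> p j" using p j by blast
      qed
      then have "ennreal (\<Prod>j\<in>{1..m}. nnpow (\<Sum>S\<in>nbhd \<delta> ` \<A> j. indicator S x) (p j))
          \<le> ennreal (mult_product m p \<A> \<delta> ?z) * indicator (grid_cube \<delta> ?z) x"
        using mem_grid_cube[OF \<delta>, of x] by (simp add: ennreal_leI)
      also have "\<dots> \<le> (\<Sum>z\<in>?Z. ennreal (mult_product m p \<A> \<delta> z) * indicator (grid_cube \<delta> z) x)"
        using z finZ by (intro member_le_sum) auto
      finally show ?thesis using True by simp
    qed simp
  qed
  also have "\<dots> = (\<Sum>z\<in>?Z. ennreal (mult_product m p \<A> \<delta> z) * ennreal (\<delta> ^ CARD('n)))"
  proof -
    have "grid_cube \<delta> z \<in> sets borel" for z :: "'n \<Rightarrow> int" by (simp add: grid_cube_def)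
    then show ?thesis
      by (subst nn_integral_sum) (simp_all add: nn_integral_cmult_indicator emeasure_grid_cube[OF \<delta>])
  qed
  also have "\<dots> = ennreal (\<delta> ^ CARD('n) * (\<Sum>z\<in>?Z. mult_product m p \<A> \<delta> z))"
    using \<delta> m0 by (simp add: ennreal_mult''[symmetric] sum_ennreal sum_distrib_left mult.commute)
  finally show ?thesis .
qed

theorem theorem1p2:
  fixes m :: nat and d :: "nat \<Rightarrow> nat"
    and L :: "nat \<Rightarrow> real ^ 'n \<Rightarrow> nat \<Rightarrow> real" and p :: "nat \<Rightarrow> real"
  assumes "BL_datum m d L p" and "BL_const m d L p < \<infinity>"
  shows "\<exists>\<nu>>0. \<forall>\<epsilon>::real. \<epsilon> > 0 \<longrightarrow> (\<exists>C::real. C \<ge> 0 \<and>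
    (\<forall>(\<delta>::real) (T :: nat \<Rightarrow> (real ^ 'n) set set). 0 < \<delta> \<and> \<delta> \<le> 1 \<and>
       (\<forall>j\<in>{1..m}. finite (T j) \<and> T j \<subseteq> tubes \<delta> (CARD('n) - d j) (ker (d j) (L j)) \<nu>) \<longrightarrow>
       (\<integral>\<^sup>+ x \<in> {x. \<forall>i. -1 \<le> x $ i \<and> x $ i \<le> 1}.
            ennreal (\<Prod>j\<in>{1..m}. nnpow (\<Sum>S\<in>T j. indicator S x) (p j)) \<partial>lborel)
         \<le> ennreal (C * \<delta> powr (real CARD('n) - \<epsilon>) *
              (\<Prod>j\<in>{1..m}. nnpow (real (card (T j))) (p j)))))"
proof -
  define V where "V j = ker (d j) (L j)" for j
  have L: "\<forall>j\<in>{1..m}. surj_linear_map (d j) (L j)" and p: "\<forall>j\<in>{1..m}. 0 \<le> p j \<and> p j \<le> 1"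
    using assms(1) by (auto simp: BL_datum_def)
  have V: "\<forall>j\<in>{1..m}. subspace (V j)" using L by (auto simp: V_def intro: subspace_ker)
  have cond: "BL_condition m (\<lambda>j. (V j)\<^sup>\<bottom>) p"
    unfolding V_def by (rule BL_condition_necessary[OF assms])
  obtain \<nu> where \<nu>: "0 < \<nu>" and bound: "\<And>\<epsilon>. 0 < \<epsilon> \<Longrightarrow> \<exists>C\<ge>0. Kakeya_bound m p \<epsilon> (\<lambda>j. proj (V j)) \<nu> C"
    using Kakeya_bound_fixed_angle[OF V cond p] by blast
  show ?thesis
    unfolding V_def[symmetric]
  proof (rule exI[of _ \<nu>], intro conjI allI impI \<nu>)
    fix \<epsilon> :: real assume "0 < \<epsilon>"
    from bound[OF this] obtain C where C: "0 \<le> C" "Kakeya_bound m p \<epsilon> (\<lambda>j. proj (V j)) \<nu> C" by blast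
    show "\<exists>C\<ge>0. \<forall>\<delta> T. 0 < \<delta> \<and> \<delta> \<le> 1 \<and>
       (\<forall>j\<in>{1..m}. finite (T j) \<and> T j \<subseteq> tubes \<delta> (CARD('n) - d j) (V j) \<nu>) \<longrightarrow>
       (\<integral>\<^sup>+ x \<in> {x. \<forall>i. -1 \<le> x $ i \<and> x $ i \<le> 1}.
            ennreal (\<Prod>j\<in>{1..m}. nnpow (\<Sum>S\<in>T j. indicator S x) (p j)) \<partial>lborel)
         \<le> ennreal (C * \<delta> powr (real CARD('n) - \<epsilon>) *
              (\<Prod>j\<in>{1..m}. nnpow (real (card (T j))) (p j)))"
    proof (intro exI[of _ C] conjI allI impI C(1), elim conjE)
      fix \<delta> :: real and T :: "nat \<Rightarrow> (real ^ 'n) set set"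
      assume \<delta>: "0 < \<delta>" "\<delta> \<le> 1"
        and T: "\<forall>j\<in>{1..m}. finite (T j) \<and> T j \<subseteq> tubes \<delta> (CARD('n) - d j) (V j) \<nu>"
      have "\<exists>A W. S = nbhd \<delta> A \<and> subspace W \<and> affine_parallel W A \<and> grassmann_dist W (V j) \<le> \<nu>"
        if "j \<in> {1..m}" "S \<in> T j" for j S
      proof -
        have "S \<in> tubes \<delta> (CARD('n) - d j) (V j) \<nu>" using T that by blast
        then show ?thesis unfolding tubes_def by blast
      qed
      then obtain core dir where core: "\<And>j S. j \<in> {1..m} \<Longrightarrow> S \<in> T j \<Longrightarrow> S = nbhd \<delta> (core j S)"
        "\<And>j S. j \<in> {1..m} \<Longrightarrow> S \<in> T j \<Longrightarrow> subspace (dir j S) \<and> affine_parallel (dir j S) (core j S)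
            \<and> grassmann_dist (dir j S) (V j) \<le> \<nu>"
        by metis
      \<comment> \<open>A tube is a set without a distinguished core; choosing one for each tube is injective.\<close>
      define \<A> where "\<A> j = core j ` T j" for j
      have TA: "nbhd \<delta> ` \<A> j = T j" if "j \<in> {1..m}" for j
        using core(1)[OF that] unfolding \<A>_def image_image by force
      have inj: "inj_on (nbhd \<delta>) (\<A> j)" if j: "j \<in> {1..m}" for j
      proof (rule inj_onI)
        fix A B assume "A \<in> \<A> j" "B \<in> \<A> j" "nbhd \<delta> A = nbhd \<delta> B"
        then show "A = B" using core(1)[OF j] unfolding \<A>_def by (metis imageE)
      qed
      have card: "card (\<A> j) = card (T j)" if "j \<in> {1..m}" for j
        using card_image[OF inj[OF that]] TA[OF that] by simp
      let ?P = "\<Prod>j\<in>{1..m}. nnpow (real (card (T j))) (p j)"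
      have K: "(\<Sum>z\<in>cells \<delta>. mult_product m p \<A> \<delta> z)
          \<le> C * \<delta> powr - \<epsilon> * (\<Prod>j\<in>{1..m}. nnpow (real (card (\<A> j))) (p j))"
      proof (rule Kakeya_boundD[OF C(2) \<delta>])
        fix j assume j: "j \<in> {1..m}"
        show "finite (\<A> j)" using T j by (auto simp: \<A>_def)
        fix A assume "A \<in> \<A> j"
        then obtain S where S: "S \<in> T j" "A = core j S" by (auto simp: \<A>_def)
        let ?W = "dir j S"
        have W: "subspace ?W" "affine_parallel ?W A" "grassmann_dist ?W (V j) \<le> \<nu>"
          using core(2)[OF j S(1)] S(2) by auto
        have "dist (proj ?W) (proj (V j)) \<le> \<nu>" using W V j by (simp add: dist_proj)
        moreover have "\<forall>a\<in>A. \<forall>a'\<in>A. a - a' \<in> ?W"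
          using W(1,2) by (auto simp: affine_parallel_def intro: subspace_diff)
        ultimately show "\<exists>W. subspace W \<and> dist (proj W) (proj (V j)) \<le> \<nu> \<and> (\<forall>a\<in>A. \<forall>a'\<in>A. a - a' \<in> W)"
          using W(1) by blast
      qed
      have "(\<integral>\<^sup>+ x \<in> {x. \<forall>i. -1 \<le> x $ i \<and> x $ i \<le> 1}.
            ennreal (\<Prod>j\<in>{1..m}. nnpow (\<Sum>S\<in>T j. indicator S x) (p j)) \<partial>lborel)
          = (\<integral>\<^sup>+ x \<in> {x. \<forall>i. -1 \<le> x $ i \<and> x $ i \<le> 1}.
            ennreal (\<Prod>j\<in>{1..m}. nnpow (\<Sum>S\<in>nbhd \<delta> ` \<A> j. indicator S x) (p j)) \<partial>lborel)"
      proof -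
        have "(\<Prod>j\<in>{1..m}. nnpow (\<Sum>S\<in>T j. indicator S x) (p j))
            = (\<Prod>j\<in>{1..m}. nnpow (\<Sum>S\<in>nbhd \<delta> ` \<A> j. indicator S x) (p j))" for x
          by (intro prod.cong refl) (simp only: TA)
        then show ?thesis by (simp only:)
      qed
      also have "\<dots> \<le> ennreal (\<delta> ^ CARD('n) * (\<Sum>z\<in>cells \<delta>. mult_product m p \<A> \<delta> z))"
        using p T inj by (intro integral_le_sum_cells \<delta>) (auto simp: \<A>_def)
      also have "\<dots> \<le> ennreal (\<delta> ^ CARD('n) * (C * \<delta> powr - \<epsilon> * ?P))"
      proof -
        have "(\<Prod>j\<in>{1..m}. nnpow (real (card (\<A> j))) (p j)) = ?P" by (intro prod.cong refl) (simp add: card)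
        then show ?thesis using K \<delta> by (intro ennreal_leI mult_left_mono) auto
      qed
      also have "\<delta> ^ CARD('n) * (C * \<delta> powr - \<epsilon> * ?P) = C * \<delta> powr (real CARD('n) - \<epsilon>) * ?P"
      proof -
        have "\<delta> powr (real CARD('n) - \<epsilon>) = \<delta> ^ CARD('n) * \<delta> powr - \<epsilon>"
          using \<delta> by (simp add: powr_diff powr_realpow powr_minus_divide)
        then show ?thesis by simp
      qed
      finally show "(\<integral>\<^sup>+ x \<in> {x. \<forall>i. -1 \<le> x $ i \<and> x $ i \<le> 1}.
            ennreal (\<Prod>j\<in>{1..m}. nnpow (\<Sum>S\<in>T j. indicator S x) (p j)) \<partial>lborel)
         \<le> ennreal (C * \<delta> powr (real CARD('n) - \<epsilon>) * ?P)" .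
    qed
  qed
qed

end
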